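(* (1) Every expansive minimal Cantor system of finite topological rank is topologically conjugate to a primitive recognizable $\mathcal S$-adic subshift with bounded alphabet rank. Moreover, the alphabet rank $AR(\boldsymbol\tau)$ of the corresponding directive sequence $\boldsymbol\tau$ is bounded by the topological rank of the minimal Cantor system. (2) Any primitive $\mathcal S$-adic subshift $(X,S)$ (so minimal) with bounded alphabet rank is a topological factor of a minimal Cantor system of finite topological rank, whose topological rank is bounded by $AR(X)^2$, the square of the alphabet rank of the subshift $X$. Moreover, when the $\mathcal S$-adic subshift is recognizable, the factor map is invertible and the subshift has finite topological rank.
   Context: A topological dynamical system $(X,T)$ is a compact metric space $X$ with a homeomorphism $T$; it is a minimal Cantor system if $X$ is a Cantor set and every orbit is dense. Factor maps are continuous, onto and equivariant; a bijective factor map is a topological conjugacy. $S$ denotes the shift map on two-sided sequences. Topological rank. A clopen Kakutani-Rohlin (CKR) partition of $X$ is a partition $\mathcal T=\{T^{-j}B(k):1\le k\le d,\ 0\le j<h(k)\}$ of $X$, where $B(1),\dots,B(d)$ are clopen, $h(k)\geq 1$ and $\bigcup_k T^{-h(k)}B(k)=\bigcup_k B(k)$; its base is $B(\mathcal T)=\bigcup_k B(k)$, and it has $d$ towers $\mathcal T(k)=\{T^{-j}B(k):0\le j<h(k)\}$. A sequence $(\mathcal T_n)_{n\ge0}$ of CKR partitions, $\mathcal T_n=\{T^{-j}B_n(k):1\le k\le d_n,0\le j<h_n(k)\}$, $\mathcal T_0=\{X\}$, is nested if for all $n$: $B(\mathcal T_{n+1})\subseteq B(\mathcal T_n)$; $\mathcal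 T_{n+1}$ refines $\mathcal T_n$; $\bigcap_n B(\mathcal T_n)$ is a single point; and the partitions $\mathcal T_n$ span the topology of $X$. It is primitive if for every $n\ge1$ there is $N>n$ such that every tower of $\mathcal T_N$ crosses every tower of $\mathcal T_n$ (i.e. the points of each $T^{-(h_N(k)-1)}B_N(k)$, iterated by $T$ until reaching $B_N(k)$, completely cross all towers of $\mathcal T_n$). A minimal Cantor system has finite topological rank if it admits a primitive nested sequence of CKR partitions with $d_n\le d$ for all $n$, for some $d$ (equivalently, a Bratteli-Vershik representation with at most $d$ vertices per level); the minimum such $d$ is its topological rank. $\mathcal S$-adic subshifts. A directive sequence is a sequence $\boldsymbol\tau=(\tau_n:\mathcal A_{n+1}^*\to\mathcal A_n^* )_{n\ge0}$ of non-erasing morphisms of free monoids over finite alphabets. For $n<N$, $\tau_{[n,N)}=\tau_n\circ\cdots\circ\tau_{N-1}$. $\boldsymbol\tau$ is primitive if for every $n$ there is $N>n$ such that for all $a\in\mathcal A_N$ the word $\tau_{[n,N)}(a)$ contains all letters of $\mathcal A_n$. $\mathcal L^{(n)}(\boldsymbol\tau)$ is the set of words occurring in $\tau_{[n,N)}(a)$ for some $N>n$, $a\in\mathcal A_N$; $X^{(n)}_{\boldsymbol\tau}$ is the subshift of all $x\in\mathcal A_n^{\mathbb Z}$ all of whose finite factors belong to $\mathcal L^{(n)}(\boldsymbol\tau)$; $X_{\boldsymbol\tau}=X^{(0)}_{\boldsymbol\tau}$ is the $\mathcal S$-adic subshift generated by $\boldsymbol\tau$. Alphabet rank. The alphabet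 rank of a directive sequence is $AR(\boldsymbol\tau)=\liminf_{n\to\infty}|\mathcal A_n|$. The alphabet rank of a subshift $X$ is $AR(X)=\inf\{AR(\boldsymbol\tau): X_{\boldsymbol\tau}=X\}$, the infimum running over all directive sequences $\boldsymbol\tau$ generating $X$ (and being $+\infty$ if there are none). An $\mathcal S$-adic subshift has bounded alphabet rank when its directive sequence $\boldsymbol\tau$ satisfies $AR(\boldsymbol\tau)<+\infty$ (so that, after composing consecutive morphisms, the alphabets can be taken bounded in size). Recognizability. A non-erasing morphism $\tau:\mathcal A^*\to\mathcal B^*$ (extended to $\mathcal A^{\mathbb Z}$ by concatenation, with $\tau(y_0)$ starting at coordinate $0$) is recognizable in $Y\subseteq\mathcal A^{\mathbb Z}$ if every $x\in\mathcal B^{\mathbb Z}$ has at most one pair $(k,y)$ with $y\in Y$, $0\le k<|\tau(y_0)|$ and $x=S^k\tau(y)$. $\boldsymbol\tau$ is recognizable if for every $n\ge0$, $\tau_n$ is recognizable in $X^{(n+1)}_{\boldsymbol\tau}$. An $\mathcal S$-adic subshift is called primitive (resp. recognizable) when the directive sequence generating it is primitive (resp. recognizable).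
   Formalization: In (2), AR(X) is the infimum over directive sequences generating X for which the least length of the words τ_[0,n)(a) tends to infinity (over all directive sequences the bound is false); the subshift X is assumed nonempty. *)

theory Defs
  imports "HOL-Analysis.Analysis" "HOL-Library.Extended_Nat" "HOL-Library.Sublist"
begin

section \<open>Topological dynamical systems\<close>

text \<open>A system is a subset \<open>X\<close> of a topological space, metrizable in its subspace topology, together
  with a map \<open>T\<close>, of which only the restriction to \<open>X\<close> matters. A metric is fixed only for
  expansivity.\<close>

definition topological_dynamical_system :: "'a::topological_space set \<Rightarrow> ('a \<Rightarrow> 'a) \<Rightarrow> bool" where
  "topological_dynamical_system X T \<longleftrightarrow>
     X \<noteq> {} \<and> compact X \<and> metrizable_space (top_of_set X) \<and> (\<exists>T'. homeomorphism X X T T')"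

definition iterate_int :: "'a set \<Rightarrow> ('a \<Rightarrow> 'a) \<Rightarrow> int \<Rightarrow> 'a \<Rightarrow> 'a" where
  "iterate_int X T n =
     (if 0 \<le> n then T ^^ nat n else (inv_into X T) ^^ nat (- n))"

definition minimal_system :: "'a::topological_space set \<Rightarrow> ('a \<Rightarrow> 'a) \<Rightarrow> bool" where
  "minimal_system X T \<longleftrightarrow> topological_dynamical_system X T \<and>
     (\<forall>x\<in>X. X \<subseteq> closure (range (\<lambda>n. iterate_int X T n x)))"

definition cantor_set :: "'a::topological_space set \<Rightarrow> bool" where
  "cantor_set X \<longleftrightarrow> X \<noteq> {} \<and> compact X \<and> metrizable_space (top_of_set X) \<and>
     (\<forall>x\<in>X. connected_component_set X x = {x}) \<and> (\<forall>x\<in>X. x islimpt X)"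

definition minimal_cantor_system :: "'a::topological_space set \<Rightarrow> ('a \<Rightarrow> 'a) \<Rightarrow> bool" where
  "minimal_cantor_system X T \<longleftrightarrow> cantor_set X \<and> minimal_system X T"

definition expansive :: "'a::metric_space set \<Rightarrow> ('a \<Rightarrow> 'a) \<Rightarrow> bool" where
  "expansive X T \<longleftrightarrow> (\<exists>\<delta>>0. \<forall>x\<in>X. \<forall>y\<in>X. x \<noteq> y \<longrightarrow>
     (\<exists>n. dist (iterate_int X T n x) (iterate_int X T n y) > \<delta>))"

definition factor_map ::
  "'a::topological_space set \<Rightarrow> ('a \<Rightarrow> 'a) \<Rightarrow> 'b::topological_space set \<Rightarrow> ('b \<Rightarrow> 'b) \<Rightarrow> ('a \<Rightarrow> 'b) \<Rightarrow> bool"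
  where
  "factor_map X T Y R \<pi> \<longleftrightarrow>
     continuous_on X \<pi> \<and> \<pi> ` X = Y \<and> (\<forall>x\<in>X. \<pi> (T x) = R (\<pi> x))"

definition topological_conjugacy ::
  "'a::topological_space set \<Rightarrow> ('a \<Rightarrow> 'a) \<Rightarrow> 'b::topological_space set \<Rightarrow> ('b \<Rightarrow> 'b) \<Rightarrow> ('a \<Rightarrow> 'b) \<Rightarrow> bool"
  where
  "topological_conjugacy X T Y R \<pi> \<longleftrightarrow> factor_map X T Y R \<pi> \<and> bij_betw \<pi> X Y"


section \<open>Clopen Kakutani-Rohlin partitions and topological rank\<close>

text \<open>\<open>tower_level X T B j\<close> is the set $T^{-j}B$. A CKR partition is given by the number \<open>d\<close> of
  its towers, which are indexed by \<open>k < d\<close>, and by the heights \<open>h k\<close> and bases \<open>B k\<close>.\<close>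

definition tower_level :: "'a set \<Rightarrow> ('a \<Rightarrow> 'a) \<Rightarrow> 'a set \<Rightarrow> nat \<Rightarrow> 'a set" where
  "tower_level X T B j = {x \<in> X. (T ^^ j) x \<in> B}"

definition ckr_atoms ::
  "'a set \<Rightarrow> ('a \<Rightarrow> 'a) \<Rightarrow> nat \<Rightarrow> (nat \<Rightarrow> nat) \<Rightarrow> (nat \<Rightarrow> 'a set) \<Rightarrow> 'a set set" where
  "ckr_atoms X T d h B = {tower_level X T (B k) j | k j. k < d \<and> j < h k}"

definition ckr_base :: "nat \<Rightarrow> (nat \<Rightarrow> 'a set) \<Rightarrow> 'a set" where
  "ckr_base d B = (\<Union>k<d. B k)"

definition ckr_partition ::
  "'a::topological_space set \<Rightarrow> ('a \<Rightarrow> 'a) \<Rightarrow> nat \<Rightarrow> (nat \<Rightarrow> nat) \<Rightarrow> (nat \<Rightarrow> 'a set) \<Rightarrow> bool" where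
  "ckr_partition X T d h B \<longleftrightarrow>
     (\<forall>k<d. B k \<noteq> {} \<and> openin (top_of_set X) (B k) \<and> closedin (top_of_set X) (B k) \<and> h k \<ge> 1) \<and>
     \<Union> (ckr_atoms X T d h B) = X \<and>
     disjoint_family_on (\<lambda>(k, j). tower_level X T (B k) j) (SIGMA k:{..<d}. {..<h k}) \<and>
     (\<Union>k<d. tower_level X T (B k) (h k)) = ckr_base d B"

definition nested_ckr ::
  "'a::topological_space set \<Rightarrow> ('a \<Rightarrow> 'a) \<Rightarrow>
   (nat \<Rightarrow> nat) \<Rightarrow> (nat \<Rightarrow> nat \<Rightarrow> nat) \<Rightarrow> (nat \<Rightarrow> nat \<Rightarrow> 'a set) \<Rightarrow> bool" where
  "nested_ckr X T d h B \<longleftrightarrow>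
     (\<forall>n. ckr_partition X T (d n) (h n) (B n)) \<and>
     ckr_atoms X T (d 0) (h 0) (B 0) = {X} \<and>
     (\<forall>n. ckr_base (d (Suc n)) (B (Suc n)) \<subseteq> ckr_base (d n) (B n)) \<and>
     (\<forall>n. \<forall>P\<in>ckr_atoms X T (d (Suc n)) (h (Suc n)) (B (Suc n)).
        \<exists>Q\<in>ckr_atoms X T (d n) (h n) (B n). P \<subseteq> Q) \<and>
     (\<exists>x. (\<Inter>n. ckr_base (d n) (B n)) = {x}) \<and>
     topology_generated_by (\<Union>n. ckr_atoms X T (d n) (h n) (B n)) = top_of_set X"

text \<open>A point climbs a tower from $T^{-(h-1)}B$ to the base $B$. The segment
  $x, Tx, \ldots, T^{h_N(k)-1}x$ starting at a point $x$ of $T^{-(h_N(k)-1)}B_N(k)$ completely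
  crosses the \<open>l\<close>-th tower of level \<open>n\<close> if it contains a point $T^i x$ of
  $T^{-(h_n(l)-1)}B_n(l)$ together with its next $h_n(l)-1$ iterates.\<close>

definition primitive_ckr ::
  "'a set \<Rightarrow> ('a \<Rightarrow> 'a) \<Rightarrow>
   (nat \<Rightarrow> nat) \<Rightarrow> (nat \<Rightarrow> nat \<Rightarrow> nat) \<Rightarrow> (nat \<Rightarrow> nat \<Rightarrow> 'a set) \<Rightarrow> bool" where
  "primitive_ckr X T d h B \<longleftrightarrow>
     (\<forall>n\<ge>1. \<exists>N>n. \<forall>k<d N. \<forall>l<d n. \<forall>x\<in>tower_level X T (B N k) (h N k - 1).
        \<exists>i. i + (h n l - 1) \<le> h N k - 1 \<and>
            (T ^^ i) x \<in> tower_level X T (B n l) (h n l - 1))"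

definition has_ckr_rank_at_most :: "'a::topological_space set \<Rightarrow> ('a \<Rightarrow> 'a) \<Rightarrow> nat \<Rightarrow> bool" where
  "has_ckr_rank_at_most X T r \<longleftrightarrow>
     (\<exists>d h B. nested_ckr X T d h B \<and> primitive_ckr X T d h B \<and> (\<forall>n. d n \<le> r))"

definition finite_topological_rank :: "'a::topological_space set \<Rightarrow> ('a \<Rightarrow> 'a) \<Rightarrow> bool" where
  "finite_topological_rank X T \<longleftrightarrow> (\<exists>r. has_ckr_rank_at_most X T r)"

text \<open>Only meaningful for systems of finite topological rank.\<close>

definition topological_rank :: "'a::topological_space set \<Rightarrow> ('a \<Rightarrow> 'a) \<Rightarrow> nat" where
  "topological_rank X T = (LEAST r. has_ckr_rank_at_most X T r)"


section \<open>Directive sequences and S-adic subshifts\<close>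

text \<open>Letters are natural numbers. A morphism of free monoids is given by the images of the letters.
  The library's topology on \<open>int \<Rightarrow> nat\<close> is the product of the discrete topologies.\<close>

definition shift :: "(int \<Rightarrow> 'l) \<Rightarrow> (int \<Rightarrow> 'l)" where
  "shift x = (\<lambda>i. x (i + 1))"

definition morphism_ext :: "('l \<Rightarrow> 'm list) \<Rightarrow> 'l list \<Rightarrow> 'm list" where
  "morphism_ext f w = concat (map f w)"

definition directive_sequence :: "(nat \<Rightarrow> nat set) \<Rightarrow> (nat \<Rightarrow> nat \<Rightarrow> nat list) \<Rightarrow> bool" where
  "directive_sequence A \<tau> \<longleftrightarrow>
     (\<forall>n. finite (A n) \<and> A n \<noteq> {} \<and> (\<forall>a\<in>A (Suc n). \<tau> n a \<noteq> [] \<and> set (\<tau> n a) \<subseteq> A n))"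

text \<open>$\tau_{[n,N)} = \tau_n \circ \cdots \circ \tau_{N-1}$\<close>

definition morphism_comp :: "(nat \<Rightarrow> nat \<Rightarrow> nat list) \<Rightarrow> nat \<Rightarrow> nat \<Rightarrow> nat list \<Rightarrow> nat list" where
  "morphism_comp \<tau> n N = foldr (\<lambda>i g. morphism_ext (\<tau> i) \<circ> g) [n..<N] id"

definition primitive_sequence :: "(nat \<Rightarrow> nat set) \<Rightarrow> (nat \<Rightarrow> nat \<Rightarrow> nat list) \<Rightarrow> bool" where
  "primitive_sequence A \<tau> \<longleftrightarrow>
     (\<forall>n. \<exists>N>n. \<forall>a\<in>A N. A n \<subseteq> set (morphism_comp \<tau> n N [a]))"

definition language_level ::
  "(nat \<Rightarrow> nat set) \<Rightarrow> (nat \<Rightarrow> nat \<Rightarrow> nat list) \<Rightarrow> nat \<Rightarrow> nat list set" where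
  "language_level A \<tau> n = {w. \<exists>N>n. \<exists>a\<in>A N. sublist w (morphism_comp \<tau> n N [a])}"

definition subshift_level ::
  "(nat \<Rightarrow> nat set) \<Rightarrow> (nat \<Rightarrow> nat \<Rightarrow> nat list) \<Rightarrow> nat \<Rightarrow> (int \<Rightarrow> nat) set" where
  "subshift_level A \<tau> n = {x. (\<forall>i. x i \<in> A n) \<and>
     (\<forall>i m. map (\<lambda>j. x (i + int j)) [0..<m] \<in> language_level A \<tau> n)}"

definition sadic_subshift ::
  "(nat \<Rightarrow> nat set) \<Rightarrow> (nat \<Rightarrow> nat \<Rightarrow> nat list) \<Rightarrow> (int \<Rightarrow> nat) set" where
  "sadic_subshift A \<tau> = subshift_level A \<tau> 0"


section \<open>Alphabet rank\<close>

definition alphabet_rank :: "(nat \<Rightarrow> nat set) \<Rightarrow> enat" where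
  "alphabet_rank A = liminf (\<lambda>n. enat (card (A n)))"

definition everywhere_growing :: "(nat \<Rightarrow> nat set) \<Rightarrow> (nat \<Rightarrow> nat \<Rightarrow> nat list) \<Rightarrow> bool" where
  "everywhere_growing A \<tau> \<longleftrightarrow>
     filterlim (\<lambda>n. MIN a\<in>A n. length (morphism_comp \<tau> 0 n [a])) at_top sequentially"

text \<open>Only everywhere growing directive sequences compete in the infimum (a primitive sequence
  generating a nonempty subshift is everywhere growing). Without this restriction the notion
  degenerates: if $x_0x_1x_2\ldots$ is the right half of a point of a minimal
  subshift \<open>X\<close> over $\{0,1\}$, then the constant alphabets $\{0,1,2\}$ with $\tau_n(0)=0$,
  $\tau_n(1)=1$, $\tau_n(2)=x_n2$ generate \<open>X\<close>, so that every such \<open>X\<close> would have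
  alphabet rank at most 3.\<close>

definition subshift_alphabet_rank :: "(int \<Rightarrow> nat) set \<Rightarrow> enat" where
  "subshift_alphabet_rank X =
     Inf {alphabet_rank A | A \<tau>.
            directive_sequence A \<tau> \<and> everywhere_growing A \<tau> \<and> sadic_subshift A \<tau> = X}"


section \<open>Recognizability\<close>

text \<open>\<open>cut_position f y k\<close> is the coordinate at which the image of the letter \<open>y k\<close> starts when
  \<open>f\<close> is applied to \<open>y\<close> by concatenation, the image of \<open>y 0\<close> starting at coordinate 0;
  one of the two sums is always empty.\<close>

definition cut_position :: "('l \<Rightarrow> 'm list) \<Rightarrow> (int \<Rightarrow> 'l) \<Rightarrow> int \<Rightarrow> int" where
  "cut_position f y k =
     (\<Sum>j\<in>{0..<k}. int (length (f (y j)))) - (\<Sum>j\<in>{k..<0}. int (length (f (y j))))"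

definition biinfinite_ext :: "('l \<Rightarrow> 'm list) \<Rightarrow> (int \<Rightarrow> 'l) \<Rightarrow> (int \<Rightarrow> 'm)" where
  "biinfinite_ext f y = (\<lambda>i.
     let k = (THE k. cut_position f y k \<le> i \<and> i < cut_position f y (k + 1))
     in f (y k) ! nat (i - cut_position f y k))"

definition recognizable_in ::
  "'m set \<Rightarrow> ('l \<Rightarrow> 'm list) \<Rightarrow> (int \<Rightarrow> 'l) set \<Rightarrow> bool" where
  "recognizable_in B f Y \<longleftrightarrow>
     (\<forall>x. (\<forall>i. x i \<in> B) \<longrightarrow>
        Uniq (\<lambda>(k::nat, y). y \<in> Y \<and> k < length (f (y 0)) \<and> x = (shift ^^ k) (biinfinite_ext f y)))"

definition recognizable_sequence :: "(nat \<Rightarrow> nat set) \<Rightarrow> (nat \<Rightarrow> nat \<Rightarrow> nat list) \<Rightarrow> bool" where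
  "recognizable_sequence A \<tau> \<longleftrightarrow>
     (\<forall>n. recognizable_in (A n) (\<tau> n) (subshift_level A \<tau> (Suc n)))"

end

theory Submission
  imports Defs
begin

text \<open>Let \<open>X\<close> be a primitive S-adic subshift of alphabet rank \<open>r\<close>. For infinitely many \<open>n\<close> all its points factor
  into the at most \<open>r\<close> words $\tau_{[0,n)}(a)$, which are long. Cutting each of them at an occurrence of a
  fixed context yields at most \<open>r\<^sup>2\<close> words, one for each pair of consecutive words, into which all
  points factor with all cuts inside a prescribed small clopen set. Among the families of at most
  \<open>r\<^sup>2\<close> words with this property take one of minimal total length. If a point had two factorizations,
  they would give either a word that is a prefix or suffix of another one, or a nontrivial relation,
  and a defect theorem would give a shorter family. So the factorization is unique, the set of points
  with a cut at 0 is clopen, and the words are the towers of a Kakutani-Rohlin partition. Choosing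
  the next context inside the base found so far gives a nested sequence, which is primitive as soon
  as \<open>X\<close> is infinite. A finite \<open>X\<close> is a factor of an odometer, and cannot be recognizable because
  recognizability gives \<open>X\<close> at least $|\tau_{[0,n)}(a)|$ points for some letter $a$ of each level $n$.

  Conversely, given nested partitions of an expansive system, code the points by the atoms of a
  partition of small diameter, and let the morphisms list the towers of one level that are crossed
  by each tower of the next one. The entries of an orbit into the towers of level \<open>n\<close> form an orbit of a
  first return map, and by compactness the points of $X^{(n)}$ are the itineraries for this map. An
  itinerary determines its point by expansivity, and a point determines its last entry into a tower
  of the next level; this is recognizability.\<close>

section \<open>Factorizations of two-sided sequences\<close>

text \<open>The obstacle is that the morphisms of a primitive sequence need not be recognizable: the
  words of a level may factor a point in several ways and then do not define towers. Minimality of a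
  family of words replaces recognizability. The number of words is a constraint, their total length
  is minimized, and every ambiguity yields a shorter family within the constraint. Words may only be
  split where the pieces again begin at admissible places; this is recorded by a predicate
  \<open>F\<close> on letters, and it survives because each splitting point starts a word of one of
  the competing factorizations. What is factored is not the point but its image under a block code
  whose letters carry the previous label, a window of the point and the membership in the context.
  Thus a unique factorization at once gives towers that refine the previous ones and separate
  points. Cutting inside the words, at the price of the square, is what places all cuts in one small
  cylinder, so that the bases shrink to a point.\<close>

definition segment :: "(int \<Rightarrow> 'b) \<Rightarrow> int \<Rightarrow> int \<Rightarrow> 'b list" where
  "segment s a b = map (\<lambda>i. s (a + int i)) [0..<nat (b - a)]"

lemma length_segment [simp]: "length (segment s a b) = nat (b - a)"
  by (simp add: segment_def)

lemma nth_segment [simp]: "i < nat (b - a) \<Longrightarrow> segment s a b ! i = s (a + int i)"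
  by (simp add: segment_def)

lemma segment_self [simp]: "segment s a a = []"
  by (simp add: segment_def)

lemma segment_append:
  assumes "a \<le> b" "b \<le> c"
  shows "segment s a b @ segment s b c = segment s a c"
  by (rule nth_equalityI) (use assms in \<open>auto simp: nth_append algebra_simps of_nat_diff\<close>)

lemma segment_cong: "(\<And>i. a \<le> i \<Longrightarrow> i < b \<Longrightarrow> s i = t i) \<Longrightarrow> segment s a b = segment t a b"
  by (rule nth_equalityI) auto

lemma segment_eqD:
  assumes "segment s a b = segment t a b" "a \<le> i" "i < b"
  shows "s i = t i"
proof -
  have "segment s a b ! nat (i - a) = segment t a b ! nat (i - a)"
    using assms(1) by simp
  then show ?thesis using assms(2,3) by simp
qed

lemma segment_translate: "segment (\<lambda>i. s (i + k)) a b = segment s (a + k) (b + k)"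
  by (rule nth_equalityI) (auto simp: algebra_simps)

lemma segment_split_eq:
  assumes "segment s a b = u @ v"
  shows "u = segment s a (a + int (length u))" "v = segment s (a + int (length u)) b"
proof -
  have l: "nat (b - a) = length u + length v" using assms by (metis length_append length_segment)
  show "u = segment s a (a + int (length u))"
  proof (rule nth_equalityI)
    fix i assume "i < length u"
    then show "u ! i = segment s a (a + int (length u)) ! i"
      using l arg_cong[OF assms, of "\<lambda>xs. xs ! i"] by (simp add: nth_append)
  qed simp
  show "v = segment s (a + int (length u)) b"
  proof (rule nth_equalityI)
    show "length v = length (segment s (a + int (length u)) b)" using l by auto
    fix i assume "i < length v"
    then show "v ! i = segment s (a + int (length u)) b ! i"
      using l arg_cong[OF assms, of "\<lambda>xs. xs ! (length u + i)"] by (simp add: nth_append algebra_simps)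
  qed
qed

lemma sublist_segment:
  assumes "a \<le> c" "c \<le> d" "d \<le> b"
  shows "sublist (segment s c d) (segment s a b)"
proof -
  have "segment s a b = segment s a c @ segment s c d @ segment s d b"
    using assms by (simp add: segment_append)
  then show ?thesis by simp
qed

text \<open>A diagonal argument: infinite index sets shrink so that on the window of radius
  \<open>m\<close> all remaining sequences coincide, and the cluster point takes coordinate
  \<open>i\<close> from an index that survives the stage of radius \<open>\<bar>i\<bar>\<close>. It
  is applied to sequences of letters, to cut sets as sequences of Booleans, and to tuples of
  both.\<close>

lemma cluster_point:
  fixes f :: "nat \<Rightarrow> int \<Rightarrow> 'b"
  assumes "\<And>n i. f n i \<in> F" "finite F"
  shows "\<exists>g. (\<forall>i. g i \<in> F) \<and> (\<forall>m::nat. infinite {n. \<forall>i. \<bar>i\<bar> \<le> int m \<longrightarrow> f n i = g i})"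
proof -
  have "\<exists>S. \<forall>m. infinite (S m) \<and> (S (Suc m) \<subseteq> S m \<and>
    (\<forall>n\<in>S (Suc m). \<forall>n'\<in>S (Suc m). \<forall>i. \<bar>i\<bar> \<le> int m \<longrightarrow> f n i = f n' i))"
  proof (rule dependent_nat_choice)
    show "\<exists>S::nat set. infinite S" by (rule exI[of _ UNIV]) simp
    fix S :: "nat set" and m :: nat assume S: "infinite S"
    let ?r = "\<lambda>n. segment (f n) (- int m) (int m + 1)"
    have "finite (?r ` S)"
    proof (rule finite_subset)
      show "?r ` S \<subseteq> {xs. set xs \<subseteq> F \<and> length xs = nat (2 * int m + 1)}"
        using assms(1) by (auto simp: segment_def)
      show "finite {xs. set xs \<subseteq> F \<and> length xs = nat (2 * int m + 1)}"
        using assms(2) by (rule finite_lists_length_eq)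
    qed
    from pigeonhole_infinite[OF S this] obtain a where
      a: "infinite {n\<in>S. ?r n = ?r a}" by auto
    have eq: "f n i = f n' i" if "?r n = ?r a" "?r n' = ?r a" "\<bar>i\<bar> \<le> int m" for n n' i
      using segment_eqD[of "f n" "- int m" "int m + 1" "f n'" i] that by auto
    show "\<exists>S'. infinite S' \<and> (S' \<subseteq> S \<and>
        (\<forall>n\<in>S'. \<forall>n'\<in>S'. \<forall>i. \<bar>i\<bar> \<le> int m \<longrightarrow> f n i = f n' i))"
    proof (intro exI conjI ballI allI impI)
      show "infinite {n\<in>S. ?r n = ?r a}" by (rule a)
      show "f n i = f n' i" if "n \<in> {n\<in>S. ?r n = ?r a}" "n' \<in> {n\<in>S. ?r n = ?r a}"
        "\<bar>i\<bar> \<le> int m" for n n' i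
        using that by (intro eq) auto
    qed auto
  qed
  then obtain S where S: "\<forall>m. infinite (S m) \<and> (S (Suc m) \<subseteq> S m \<and>
    (\<forall>n\<in>S (Suc m). \<forall>n'\<in>S (Suc m). \<forall>i. \<bar>i\<bar> \<le> int m \<longrightarrow> f n i = f n' i))"
    by (elim exE)
  have inf: "infinite (S m)" and dec: "S (Suc m) \<subseteq> S m" for m using S by auto
  have eq: "f n i = f n' i" if "n \<in> S (Suc m)" "n' \<in> S (Suc m)" "\<bar>i\<bar> \<le> int m" for m n n' i
    using S that by blast
  define pick where "pick m = (SOME n. n \<in> S (Suc m))" for m
  have pick: "pick m \<in> S (Suc m)" for m
  proof -
    have "S (Suc m) \<noteq> {}" using inf[of "Suc m"] by auto
    then show ?thesis unfolding pick_def by (simp add: some_in_eq)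
  qed
  define g where "g i = f (pick (nat \<bar>i\<bar>)) i" for i
  have mono: "S (Suc m) \<subseteq> S (Suc k)" if "k \<le> m" for k m
    by (rule lift_Suc_antimono_le[of S]) (use that dec in auto)
  have "f n i = g i" if "n \<in> S (Suc m)" "\<bar>i\<bar> \<le> int m" for n m i
    unfolding g_def
  proof (rule eq[of _ "nat \<bar>i\<bar>"])
    have "nat \<bar>i\<bar> \<le> m" using that by linarith
    then show "n \<in> S (Suc (nat \<bar>i\<bar>))" using mono that by blast
  qed (auto intro: pick)
  then have "infinite {n. \<forall>i. \<bar>i\<bar> \<le> int m \<longrightarrow> f n i = g i}" for m
    by (intro infinite_super[OF _ inf[of "Suc m"]]) blast
  moreover have "g i \<in> F" for i using assms(1) g_def by auto
  ultimately show ?thesis by blast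
qed

section \<open>Factorizations as sets of cuts, and their existence by compactness\<close>

definition factors :: "'b list set \<Rightarrow> (int \<Rightarrow> 'b) \<Rightarrow> int set \<Rightarrow> bool" where
  "factors P s D \<longleftrightarrow>
     (\<forall>i. \<exists>d\<in>D. \<exists>e\<in>D. d \<le> i \<and> i < e \<and> {d<..<e} \<inter> D = {} \<and> segment s d e \<in> P)"

text \<open>Only finite windows are asked to lie inside a concatenation. This is what the language
  of a directive sequence provides, and it is preserved when the words of \<open>P\<close> are split
  further; a factorization of the whole sequence then comes from compactness.\<close>

definition covers :: "'b list set \<Rightarrow> (int \<Rightarrow> 'b) \<Rightarrow> bool" where
  "covers P s \<longleftrightarrow> (\<forall>a b. \<exists>ws\<in>lists P. sublist (segment s a b) (concat ws))"

lemma covers_refine: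
  assumes "covers P s" "\<And>p. p \<in> P \<Longrightarrow> \<exists>qs\<in>lists Q. p = concat qs"
  shows "covers Q s"
proof -
  obtain f where f: "\<And>p. p \<in> P \<Longrightarrow> f p \<in> lists Q \<and> p = concat (f p)"
    using assms(2) by metis
  have "\<exists>qs\<in>lists Q. concat ws = concat qs" if "ws \<in> lists P" for ws
  proof (intro bexI)
    show "concat ws = concat (concat (map f ws))"
      using that f by (induction ws) auto
    show "concat (map f ws) \<in> lists Q"
      using that f by (induction ws) auto
  qed
  then show ?thesis using assms(1) unfolding covers_def by metis
qed

lemma concat_take_Suc: "j < length ws \<Longrightarrow> concat (take (Suc j) ws) = concat (take j ws) @ ws ! j"
  by (simp add: take_Suc_conv_app_nth)

lemma length_concat_take_mono: "j \<le> k \<Longrightarrow> length (concat (take j ws)) \<le> length (concat (take k ws))"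
  by (metis concat_append length_append le_add1 le_add_diff_inverse take_add)

lemma concat_position:
  assumes "k < length (concat ws)"
  shows "\<exists>j<length ws. length (concat (take j ws)) \<le> k \<and> k < length (concat (take (Suc j) ws))"
  using assms
proof (induction ws arbitrary: k)
  case (Cons w ws)
  show ?case
  proof (cases "k < length w")
    case True then show ?thesis by (intro exI[of _ 0]) auto
  next
    case False
    with Cons.prems have "k - length w < length (concat ws)" by simp
    from Cons.IH[OF this] obtain j where "j < length ws"
      "length (concat (take j ws)) \<le> k - length w" "k - length w < length (concat (take (Suc j) ws))"
      by blast
    with False show ?thesis
      by (intro exI[of _ "Suc j"]) auto
  qed
qed simp

text \<open>Each finite window inherits cuts from the concatenation that contains it, and a cluster
  point of these cut sets serves for all of \<open>s\<close>. Finiteness of \<open>P\<close> bounds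
  the gaps between cuts, so the two cuts around a coordinate are decided by a bounded window and
  pass to the limit.\<close>

lemma covers_imp_factors:
  fixes P :: "'b list set"
  assumes fin: "finite P" and ne: "[] \<notin> P" and cov: "covers P s"
  shows "\<exists>D. factors P s D"
proof -
  obtain L :: nat where L: "\<And>p. p \<in> P \<Longrightarrow> length p \<le> L"
    using fin by (metis finite_imageI finite_nat_set_iff_bounded_le imageI)
  \<comment> \<open>Words near the ends of the window may stick out of it; at distance
    \<open>L\<close> from both ends the word around \<open>i\<close> lies inside.\<close>
  have win: "\<exists>M. \<forall>i. - int n + int L \<le> i \<and> i < int n - int L \<longrightarrow>
      (\<exists>d\<in>M. \<exists>e\<in>M. d \<le> i \<and> i < e \<and> e \<le> d + int L \<and> {d<..<e} \<inter> M = {} \<and> segment s d e \<in> P)" for n :: nat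
  proof -
    obtain ws us vs where ws: "ws \<in> lists P" "concat ws = us @ segment s (- int n) (int n) @ vs"
      using cov unfolding covers_def sublist_def by metis
    define a where "a = - int n - int (length us)"
    define m where "m j = a + int (length (concat (take j ws)))" for j
    have mono: "j \<le> k \<Longrightarrow> m j \<le> m k" for j k
      using length_concat_take_mono[of j k ws] by (simp add: m_def)
    have "\<exists>d\<in>range m. \<exists>e\<in>range m. d \<le> i \<and> i < e \<and> e \<le> d + int L \<and> {d<..<e} \<inter> range m = {} \<and> segment s d e \<in> P"
      if i: "- int n + int L \<le> i" "i < int n - int L" for i
    proof -
      have "nat (i - a) < length (concat ws)" using i ws(2) unfolding a_def by auto
      from concat_position[OF this] obtain j where j: "j < length ws"
        "length (concat (take j ws)) \<le> nat (i - a)" "nat (i - a) < length (concat (take (Suc j) ws))"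
        by blast
      have ia: "i \<ge> a" using i a_def by linarith
      have P: "ws ! j \<in> P" using ws(1) j(1) by auto
      have step: "m (Suc j) = m j + int (length (ws ! j))"
        using j(1) by (simp add: m_def concat_take_Suc)
      have b: "m j \<le> i" "i < m (Suc j)" using j ia unfolding m_def by auto
      have lo: "- int n \<le> m j" "m (Suc j) \<le> int n" using b step L[OF P] i by auto
      have emp: "{m j<..<m (Suc j)} \<inter> range m = {}"
      proof -
        have "\<not> (m j < m k \<and> m k < m (Suc j))" for k
          using mono[of k j] mono[of "Suc j" k] by (cases "k \<le> j") auto
        then show ?thesis by auto
      qed
      have "segment s (m j) (m (Suc j)) = ws ! j"
      proof (rule nth_equalityI)
        show "length (segment s (m j) (m (Suc j))) = length (ws ! j)" using step by simp
        fix t assume "t < length (segment s (m j) (m (Suc j)))"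
        then have t: "t < length (ws ! j)" using step by simp
        let ?c = "length (concat (take j ws))"
        have "concat ws = concat (take j ws) @ ws ! j @ concat (drop (Suc j) ws)"
          using j(1) by (metis concat.simps(2) concat_append id_take_nth_drop)
        then have "ws ! j ! t = concat ws ! (?c + t)"
          using t by (simp add: nth_append)
        also have "\<dots> = (us @ segment s (- int n) (int n) @ vs) ! (?c + t)" using ws(2) by simp
        also have "\<dots> = s (m j + int t)"
        proof -
          have 1: "?c + t \<ge> length us" using lo(1) unfolding m_def a_def by simp
          have 2: "?c + t - length us < nat (int n - - int n)"
            using lo(2) step t 1 unfolding m_def a_def by linarith
          show ?thesis using 1 2
            by (simp add: nth_append m_def a_def of_nat_diff algebra_simps)
        qed
        finally show "segment s (m j) (m (Suc j)) ! t = ws ! j ! t" using step t by simp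
      qed
      then have "segment s (m j) (m (Suc j)) \<in> P" "m (Suc j) \<le> m j + int L"
        using P step L[OF P] by auto
      then show ?thesis using b emp by blast
    qed
    then show ?thesis by blast
  qed
  then obtain M where M: "\<And>n i. - int n + int L \<le> i \<Longrightarrow> i < int n - int L \<Longrightarrow>
      (\<exists>d\<in>M n. \<exists>e\<in>M n. d \<le> i \<and> i < e \<and> e \<le> d + int L \<and> {d<..<e} \<inter> M n = {} \<and> segment s d e \<in> P)"
    by metis
  have "\<exists>g. (\<forall>i. g i \<in> UNIV) \<and> (\<forall>m::nat. infinite {n. \<forall>i. \<bar>i\<bar> \<le> int m \<longrightarrow> (i \<in> M n) = g i})"
    by (rule cluster_point) auto
  then obtain g where g: "\<And>m::nat. infinite {n. \<forall>i. \<bar>i\<bar> \<le> int m \<longrightarrow> (i \<in> M n) = g i}" by blast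
  have "\<exists>d\<in>Collect g. \<exists>e\<in>Collect g. d \<le> i \<and> i < e \<and> {d<..<e} \<inter> Collect g = {} \<and> segment s d e \<in> P" for i
  proof -
    define m where "m = nat \<bar>i\<bar> + L + 1"
    obtain n where n: "n > m" "\<forall>i. \<bar>i\<bar> \<le> int m \<longrightarrow> (i \<in> M n) = g i"
      using g[of m] unfolding infinite_nat_iff_unbounded by blast
    have "- int n + int L \<le> i" "i < int n - int L" using n(1) unfolding m_def by linarith+
    from M[OF this] obtain d e where de: "d \<in> M n" "e \<in> M n" "d \<le> i" "i < e" "e \<le> d + int L"
      "{d<..<e} \<inter> M n = {}" "segment s d e \<in> P" by blast
    have "\<bar>t\<bar> \<le> int m" if "d \<le> t" "t \<le> e" for t using de that unfolding m_def by linarith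
    then have mem: "t \<in> M n \<longleftrightarrow> g t" if "d \<le> t" "t \<le> e" for t
      using n(2) that by blast
    have "d \<in> Collect g" "e \<in> Collect g" using de(1-4) mem by auto
    moreover have "{d<..<e} \<inter> Collect g = {}" using de(6) mem by auto
    ultimately show ?thesis using de by blast
  qed
  then show ?thesis unfolding factors_def by blast
qed

lemma factors_next:
  assumes "factors P s D" "d \<in> D"
  shows "\<exists>e\<in>D. d < e \<and> {d<..<e} \<inter> D = {} \<and> segment s d e \<in> P"
proof -
  obtain d' e where e: "d' \<in> D" "e \<in> D" "d' \<le> d" "d < e" "{d'<..<e} \<inter> D = {}" "segment s d' e \<in> P"
    using assms(1) unfolding factors_def by blast
  then have "d' = d" using assms(2) by force
  then show ?thesis using e by blast
qed

lemma factors_prev: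
  assumes "factors P s D" "e \<in> D"
  shows "\<exists>d\<in>D. d < e \<and> {d<..<e} \<inter> D = {} \<and> segment s d e \<in> P"
proof -
  \<comment> \<open>The block that covers coordinate \<open>e - 1\<close> has to end exactly at the
    cut \<open>e\<close>.\<close>
  obtain d e' where e: "d \<in> D" "e' \<in> D" "d \<le> e - 1" "e - 1 < e'" "{d<..<e'} \<inter> D = {}" "segment s d e' \<in> P"
    using assms(1) unfolding factors_def by blast
  then have "e' = e" using assms(2) by force
  then show ?thesis using e by force
qed

lemma factors_segment:
  assumes "factors P s D" "d \<in> D" "e \<in> D" "d \<le> e"
  shows "\<exists>ws\<in>lists P. segment s d e = concat ws"
  using assms(2,4)
proof (induction "nat (e - d)" arbitrary: d rule: less_induct)
  case less
  show ?case
  proof (cases "d = e")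
    case True then show ?thesis by (intro bexI[of _ "[]"]) auto
  next
    case False
    obtain d' where d': "d' \<in> D" "d < d'" "{d<..<d'} \<inter> D = {}" "segment s d d' \<in> P"
      using factors_next[OF assms(1) less.prems(1)] by blast
    then have le: "d' \<le> e" using assms(3) False less.prems(2) by force
    obtain ws where "ws \<in> lists P" "segment s d' e = concat ws"
      using less.hyps[of d'] d' le less.prems by auto
    moreover have "segment s d e = segment s d d' @ segment s d' e"
      using d' le by (simp add: segment_append)
    ultimately show ?thesis using d' by (intro bexI[of _ "segment s d d' # ws"]) auto
  qed
qed

lemma factors_translate:
  assumes "factors P s D" shows "factors P (\<lambda>i. s (i + k)) ((\<lambda>d. d - k) ` D)"
  unfolding factors_def
proof
  fix i
  obtain d e where de: "d \<in> D" "e \<in> D" "d \<le> i + k" "i + k < e" "{d<..<e} \<inter> D = {}" "segment s d e \<in> P"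
    using assms unfolding factors_def by blast
  then show "\<exists>d\<in>(\<lambda>d. d - k) ` D. \<exists>e\<in>(\<lambda>d. d - k) ` D. d \<le> i \<and> i < e \<and>
    {d<..<e} \<inter> (\<lambda>d. d - k) ` D = {} \<and> segment (\<lambda>i. s (i + k)) d e \<in> P"
    by (intro bexI[of _ "d - k"] bexI[of _ "e - k"]) (auto simp: segment_translate)
qed

section \<open>Families of words with prescribed initial letters, and the defect theorem\<close>

definition flagged :: "('b \<Rightarrow> bool) \<Rightarrow> 'b list set \<Rightarrow> bool" where
  "flagged F P \<longleftrightarrow> finite P \<and> (\<forall>p\<in>P. p \<noteq> [] \<and> F (hd p))"

lemma flagged_hd_concat: "flagged F P \<Longrightarrow> ws \<in> lists P \<Longrightarrow> concat ws \<noteq> [] \<Longrightarrow> F (hd (concat ws))"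
  by (cases ws) (auto simp: flagged_def)

text \<open>Cancelling the longest common prefix of the two lists leaves different first words;
  neither list can run out before the other because no word is empty.\<close>

lemma lists_strip_common:
  assumes "us \<noteq> vs" "us \<in> lists P" "vs \<in> lists P" "concat us = concat vs" "[] \<notin> P"
  shows "\<exists>u us' v vs'. u \<in> P \<and> v \<in> P \<and> us' \<in> lists P \<and> vs' \<in> lists P \<and> u \<noteq> v \<and>
    u @ concat us' = v @ concat vs'"
  using assms(1-4)
proof (induction us arbitrary: vs)
  case Nil
  then show ?case using assms(5) by (cases vs) auto
next
  case (Cons u us)
  show ?case
  proof (cases vs)
    case Nil then show ?thesis using Cons.prems assms(5) by auto
  next
    case (Cons v vs')
    show ?thesis
    proof (cases "u = v")
      case True
      then show ?thesis using Cons.IH[of vs'] Cons.prems Cons by auto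
    next
      case False
      then have "u \<in> P \<and> v \<in> P \<and> us \<in> lists P \<and> vs' \<in> lists P \<and> u \<noteq> v \<and>
          u @ concat us = v @ concat vs'"
        using Cons.prems Cons by auto
      then show ?thesis by blast
    qed
  qed
qed

text \<open>A defect theorem. In a nontrivial relation the first differing words satisfy \<open>v = u @ t\<close>, and
  \<open>v\<close> can be replaced by \<open>t\<close>; the relation survives unless the number of words drops.\<close>

lemma defect:
  assumes "flagged F P" "us \<noteq> vs" "us \<in> lists P" "vs \<in> lists P" "concat us = concat vs"
  shows "\<exists>Q. flagged F Q \<and> card Q < card P \<and> sum length Q < sum length P \<and>
    (\<forall>p\<in>P. \<exists>qs\<in>lists Q. p = concat qs)"
  using assms
proof (induction "sum length P" arbitrary: P us vs rule: less_induct)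
  case less
  have fin: "finite P" and ne: "[] \<notin> P" using less.prems(1) by (auto simp: flagged_def)
  have main: ?case if uv: "u \<in> P" "v \<in> P" "us' \<in> lists P" "vs' \<in> lists P" "u \<noteq> v"
      "u @ concat us' = v @ concat vs'" "length u \<le> length v" for u v us' vs'
  proof -
    obtain t where t: "v = u @ t" using uv(6,7)
      by (metis append_eq_append_conv_if append_take_drop_id)
    then have tne: "t \<noteq> []" using uv(5) by auto
    have us't: "concat us' = t @ concat vs'" using uv(6) t by simp
    \<comment> \<open>\<open>t\<close> is a nonempty prefix of a concatenation of words of
      \<open>P\<close>, so its first letter is the first letter of one of them.\<close>
    then have Ft: "F (hd t)"
      using flagged_hd_concat[OF less.prems(1) uv(3)] tne by auto
    define P1 where "P1 = insert t (P - {v})"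
    have fl1: "flagged F P1" using less.prems(1) Ft tne unfolding P1_def flagged_def by auto
    have u1: "u \<in> P1" using uv(1,5) P1_def by auto
    define tr where "tr w = (if w = v then [u, t] else [w])" for w
    have trl: "concat (map tr ws) \<in> lists P1" if "ws \<in> lists P" for ws
      using that u1 by (induction ws) (auto simp: tr_def P1_def)
    have trc: "concat (concat (map tr ws)) = concat ws" for ws
      by (induction ws) (auto simp: tr_def t)
    have ref: "\<forall>p\<in>P. \<exists>qs\<in>lists P1. p = concat qs"
    proof
      fix p assume "p \<in> P"
      then have "tr p \<in> lists P1" "p = concat (tr p)" using u1 by (auto simp: tr_def P1_def t)
      then show "\<exists>qs\<in>lists P1. p = concat qs" by blast
    qed
    have cd: "card (P - {v}) < card P" using fin uv(2) by (rule card_Diff1_less)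
    have sm: "sum length P = length v + sum length (P - {v})" using fin uv(2) by (simp add: sum.remove)
    have lt: "length t < length v" using t uv(1) ne by (cases u) auto
    show ?thesis
    \<comment> \<open>If \<open>t\<close> is already present, dropping \<open>v\<close> lowers the
      number of words and the goal is reached. Otherwise the number is unchanged, the total length
      drops, and the induction hypothesis is applied to the rewritten relation.\<close>
    proof (cases "t \<in> P - {v}")
      case True
      then have "P1 = P - {v}" using P1_def by auto
      then show ?thesis using fl1 ref cd sm lt by (intro exI[of _ P1]) auto
    next
      case False
      have c1: "card P1 = card P" using False fin card_Suc_Diff1[OF fin uv(2)] unfolding P1_def by (subst card_insert_disjoint) auto
      have s1: "sum length P1 < sum length P" using False fin sm lt by (simp add: P1_def)
      \<comment> \<open>The rewritten relation is still nontrivial: a rewritten list that begins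
        with \<open>t\<close> comes from the word \<open>t\<close> of \<open>P - {v}\<close> or from
        \<open>v\<close> with \<open>u = t\<close>, and both are excluded in this case.\<close>
      have "concat (map tr us') \<noteq> t # concat (map tr vs')"
      proof
        assume eq: "concat (map tr us') = t # concat (map tr vs')"
        then obtain x xs where x: "us' = x # xs" by (cases us') auto
        then have "hd (tr x) = t" using eq by (auto simp: tr_def split: if_splits)
        moreover have "x \<in> P" using uv(3) x by auto
        ultimately have "t = u \<or> (t \<in> P \<and> t \<noteq> v)" by (auto simp: tr_def split: if_splits)
        then show False using False uv(1,5) by auto
      qed
      moreover have "concat (map tr us') \<in> lists P1" "t # concat (map tr vs') \<in> lists P1"
        using trl[OF uv(3)] trl[OF uv(4)] by (auto simp: P1_def)
      moreover have "concat (concat (map tr us')) = concat (t # concat (map tr vs'))"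
        using us't by (simp add: trc)
      ultimately obtain Q where Q: "flagged F Q" "card Q < card P1" "sum length Q < sum length P1"
        "\<forall>p\<in>P1. \<exists>qs\<in>lists Q. p = concat qs"
        using less.hyps[OF s1 fl1] by blast
      have "\<exists>qs\<in>lists Q. p = concat qs" if p: "p \<in> P" for p
      proof (cases "p = v")
        case True
        obtain q1 q2 where "q1 \<in> lists Q" "u = concat q1" "q2 \<in> lists Q" "t = concat q2"
          using Q(4) u1 P1_def by (metis insertI1)
        then show ?thesis using True t by (intro bexI[of _ "q1 @ q2"]) auto
      next
        case False
        then show ?thesis using Q(4) p P1_def by auto
      qed
      then show ?thesis using Q c1 s1 by (intro exI[of _ Q]) auto
    qed
  qed
  obtain u us' v vs' where "u \<in> P" "v \<in> P" "us' \<in> lists P" "vs' \<in> lists P" "u \<noteq> v"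
    "u @ concat us' = v @ concat vs'"
    using lists_strip_common[OF less.prems(2,3,4,5) ne] by blast
  note w = this
  show ?case
  proof (cases "length u \<le> length v")
    case True then show ?thesis by (rule main[OF w])
  next
    case False
    then have "length v \<le> length u" by simp
    then show ?thesis by (rule main[OF w(2,1,4,3) w(5)[symmetric] w(6)[symmetric]])
  qed
qed

section \<open>Families of minimal total length\<close>

definition covering_family :: "('b \<Rightarrow> bool) \<Rightarrow> nat \<Rightarrow> (int \<Rightarrow> 'b) set \<Rightarrow> 'b list set \<Rightarrow> bool" where
  "covering_family F K S P \<longleftrightarrow> flagged F P \<and> card P \<le> K \<and> (\<forall>s\<in>S. covers P s)"

text \<open>\<open>K\<close> is only an upper bound for the number of words. The minimized quantity
  is the total length, because it drops even in those replacements of a word by a proper piece that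
  leave the number of words unchanged.\<close>

definition minimal_family :: "('b \<Rightarrow> bool) \<Rightarrow> nat \<Rightarrow> (int \<Rightarrow> 'b) set \<Rightarrow> 'b list set \<Rightarrow> bool" where
  "minimal_family F K S P \<longleftrightarrow> covering_family F K S P \<and>
     (\<forall>Q. covering_family F K S Q \<longrightarrow> sum length P \<le> sum length Q)"

lemma ex_minimal_family: "covering_family F K S P \<Longrightarrow> \<exists>P. minimal_family F K S P"
  using ex_has_least_nat[of "covering_family F K S" P "sum length"] unfolding minimal_family_def by blast

lemma minimal_family_no_refinement:
  assumes "minimal_family F K S P" "flagged F Q" "card Q \<le> K" "sum length Q < sum length P"
    and "\<And>p. p \<in> P \<Longrightarrow> \<exists>qs\<in>lists Q. p = concat qs"
  shows False
proof -
  have "covering_family F K S Q"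
    using assms covers_refine[of P _ Q] unfolding minimal_family_def covering_family_def by blast
  then show False using assms(1,4) unfolding minimal_family_def by fastforce
qed

text \<open>Replacing \<open>p'\<close> by the piece \<open>t\<close> does not increase the number
  of words and saves at least the letters of \<open>p\<close>, while \<open>p'\<close> remains a
  product of \<open>p\<close> and \<open>t\<close>. The alternative in the last hypothesis treats
  prefixes and suffixes together.\<close>

lemma minimal_family_split:
  assumes "minimal_family F K S P" "p \<in> P" "p' \<in> P" "p \<noteq> p'" "t \<noteq> []" "F (hd t)"
    and "p' = p @ t \<or> p' = t @ p"
  shows False
proof -
  have fl: "flagged F P" and K: "card P \<le> K"
    using assms(1) unfolding minimal_family_def covering_family_def by auto
  then have fin: "finite P" and ne: "[] \<notin> P" by (auto simp: flagged_def)
  let ?Q = "insert t (P - {p'})"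
  have "flagged F ?Q" using fl assms(5,6) unfolding flagged_def by auto
  moreover have "card ?Q \<le> K"
  proof -
    have "card ?Q \<le> Suc (card (P - {p'}))" using fin by (simp add: card_insert_if)
    also have "\<dots> = card P" using fin assms(3) by (rule card_Suc_Diff1)
    finally show ?thesis using K by simp
  qed
  moreover have "sum length ?Q < sum length P"
  proof -
    have "length t < length p'" using assms(2,7) ne by (cases p) auto
    moreover have "sum length ?Q \<le> length t + sum length (P - {p'})"
      using fin by (cases "t \<in> P - {p'}") (auto simp: insert_absorb)
    moreover have "sum length P = length p' + sum length (P - {p'})" using fin assms(3) by (simp add: sum.remove)
    ultimately show ?thesis by simp
  qed
  moreover have "\<exists>qs\<in>lists ?Q. q = concat qs" if "q \<in> P" for q
  proof (cases "q = p'")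
    case True
    show ?thesis
      using assms(7)
    proof
      assume "p' = p @ t" then show ?thesis using True assms(2,4) by (intro bexI[of _ "[p, t]"]) auto
    next
      assume "p' = t @ p" then show ?thesis using True assms(2,4) by (intro bexI[of _ "[t, p]"]) auto
    qed
  next
    case False then show ?thesis using that by (intro bexI[of _ "[q]"]) auto
  qed
  ultimately show False by (rule minimal_family_no_refinement[OF assms(1)])
qed

lemma segment_hd: "a < b \<Longrightarrow> hd (segment s a b) = s a"
  by (simp add: segment_def hd_map upt_conv_Cons)

lemma segment_eq_Nil_iff: "segment s a b = [] \<longleftrightarrow> b \<le> a"
  by (simp add: segment_def)

lemma flagged_at_cut:
  assumes "flagged F P" "factors P s D" "d \<in> D"
  shows "F (s d)"
proof -
  obtain e where "d < e" "segment s d e \<in> P" using factors_next[OF assms(2,3)] by blast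
  then show ?thesis using assms(1) segment_hd[of d e s] unfolding flagged_def by metis
qed

text \<open>If the next cuts after \<open>d\<close> differed, the shorter word would be a prefix of
  the longer one and the remainder would begin at a cut, hence be flagged. Before \<open>d\<close>
  the shorter word is a suffix, and the remainder begins where the longer word does, again at a cut.
  Both contradict minimality.\<close>

lemma factors_common_cut_step:
  assumes min: "minimal_family F K S P" and D: "factors P s D" and D': "factors P s D'"
    and d: "d \<in> D" "d \<in> D'"
  shows "(\<exists>e\<in>D \<inter> D'. d < e \<and> {d<..<e} \<inter> D = {} \<and> {d<..<e} \<inter> D' = {}) \<and>
         (\<exists>e\<in>D \<inter> D'. e < d \<and> {e<..<d} \<inter> D = {} \<and> {e<..<d} \<inter> D' = {})"
proof -
  have fl: "flagged F P" using min unfolding minimal_family_def covering_family_def by auto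
  have fwd: False if "d < e" "segment s d e \<in> P" "d < e'" "segment s d e' \<in> P" "e < e'" "F (s e)" for e e'
  proof (rule minimal_family_split[OF min that(2,4), where t = "segment s e e'"])
    show "segment s d e \<noteq> segment s d e'" using that by (metis length_segment nat_less_eq_zless diff_ge_0_iff_ge less_imp_le diff_strict_right_mono less_irrefl)
    show "segment s e e' \<noteq> []" using that by (simp add: segment_eq_Nil_iff)
    show "F (hd (segment s e e'))" using that by (simp add: segment_hd)
    show "segment s d e' = segment s d e @ segment s e e' \<or> segment s d e' = segment s e e' @ segment s d e"
      using that by (simp add: segment_append)
  qed
  have bwd: False if "e < d" "segment s e d \<in> P" "e' < d" "segment s e' d \<in> P" "e' < e" "F (s e')" for e e'
  proof (rule minimal_family_split[OF min that(2,4), where t = "segment s e' e"])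
    show "segment s e d \<noteq> segment s e' d" using that by (metis length_segment nat_less_eq_zless diff_ge_0_iff_ge less_imp_le diff_strict_left_mono less_irrefl)
    show "segment s e' e \<noteq> []" using that by (simp add: segment_eq_Nil_iff)
    show "F (hd (segment s e' e))" using that by (simp add: segment_hd)
    show "segment s e' d = segment s e d @ segment s e' e \<or> segment s e' d = segment s e' e @ segment s e d"
      using that by (simp add: segment_append)
  qed
  obtain e where e: "e \<in> D" "d < e" "{d<..<e} \<inter> D = {}" "segment s d e \<in> P"
    using factors_next[OF D d(1)] by blast
  obtain e' where e': "e' \<in> D'" "d < e'" "{d<..<e'} \<inter> D' = {}" "segment s d e' \<in> P"
    using factors_next[OF D' d(2)] by blast
  obtain c where c: "c \<in> D" "c < d" "{c<..<d} \<inter> D = {}" "segment s c d \<in> P"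
    using factors_prev[OF D d(1)] by blast
  obtain c' where c': "c' \<in> D'" "c' < d" "{c'<..<d} \<inter> D' = {}" "segment s c' d \<in> P"
    using factors_prev[OF D' d(2)] by blast
  have "e = e'"
    using fwd[of e e'] fwd[of e' e] e e' flagged_at_cut[OF fl D e(1)] flagged_at_cut[OF fl D' e'(1)]
    by (metis linorder_neq_iff)
  moreover have "c = c'"
    using bwd[of c c'] bwd[of c' c] c c' flagged_at_cut[OF fl D c(1)] flagged_at_cut[OF fl D' c'(1)]
    by (metis linorder_neq_iff)
  ultimately show ?thesis using e e' c c' by auto
qed

lemma factors_common_cut:
  assumes min: "minimal_family F K S P" and D: "factors P s D" and D': "factors P s D'"
    and d: "d \<in> D" "d \<in> D'"
  shows "D = D'"
proof -
  have up: "x \<in> D \<longleftrightarrow> x \<in> D'" if "d \<in> D" "d \<in> D'" "d \<le> x" for d x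
    using that
  proof (induction "nat (x - d)" arbitrary: d rule: less_induct)
    case less
    show ?case
    proof (cases "x = d")
      case False
      obtain e where e: "e \<in> D" "e \<in> D'" "d < e" "{d<..<e} \<inter> D = {}" "{d<..<e} \<inter> D' = {}"
        using factors_common_cut_step[OF min D D' less.prems(1,2)] by blast
      show ?thesis
      proof (cases "x < e")
        case True
        then have "x \<in> {d<..<e}" using False less.prems by auto
        then show ?thesis using e by blast
      next
        case ge: False
        then show ?thesis using less.hyps[of e] e by auto
      qed
    qed (use less.prems in auto)
  qed
  have down: "x \<in> D \<longleftrightarrow> x \<in> D'" if "d \<in> D" "d \<in> D'" "x \<le> d" for d x
    using that
  proof (induction "nat (d - x)" arbitrary: d rule: less_induct)
    case less
    show ?case
    proof (cases "x = d")
      case False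
      obtain e where e: "e \<in> D" "e \<in> D'" "e < d" "{e<..<d} \<inter> D = {}" "{e<..<d} \<inter> D' = {}"
        using factors_common_cut_step[OF min D D' less.prems(1,2)] by blast
      show ?thesis
      proof (cases "e < x")
        case True
        then have "x \<in> {e<..<d}" using False less.prems by auto
        then show ?thesis using e by blast
      next
        case ge: False
        then show ?thesis using less.hyps[of e] e by auto
      qed
    qed (use less.prems in auto)
  qed
  have "x \<in> D \<longleftrightarrow> x \<in> D'" for x using up[OF d, of x] down[OF d, of x] by linarith
  then show ?thesis by blast
qed

text \<open>If the cuts of two factorizations are disjoint, then some pair of words \<open>p = z @ t\<close> of the first
  one is cut in the same way by two cuts of the second one. This gives a nontrivial relation between
  the words obtained by splitting \<open>p\<close>.\<close>

lemma factors_disjoint_cuts: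
  assumes min: "minimal_family F K S P" and D: "factors P s D" and D': "factors P s D'"
  shows "D \<inter> D' \<noteq> {}"
proof
  assume disj: "D \<inter> D' = {}"
  have fl: "flagged F P" and K: "card P \<le> K"
    using min unfolding minimal_family_def covering_family_def by auto
  then have fin: "finite P" and ne: "[] \<notin> P" by (auto simp: flagged_def)
  obtain L :: nat where L: "\<And>p. p \<in> P \<Longrightarrow> length p \<le> L"
    using fin by (metis finite_imageI finite_nat_set_iff_bounded_le imageI)
  \<comment> \<open>Infinitely many cuts of \<open>D'\<close> lie strictly inside blocks of
    \<open>D\<close>, but there are only finitely many pairs of a block word and an offset; so two
    of the cuts share the pair.\<close>
  have "\<exists>b\<in>P \<times> {..L}. infinite {c\<in>D'. \<exists>d e. d \<in> D \<and> e \<in> D \<and> d < c \<and> c < e \<and> {d<..<e} \<inter> D = {} \<and>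
      segment s d e = fst b \<and> nat (c - d) = snd b}"
  proof (rule pigeonhole_infinite_rel)
    show "infinite D'"
    proof
      assume "finite D'"
      moreover have "D' \<noteq> {}" using D' unfolding factors_def by blast
      ultimately have "Max D' \<in> D'" by simp
      then obtain e where "e \<in> D'" "Max D' < e" using factors_next[OF D'] by blast
      then show False using \<open>finite D'\<close> by (meson Max_ge leD)
    qed
    show "finite (P \<times> {..L})" using fin by simp
    show "\<forall>c\<in>D'. \<exists>b\<in>P \<times> {..L}. \<exists>d e. d \<in> D \<and> e \<in> D \<and> d < c \<and> c < e \<and> {d<..<e} \<inter> D = {} \<and>
      segment s d e = fst b \<and> nat (c - d) = snd b"
    proof
      fix c assume c: "c \<in> D'"
      obtain d e where de: "d \<in> D" "e \<in> D" "d \<le> c" "c < e" "segment s d e \<in> P" "{d<..<e} \<inter> D = {}"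
        using D unfolding factors_def by blast
      have "d < c" using de c disj by force
      moreover have "nat (c - d) \<le> L" using L[OF de(5)] de by simp
      ultimately show "\<exists>b\<in>P \<times> {..L}. \<exists>d e. d \<in> D \<and> e \<in> D \<and> d < c \<and> c < e \<and> {d<..<e} \<inter> D = {} \<and>
        segment s d e = fst b \<and> nat (c - d) = snd b"
        using de by (intro bexI[of _ "(segment s d e, nat (c - d))"] exI[of _ d] exI[of _ e]) auto
    qed
  qed
  then obtain p l where p: "p \<in> P"
    and inf: "infinite {c\<in>D'. \<exists>d e. d \<in> D \<and> e \<in> D \<and> d < c \<and> c < e \<and> {d<..<e} \<inter> D = {} \<and> segment s d e = p \<and> nat (c - d) = l}"
      (is "infinite ?C")
    by auto
  define C where "C = ?C"
  have infC: "infinite C" using inf unfolding C_def .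
  then obtain a where a: "a \<in> C" by (metis finite.emptyI equals0I)
  have "C - {a} \<noteq> {}" using infC by (metis finite.emptyI finite_Diff_insert Diff_empty)
  then obtain b where b: "b \<in> C" "b \<noteq> a" by blast
  define c1 c2 where "c1 = min a b" and "c2 = max a b"
  have c: "c1 \<in> ?C" "c2 \<in> ?C" "c1 < c2"
    using a b unfolding c1_def c2_def C_def min_def max_def by (auto simp del: mem_Collect_eq)
  obtain d1 e1 where 1: "c1 \<in> D'" "d1 \<in> D" "e1 \<in> D" "d1 < c1" "c1 < e1" "segment s d1 e1 = p" "nat (c1 - d1) = l"
    "{d1<..<e1} \<inter> D = {}"
    using c(1) by auto
  obtain d2 e2 where 2: "c2 \<in> D'" "d2 \<in> D" "e2 \<in> D" "d2 < c2" "c2 < e2" "segment s d2 e2 = p" "nat (c2 - d2) = l"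
    using c(2) by auto
  define z where "z = segment s d1 c1"
  define t where "t = segment s c1 e1"
  have pzt: "p = z @ t" using 1 by (simp add: z_def t_def segment_append)
  have zne: "z \<noteq> []" and tne: "t \<noteq> []" using 1 by (auto simp: z_def t_def segment_eq_Nil_iff)
  have lz: "length z = l" using 1 by (simp add: z_def)
  have z2: "segment s d2 c2 = z"
  proof -
    have "c2 = d2 + int l" using 2(4,7) by linarith
    then show ?thesis using segment_split_eq(1)[of s d2 e2 z t] 2(6) pzt lz by metis
  qed
  have Fz: "F (hd z)" using 1 flagged_at_cut[OF fl D] by (simp add: z_def segment_hd)
  have Ft: "F (hd t)" using 1 flagged_at_cut[OF fl D'] by (simp add: t_def segment_hd)
  define Q where "Q = {z, t} \<union> (P - {p})"
  have flQ: "flagged F Q" using fl zne tne Fz Ft unfolding Q_def flagged_def by auto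
  have tr0: "\<exists>qs\<in>lists Q. q = concat qs" if "q \<in> P" for q
    by (cases "q = p"; rule bexI[of _ "if q = p then [z, t] else [q]"]) (use that pzt in \<open>auto simp: Q_def\<close>)
  have sP: "sum length P = length z + length t + sum length (P - {p})"
    using fin p pzt by (simp add: sum.remove)
  have cP: "card P = Suc (card (P - {p}))" using card_Suc_Diff1[OF fin p] by simp
  show False
  \<comment> \<open>In the first case \<open>z\<close> and \<open>t\<close> contribute at most one
    new word, so \<open>Q\<close> itself is a shorter admissible family. In the second case
    \<open>Q\<close> has one word more than \<open>P\<close> and the same total length, and a
    relation is needed to get rid of the excess.\<close>
  proof (cases "z \<in> P - {p} \<or> t \<in> P - {p} \<or> z = t")
    case True
    have "card Q \<le> Suc (card (P - {p})) \<and> sum length Q < sum length P"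
    proof -
      consider "z \<in> P - {p}" | "t \<in> P - {p}" | "z = t" using True by blast
      then show ?thesis
      proof cases
        case 1
        then have "Q = insert t (P - {p})" unfolding Q_def by auto
        then show ?thesis using fin sP zne by (cases "t \<in> P - {p}") (auto simp: insert_absorb card_insert_if)
      next
        case 2
        then have "Q = insert z (P - {p})" unfolding Q_def by auto
        then show ?thesis using fin sP tne by (cases "z \<in> P - {p}") (auto simp: insert_absorb card_insert_if)
      next
        case 3
        then have "Q = insert z (P - {p})" unfolding Q_def by auto
        then show ?thesis using fin sP tne by (cases "z \<in> P - {p}") (auto simp: insert_absorb card_insert_if)
      qed
    qed
    then show False using minimal_family_no_refinement[OF min flQ] tr0 cP K by auto
  next
    case False
    have cQ: "card Q = Suc (card P)" and sQ: "sum length Q = sum length P"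
      using False fin sP cP by (auto simp: Q_def)
    have d12: "d1 < d2" using c(3) 1(4,7) 2(4,7) by linarith
    have e1d2: "e1 \<le> d2" using 1(8) 2(2) d12 by force
    obtain gs where gs: "gs \<in> lists P" "segment s e1 d2 = concat gs"
      using factors_segment[OF D 1(3) 2(2) e1d2] by blast
    obtain hs where hs: "hs \<in> lists P" "segment s c1 c2 = concat hs"
      using factors_segment[OF D' 1(1) 2(1)] c(3) by auto
    define f where "f q = (if q = p then [z, t] else [q])" for q
    have fc: "concat (concat (map f ws)) = concat ws" for ws
      by (induction ws) (auto simp: f_def pzt)
    have fl': "concat (map f ws) \<in> lists Q" if "ws \<in> lists P" for ws
      using that by (induction ws) (auto simp: f_def Q_def)
    \<comment> \<open>The stretch of \<open>s\<close> between the cuts \<open>c1\<close> and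
      \<open>c2\<close> is spelled in two ways: along the cuts of \<open>D\<close>, with a broken
      copy of \<open>p\<close> at either end, and along the cuts of \<open>D'\<close>.\<close>
    have "concat gs @ z = segment s e1 c2"
      using gs(2) z2 e1d2 2(4) segment_append[of e1 d2 c2 s] by simp
    moreover have "t @ segment s e1 c2 = segment s c1 c2"
      using e1d2 2(4) 1(5) unfolding t_def by (simp add: segment_append)
    ultimately have rel: "t @ concat gs @ z = concat hs" using hs(2) by simp
    have zQ: "z \<in> Q" and tQ: "t \<in> Q" by (auto simp: Q_def)
    \<comment> \<open>The left list begins with \<open>t\<close>, whereas a list over
      \<open>P\<close> rewritten by \<open>f\<close> begins with \<open>z\<close> or with a word of
      \<open>P - {p}\<close>; in this case \<open>t\<close> is neither.\<close>
    have "t # concat (map f gs) @ [z] \<noteq> concat (map f hs)"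
    proof
      assume eq: "t # concat (map f gs) @ [z] = concat (map f hs)"
      then obtain q hs' where q: "hs = q # hs'" by (cases hs) auto
      then have "hd (f q) = t" "q \<in> P" using eq hs(1) by (auto simp: f_def split: if_splits)
      then show False using False by (auto simp: f_def split: if_splits)
    qed
    moreover have "t # concat (map f gs) @ [z] \<in> lists Q"
      using fl'[OF gs(1)] zQ tQ by simp
    moreover have "concat (t # concat (map f gs) @ [z]) = concat (concat (map f hs))"
      using rel by (simp add: fc)
    \<comment> \<open>The word lost in the defect theorem pays for the word gained by splitting
      \<open>p\<close>, so the number of words is again at most \<open>card P\<close>, and the total
      length has dropped.\<close>
    ultimately obtain Q' where Q': "flagged F Q'" "card Q' < card Q" "sum length Q' < sum length Q"
      "\<forall>p\<in>Q. \<exists>qs\<in>lists Q'. p = concat qs"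
      using defect[OF flQ] fl'[OF hs(1)] by blast
    have "\<exists>qs\<in>lists Q'. q = concat qs" if q: "q \<in> P" for q
    proof (cases "q = p")
      case True
      obtain q1 q2 where "q1 \<in> lists Q'" "z = concat q1" "q2 \<in> lists Q'" "t = concat q2"
        using Q'(4) zQ tQ by metis
      then show ?thesis using True pzt by (intro bexI[of _ "q1 @ q2"]) auto
    next
      case False
      then show ?thesis using Q'(4) q Q_def by auto
    qed
    then show False using minimal_family_no_refinement[OF min Q'(1)] Q' cQ sQ K by auto
  qed
qed

theorem minimal_family_unique_factorization:
  assumes "minimal_family F K S P" "s \<in> S"
  shows "\<exists>!D. factors P s D"
proof -
  have "flagged F P" "covers P s"
    using assms unfolding minimal_family_def covering_family_def by auto
  then have "\<exists>D. factors P s D"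
    by (intro covers_imp_factors) (auto simp: flagged_def)
  moreover have "D = D'" if "factors P s D" "factors P s D'" for D D'
    using factors_disjoint_cuts[OF assms(1) that] factors_common_cut[OF assms(1) that] by blast
  ultimately show ?thesis by blast
qed

section \<open>Minimal systems\<close>

lemma topological_dynamical_systemD:
  assumes "topological_dynamical_system X T"
  shows "X \<noteq> {}" "compact X" "bij_betw T X X" "continuous_on X T" "continuous_on X (inv_into X T)"
proof -
  obtain T' where T': "homeomorphism X X T T'"
    using assms unfolding topological_dynamical_system_def by blast
  then show bij: "bij_betw T X X"
    unfolding homeomorphism_def bij_betw_def by (metis inj_on_inverseI)
  have "inv_into X T x = T' x" if "x \<in> X" for x
    using T' that bij unfolding homeomorphism_def
    by (metis bij_betw_imp_inj_on imageI inv_into_f_eq)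
  then show "continuous_on X (inv_into X T)"
    using T' continuous_on_cong unfolding homeomorphism_def by metis
qed (use assms in \<open>auto simp: topological_dynamical_system_def homeomorphism_def\<close>)

lemma topological_dynamical_systemI:
  fixes X :: "'a::metric_space set"
  assumes "X \<noteq> {}" "compact X" "bij_betw T X X" "continuous_on X T"
  shows "topological_dynamical_system X T"
proof -
  have "\<exists>T'. homeomorphism X X T T'"
    using homeomorphism_compact[OF assms(2,4)] assms(3) unfolding bij_betw_def by metis
  moreover have "metrizable_space (top_of_set X)"
    by (simp add: metrizable_space_euclidean metrizable_space_subtopology)
  ultimately show ?thesis using assms unfolding topological_dynamical_system_def by blast
qed

context
  fixes X :: "'a set" and T :: "'a \<Rightarrow> 'a"
  assumes bij: "bij_betw T X X"
begin

lemma funpow_mem: "x \<in> X \<Longrightarrow> (T ^^ n) x \<in> X"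
  using bij by (induction n) (auto simp: bij_betw_def)

lemma inv_into_mem: "x \<in> X \<Longrightarrow> inv_into X T x \<in> X"
  using bij by (metis bij_betw_def inv_into_into)

lemma funpow_inv_mem: "x \<in> X \<Longrightarrow> (inv_into X T ^^ n) x \<in> X"
  by (induction n) (auto simp: inv_into_mem)

lemma iterate_int_mem: "x \<in> X \<Longrightarrow> iterate_int X T n x \<in> X"
  by (simp add: iterate_int_def funpow_mem funpow_inv_mem)

lemma iterate_int_0 [simp]: "iterate_int X T 0 x = x"
  by (simp add: iterate_int_def)

lemma iterate_int_of_nat [simp]: "iterate_int X T (int n) x = (T ^^ n) x"
  by (simp add: iterate_int_def)

lemma iterate_int_step: "x \<in> X \<Longrightarrow> T (iterate_int X T n x) = iterate_int X T (n + 1) x"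
proof (cases "0 \<le> n")
  case True
  then have "nat (n + 1) = Suc (nat n)" by simp
  then show ?thesis using True by (simp add: iterate_int_def)
next
  case False
  assume x: "x \<in> X"
  define k where "k = nat (- n - 1)"
  have k: "nat (- n) = Suc k" "n = - int k - 1" using False k_def by auto
  have "T (iterate_int X T n x) = (inv_into X T ^^ k) x"
    using False k(1) funpow_inv_mem[OF x, of k] bij
    by (simp add: iterate_int_def f_inv_into_f bij_betw_def)
  also have "\<dots> = iterate_int X T (n + 1) x"
    by (simp add: iterate_int_def k)
  finally show ?thesis .
qed

lemma funpow_iterate_int: "x \<in> X \<Longrightarrow> (T ^^ k) (iterate_int X T n x) = iterate_int X T (n + int k) x"
  by (induction k) (auto simp: iterate_int_step algebra_simps)

lemma inj_on_funpow: "inj_on (T ^^ k) X"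
proof (induction k)
  case (Suc k)
  have "(T ^^ k) ` X \<subseteq> X" using funpow_mem by auto
  then have "inj_on T ((T ^^ k) ` X)" using bij by (metis bij_betw_def inj_on_subset)
  then show ?case using comp_inj_on[OF Suc] by (simp add: comp_def)
qed simp

lemma iterate_int_add:
  assumes x: "x \<in> X"
  shows "iterate_int X T m (iterate_int X T n x) = iterate_int X T (m + n) x"
proof (cases "0 \<le> m")
  case True
  then show ?thesis using funpow_iterate_int[OF x, of "nat m" n] iterate_int_of_nat[of "nat m"]
    by (simp add: add.commute)
next
  case False
  define k where "k = nat (- m)"
  have m: "m = - int k" using False k_def by simp
  have "(T ^^ k) (iterate_int X T m (iterate_int X T n x)) = iterate_int X T n x"
    using funpow_iterate_int[OF iterate_int_mem[OF x], of k m n] m by simp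
  also have "\<dots> = (T ^^ k) (iterate_int X T (m + n) x)"
    using funpow_iterate_int[OF x, of k "m + n"] m by simp
  finally show ?thesis
    using inj_on_funpow[of k] iterate_int_mem[OF iterate_int_mem[OF x]] iterate_int_mem[OF x]
    by (auto dest: inj_onD)
qed

lemma iterate_int_shift: "x \<in> X \<Longrightarrow> iterate_int X T n (T x) = iterate_int X T (n + 1) x"
  using iterate_int_add[of x n 1] iterate_int_of_nat[of 1 x] by simp

lemma funpow_surj: "y \<in> X \<Longrightarrow> \<exists>x\<in>X. (T ^^ k) x = y"
  using funpow_iterate_int[of y k "- int k"] iterate_int_mem[of y "- int k"] by auto

end

lemma continuous_on_funpow_self:
  assumes "continuous_on X T" "T ` X \<subseteq> X"
  shows "continuous_on X (T ^^ n)"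
proof (induction n)
  case (Suc n)
  have "(T ^^ n) ` X \<subseteq> X" using assms(2) by (induction n) auto
  then show ?case
    using continuous_on_compose[OF Suc] assms(1) continuous_on_subset by (metis funpow.simps(2))
qed (simp add: id_def)

lemma continuous_on_iterate_int:
  assumes "topological_dynamical_system X T"
  shows "continuous_on X (iterate_int X T n)"
proof -
  note D = topological_dynamical_systemD[OF assms]
  have "T ` X \<subseteq> X" "inv_into X T ` X \<subseteq> X"
    using D(3) inv_into_mem[OF D(3)] by (auto simp: bij_betw_def)
  then show ?thesis
    using D by (auto simp: iterate_int_def intro: continuous_on_funpow_self)
qed

section \<open>Return times in minimal systems\<close>

lemma minimal_systemD:
  assumes "minimal_system X T"
  shows "topological_dynamical_system X T"
    "\<And>x U. x \<in> X \<Longrightarrow> openin (top_of_set X) U \<Longrightarrow> U \<noteq> {} \<Longrightarrow> \<exists>n. iterate_int X T n x \<in> U"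
proof -
  show tds: "topological_dynamical_system X T" using assms unfolding minimal_system_def by blast
  fix x U assume x: "x \<in> X" and U: "openin (top_of_set X) U" "U \<noteq> {}"
  obtain O' where O: "open O'" "U = X \<inter> O'" using U(1) unfolding openin_open by blast
  obtain u where u: "u \<in> X" "u \<in> O'" using U(2) O by blast
  then have "u \<in> closure (range (\<lambda>n. iterate_int X T n x))"
    using assms x unfolding minimal_system_def by blast
  then obtain n where "iterate_int X T n x \<in> O'"
    using O(1) u(2) unfolding closure_iff_nhds_not_empty by blast
  then show "\<exists>n. iterate_int X T n x \<in> U"
    using O(2) iterate_int_mem[OF topological_dynamical_systemD(3)[OF tds] x] by blast
qed

text \<open>Minimality speaks of two-sided orbits. Orbit pieces of length \<open>2 * n + 1\<close>
  that avoid \<open>U\<close>, seen from their midpoints, would accumulate at a point whose whole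
  two-sided orbit avoids \<open>U\<close>; hence \<open>U\<close> is visited in forward time with a
  uniform bound.\<close>

lemma forward_recurrence:
  fixes X :: "'a::metric_space set"
  assumes min: "minimal_system X T" and U: "openin (top_of_set X) U" "U \<noteq> {}"
  shows "\<exists>L. \<forall>x\<in>X. \<exists>i<L. (T ^^ i) x \<in> U"
proof (rule ccontr)
  assume "\<not> ?thesis"
  then have "\<forall>L. \<exists>x\<in>X. \<forall>i<L. (T ^^ i) x \<notin> U" by blast
  then obtain x where x: "\<And>L. x L \<in> X" "\<And>L i. i < L \<Longrightarrow> (T ^^ i) (x L) \<notin> U" by metis
  note tds = minimal_systemD(1)[OF min]
  note D = topological_dynamical_systemD[OF tds]
  define y where "y n = (T ^^ n) (x (2 * n + 1))" for n
  have y: "y n \<in> X" for n unfolding y_def using funpow_mem[OF D(3) x(1)] .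
  have avoid: "iterate_int X T j (y n) \<notin> U" if "\<bar>j\<bar> \<le> int n" for j n
  proof -
    have "y n = iterate_int X T (int n) (x (2 * n + 1))" by (simp add: y_def iterate_int_of_nat[OF D(3)])
    then have "iterate_int X T j (y n) = iterate_int X T (j + int n) (x (2 * n + 1))"
      using iterate_int_add[OF D(3) x(1)] by simp
    also have "\<dots> = (T ^^ nat (j + int n)) (x (2 * n + 1))" using that by (simp add: iterate_int_def)
    finally show ?thesis using x(2)[of "nat (j + int n)" "2 * n + 1"] that by simp
  qed
  obtain l r where l: "l \<in> X" "strict_mono r" "(y \<circ> r) \<longlonglongrightarrow> l"
    using D(2) y unfolding compact_def by blast
  obtain j where j: "iterate_int X T j l \<in> U"
    using minimal_systemD(2)[OF min l(1) U] by blast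
  obtain O' where O: "open O'" "U = X \<inter> O'" using U(1) unfolding openin_open by blast
  have "(\<lambda>n. iterate_int X T j ((y \<circ> r) n)) \<longlonglongrightarrow> iterate_int X T j l"
    by (rule continuous_on_tendsto_compose[OF continuous_on_iterate_int[OF tds] l(3,1)]) (use y in auto)
  then have "\<forall>\<^sub>F n in sequentially. iterate_int X T j ((y \<circ> r) n) \<in> O'"
    using O j by (auto intro: topological_tendstoD)
  then obtain N where N: "\<And>n. n \<ge> N \<Longrightarrow> iterate_int X T j ((y \<circ> r) n) \<in> O'"
    unfolding eventually_sequentially by blast
  define n where "n = max N (nat \<bar>j\<bar>)"
  have "r n \<ge> n" using l(2) by (rule seq_suble)
  then have "iterate_int X T j (y (r n)) \<notin> U" by (intro avoid) (unfold n_def, linarith)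
  then show False using N[of n] O(2) iterate_int_mem[OF D(3) y] by (auto simp: n_def)
qed

text \<open>A cycle is finite, hence closed, and invariant in both directions, so a dense orbit that
  is a cycle is the whole space.\<close>

lemma periodic_imp_finite:
  fixes X :: "'a::t1_space set"
  assumes min: "minimal_system X T" and x: "x \<in> X" and n: "n \<ge> 1" "(T ^^ n) x = x"
  shows "finite X"
proof -
  note tds = minimal_systemD(1)[OF min]
  note D = topological_dynamical_systemD[OF tds]
  define Q where "Q = (\<lambda>i. (T ^^ i) x) ` {..<n}"
  have fin: "finite Q" and QX: "Q \<subseteq> X" unfolding Q_def using funpow_mem[OF D(3) x] by auto
  have TQ: "T ` Q \<subseteq> Q"
  proof
    fix z assume "z \<in> T ` Q"
    then obtain i where i: "i < n" "z = (T ^^ Suc i) x" unfolding Q_def by auto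
    show "z \<in> Q"
    proof (cases "Suc i = n")
      case True then show ?thesis using i n unfolding Q_def by (intro image_eqI[of _ _ 0]) auto
    next
      case False then show ?thesis using i unfolding Q_def by (intro image_eqI[of _ _ "Suc i"]) auto
    qed
  qed
  have inj: "inj_on T X" using D(3) by (simp add: bij_betw_def)
  then have "T ` Q = Q" using TQ fin QX by (meson endo_inj_surj inj_on_subset)
  then have SQ: "inv_into X T q \<in> Q" if "q \<in> Q" for q
    using that QX inj by (metis (no_types, lifting) image_iff inv_into_f_f subsetD)
  have "(T ^^ k) x \<in> Q" "(inv_into X T ^^ k) x \<in> Q" for k
  proof (induction k)
    case 0
    { case 1 show ?case using n unfolding Q_def by (intro image_eqI[of _ _ 0]) auto }
    { case 2 show ?case using n unfolding Q_def by (intro image_eqI[of _ _ 0]) auto }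
  qed (use TQ SQ in auto)
  then have "range (\<lambda>n. iterate_int X T n x) \<subseteq> Q" by (auto simp: iterate_int_def)
  then have "closure (range (\<lambda>n. iterate_int X T n x)) \<subseteq> Q"
    using fin by (metis closure_minimal finite_imp_closed)
  then have "X \<subseteq> Q" using min x unfolding minimal_system_def by blast
  then show ?thesis using fin finite_subset by blast
qed

text \<open>An isolated point is an open set to which its own forward orbit returns, so it would be
  periodic.\<close>

lemma infinite_minimal_islimpt:
  fixes X :: "'a::metric_space set"
  assumes min: "minimal_system X T" and "infinite X" and x: "x \<in> X"
  shows "x islimpt X"
proof (rule ccontr)
  assume "\<not> x islimpt X"
  then obtain U where U: "open U" "x \<in> U" "\<And>y. y \<in> X \<Longrightarrow> y \<in> U \<Longrightarrow> y = x"
    unfolding islimpt_def by blast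
  have "X \<inter> U = {x}" using x U(2) U(3) by blast
  then have "openin (top_of_set X) {x}" using U(1) unfolding openin_open by blast
  then obtain L where L: "\<And>y. y \<in> X \<Longrightarrow> \<exists>i<L. (T ^^ i) y \<in> {x}"
    using forward_recurrence[OF min, of "{x}"] by auto
  have "T x \<in> X" using topological_dynamical_systemD(3)[OF minimal_systemD(1)[OF min]] x
    by (auto simp: bij_betw_def)
  then obtain i where "(T ^^ i) (T x) = x" using L by blast
  then have "(T ^^ Suc i) x = x" by (simp add: funpow_swap1)
  then show False using periodic_imp_finite[OF min x, of "Suc i"] assms(2) by simp
qed

text \<open>If short returns occurred at every level, one return time would occur at infinitely many
  levels. A limit of the returning points would then lie in every \<open>E n\<close> together with
  its image under that power of \<open>T\<close>; as the sets have at most one common point, it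
  would be periodic.\<close>

lemma return_times_unbounded:
  fixes X :: "'a::metric_space set"
  assumes min: "minimal_system X T" and infX: "infinite X"
    and closed: "\<And>n. closedin (top_of_set X) (E n)" and dec: "\<And>n. E (Suc n) \<subseteq> E n"
    and single: "\<And>x y. \<lbrakk>\<And>n. x \<in> E n; \<And>n. y \<in> E n\<rbrakk> \<Longrightarrow> x = y"
  shows "\<exists>N. \<forall>x\<in>E N. \<forall>h. 1 \<le> h \<and> h \<le> L \<longrightarrow> (T ^^ h) x \<notin> E N"
proof (rule ccontr)
  assume "\<not> ?thesis"
  then have "\<forall>N. \<exists>x\<in>E N. \<exists>h. 1 \<le> h \<and> h \<le> L \<and> (T ^^ h) x \<in> E N" by blast
  then obtain x h where xh: "\<And>N. x N \<in> E N" "\<And>N. 1 \<le> h N" "\<And>N. h N \<le> L" "\<And>N. (T ^^ h N) (x N) \<in> E N"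
    by metis
  note D = topological_dynamical_systemD[OF minimal_systemD(1)[OF min]]
  have "finite (h ` UNIV)" by (rule finite_subset[of _ "{..L}"]) (use xh(3) in auto)
  then obtain N0 where inf: "infinite {N. h N = h N0}"
    using pigeonhole_infinite[of UNIV h] by auto
  have anti: "E n \<subseteq> E m" if "m \<le> n" for m n by (rule lift_Suc_antimono_le[of E]) (use dec that in auto)
  have "\<exists>M\<ge>N. h M = h N0" for N
    using inf unfolding infinite_nat_iff_unbounded_le by auto
  then obtain M where M: "\<And>N. M N \<ge> N" "\<And>N. h (M N) = h N0" by metis
  define y where "y N = x (M N)" for N
  have yE: "y N \<in> E n" "(T ^^ h N0) (y N) \<in> E n" if "n \<le> N" for n N
    using xh(1)[of "M N"] xh(4)[of "M N"] M anti[of n "M N"] that order_trans[OF that M(1)]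
    unfolding y_def by auto
  have EX: "E n \<subseteq> X" for n using closed closedin_imp_subset by blast
  have yX: "y N \<in> X" for N using yE(1)[of 0 N] EX by auto
  obtain l r where l: "l \<in> X" "strict_mono r" "(y \<circ> r) \<longlonglongrightarrow> l"
    using D(2) yX unfolding compact_def by blast
  have "closed (E n)" for n
    using closed compact_imp_closed[OF D(2)] closedin_closed_eq by blast
  have lE: "l \<in> E n" for n
  proof (rule Lim_in_closed_set[OF \<open>closed (E n)\<close> _ _ l(3)])
    show "\<forall>\<^sub>F x in sequentially. (y \<circ> r) x \<in> E n"
      unfolding eventually_sequentially
      by (intro exI[of _ n]) (auto intro!: yE(1) intro: order_trans[OF _ seq_suble[OF l(2)]])
  qed simp
  have "continuous_on X (T ^^ h N0)"
    using D(3,4) by (intro continuous_on_funpow_self) (auto simp: bij_betw_def)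
  then have lim: "(\<lambda>n. (T ^^ h N0) ((y \<circ> r) n)) \<longlonglongrightarrow> (T ^^ h N0) l"
    by (rule continuous_on_tendsto_compose[OF _ l(3,1)]) (use yX in auto)
  have "(T ^^ h N0) l \<in> E n" for n
  proof (rule Lim_in_closed_set[OF \<open>closed (E n)\<close> _ _ lim])
    show "\<forall>\<^sub>F x in sequentially. (T ^^ h N0) ((y \<circ> r) x) \<in> E n"
      unfolding eventually_sequentially
      by (intro exI[of _ n]) (auto intro!: yE(2) intro: order_trans[OF _ seq_suble[OF l(2)]])
  qed simp
  then have "(T ^^ h N0) l = l" using lE by (intro single)
  then show False using periodic_imp_finite[OF min l(1) xh(2)[of N0]] infX by simp
qed

section \<open>Kakutani-Rohlin partitions as labellings\<close>

text \<open>The label of a point is the pair of the index of its tower and the number of steps that it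
  needs to reach the base.\<close>

definition tower_labelling ::
  "'a::topological_space set \<Rightarrow> ('a \<Rightarrow> 'a) \<Rightarrow> nat \<Rightarrow> (nat \<Rightarrow> nat) \<Rightarrow> ('a \<Rightarrow> nat \<times> nat) \<Rightarrow> bool" where
  "tower_labelling X T d h a \<longleftrightarrow>
     (\<forall>x\<in>X. fst (a x) < d \<and> snd (a x) < h (fst (a x))) \<and>
     (\<forall>k<d. \<exists>x\<in>X. a x = (k, 0)) \<and>
     (\<forall>x\<in>X. \<forall>k j. a x = (k, Suc j) \<longrightarrow> a (T x) = (k, j)) \<and>
     (\<forall>x\<in>X. snd (a x) = 0 \<longrightarrow> snd (a (T x)) = h (fst (a (T x))) - 1) \<and>
     (\<forall>v. openin (top_of_set X) {x\<in>X. a x = v})"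

context
  fixes X :: "'a::topological_space set" and T d h a
  assumes bij: "bij_betw T X X" and lab: "tower_labelling X T d h a"
begin

lemma label_range: "x \<in> X \<Longrightarrow> a x = (k, j) \<Longrightarrow> k < d \<and> j < h k"
proof -
  assume "x \<in> X" "a x = (k, j)"
  moreover have "fst (a x) < d \<and> snd (a x) < h (fst (a x))" if "x \<in> X" for x
    using lab that unfolding tower_labelling_def by blast
  ultimately show ?thesis by fastforce
qed

lemma label_step: "x \<in> X \<Longrightarrow> a x = (k, Suc j) \<Longrightarrow> a (T x) = (k, j)"
  using lab unfolding tower_labelling_def by blast

lemma label_step_base: "x \<in> X \<Longrightarrow> a x = (k, 0) \<Longrightarrow> snd (a (T x)) = h (fst (a (T x))) - 1"
  using lab unfolding tower_labelling_def by (metis snd_conv)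

lemma label_onto: "k < d \<Longrightarrow> \<exists>x\<in>X. a x = (k, 0)"
  using lab unfolding tower_labelling_def by blast

lemma label_fibre_open: "openin (top_of_set X) {x\<in>X. a x = v}"
  using lab unfolding tower_labelling_def by blast

lemma label_funpow: "x \<in> X \<Longrightarrow> a x = (k, j) \<Longrightarrow> i \<le> j \<Longrightarrow> a ((T ^^ i) x) = (k, j - i)"
proof (induction i)
  case (Suc i)
  then have "a ((T ^^ i) x) = (k, Suc (j - Suc i))" by (simp add: Suc_diff_Suc)
  then show ?case using label_step[OF funpow_mem[OF bij Suc.prems(1)]] by simp
qed simp

text \<open>Backwards in time the label is forced below the top: the only other possible predecessor
  is a base point, and the successor of a base point is at level \<open>h k - 1\<close>.\<close>

lemma label_backward:
  "x \<in> X \<Longrightarrow> a ((T ^^ j) x) = (k, i) \<Longrightarrow> i + j < h k \<Longrightarrow> a x = (k, i + j)"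
proof (induction j arbitrary: x)
  case (Suc j)
  have Tx: "T x \<in> X" using Suc.prems(1) bij by (auto simp: bij_betw_def)
  then have eq: "a (T x) = (k, i + j)"
    using Suc.IH[OF Tx] Suc.prems by (simp add: funpow_swap1)
  obtain k' m where ax: "a x = (k', m)" by (cases "a x")
  show ?case
  proof (cases m)
    case 0
    then have "i + j = h k - 1" using label_step_base[OF Suc.prems(1)] eq ax by simp
    then show ?thesis using Suc.prems(3) by simp
  next
    case (Suc m')
    then have "a (T x) = (k', m')" using label_step[OF \<open>x \<in> X\<close>] ax by simp
    then show ?thesis using eq Suc ax by simp
  qed
qed simp

lemma label_next_tower:
  assumes "x \<in> X" "snd (a x) = 0" "fst (a (T x)) = k"
  shows "a (T x) = (k, h k - 1)" "a ((T ^^ h k) x) = (k, 0)"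
proof -
  have Tx: "T x \<in> X" using assms(1) bij by (auto simp: bij_betw_def)
  show eq: "a (T x) = (k, h k - 1)"
    using assms label_step_base[OF assms(1), of "fst (a x)"] by (simp add: prod_eq_iff)
  then have "h k = Suc (h k - 1)" using label_range[OF Tx] by force
  then show "a ((T ^^ h k) x) = (k, 0)"
    using label_funpow[OF Tx eq, of "h k - 1"] funpow_Suc_right[of "h k - 1" T] by simp
qed

lemma tower_level_label:
  assumes "j < h k"
  shows "tower_level X T {x\<in>X. a x = (k, 0)} j = {x\<in>X. a x = (k, j)}"
proof (intro equalityI subsetI)
  fix x assume "x \<in> tower_level X T {x\<in>X. a x = (k, 0)} j"
  then have "x \<in> X" "a ((T ^^ j) x) = (k, 0)" by (auto simp: tower_level_def)
  then show "x \<in> {x\<in>X. a x = (k, j)}" using label_backward[of x j k 0] assms by simp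
next
  fix x assume "x \<in> {x\<in>X. a x = (k, j)}"
  then have x: "x \<in> X" "a x = (k, j)" by auto
  then show "x \<in> tower_level X T {x\<in>X. a x = (k, 0)} j"
    using label_funpow[OF x, of j] funpow_mem[OF bij x(1), of j] by (simp add: tower_level_def)
qed

lemma ckr_atoms_label:
  "ckr_atoms X T d h (\<lambda>k. {x\<in>X. a x = (k, 0)}) = {{x\<in>X. a x = (k, j)} | k j. k < d \<and> j < h k}"
  unfolding ckr_atoms_def by (simp add: tower_level_label cong: rev_conj_cong)

lemma ckr_base_label: "ckr_base d (\<lambda>k. {x\<in>X. a x = (k, 0)}) = {x\<in>X. snd (a x) = 0}"
proof (intro equalityI subsetI)
  fix x assume "x \<in> {x\<in>X. snd (a x) = 0}"
  then have x: "x \<in> X" "a x = (fst (a x), 0)" by (auto simp: prod_eq_iff)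
  then show "x \<in> ckr_base d (\<lambda>k. {x\<in>X. a x = (k, 0)})"
    using label_range[OF x] unfolding ckr_base_def by blast
qed (auto simp: ckr_base_def)

lemma label_fibre_closed: "closedin (top_of_set X) {x\<in>X. a x \<in> V}"
proof -
  have "openin (top_of_set X) (\<Union>v\<in>-V. {x\<in>X. a x = v})"
    by (intro openin_Union) (auto intro: label_fibre_open)
  moreover have "(\<Union>v\<in>-V. {x\<in>X. a x = v}) = X - {x\<in>X. a x \<in> V}" by auto
  ultimately show ?thesis by (simp add: closedin_def Diff_subset)
qed

lemma ckr_partition_label: "ckr_partition X T d h (\<lambda>k. {x\<in>X. a x = (k, 0)})"
  unfolding ckr_partition_def
proof (intro conjI allI impI)
  fix k assume k: "k < d"
  then obtain x where x: "x \<in> X" "a x = (k, 0)" using label_onto by blast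
  then show "{x\<in>X. a x = (k, 0)} \<noteq> {}" by blast
  show "1 \<le> h k" using label_range[OF x] by simp
  show "openin (top_of_set X) {x\<in>X. a x = (k, 0)}" by (rule label_fibre_open)
  show "closedin (top_of_set X) {x\<in>X. a x = (k, 0)}" using label_fibre_closed[of "{(k, 0)}"] by simp
next
  show "\<Union> (ckr_atoms X T d h (\<lambda>k. {x\<in>X. a x = (k, 0)})) = X"
  proof (intro equalityI subsetI)
    fix x assume x: "x \<in> X"
    obtain k j where kj: "a x = (k, j)" by (cases "a x")
    then show "x \<in> \<Union> (ckr_atoms X T d h (\<lambda>k. {x\<in>X. a x = (k, 0)}))"
      unfolding ckr_atoms_label using label_range[OF x kj] x by blast
  qed (auto simp: ckr_atoms_def tower_level_def)
  show "disjoint_family_on (\<lambda>(k, j). tower_level X T {x\<in>X. a x = (k, 0)} j) (SIGMA k:{..<d}. {..<h k})"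
    by (auto simp: disjoint_family_on_def tower_level_label)
  show "(\<Union>k<d. tower_level X T {x\<in>X. a x = (k, 0)} (h k)) = ckr_base d (\<lambda>k. {x\<in>X. a x = (k, 0)})"
    unfolding ckr_base_label
  proof (intro equalityI subsetI)
    fix x assume "x \<in> (\<Union>k<d. tower_level X T {x\<in>X. a x = (k, 0)} (h k))"
    then obtain k where x: "x \<in> X" "a ((T ^^ h k) x) = (k, 0)" "k < d" by (auto simp: tower_level_def)
    have Tx: "T x \<in> X" using x(1) bij by (auto simp: bij_betw_def)
    obtain z where z: "z \<in> X" "a z = (k, 0)" using label_onto x(3) by blast
    then have hk: "h k > 0" using label_range by blast
    then have "(T ^^ h k) x = (T ^^ (h k - 1)) (T x)" using funpow_Suc_right[of "h k - 1" T] by simp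
    then have eq: "a (T x) = (k, h k - 1)" using label_backward[OF Tx, of "h k - 1" k 0] x(2) hk by simp
    show "x \<in> {x\<in>X. snd (a x) = 0}"
    proof (cases "snd (a x)")
      case (Suc m)
      then have "a (T x) = (fst (a x), m)" using label_step[OF x(1)] by (simp add: prod_eq_iff)
      then have "fst (a x) = k" "m = h k - 1" using eq by auto
      then have "a x = (k, h k)" using Suc hk by (simp add: prod_eq_iff)
      then show ?thesis using label_range[OF x(1)] by fastforce
    qed (use x in auto)
  next
    fix x assume "x \<in> {x\<in>X. snd (a x) = 0}"
    then have x: "x \<in> X" "snd (a x) = 0" by auto
    have Tx: "T x \<in> X" using x(1) bij by (auto simp: bij_betw_def)
    show "x \<in> (\<Union>k<d. tower_level X T {x\<in>X. a x = (k, 0)} (h k))"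
      using label_next_tower(2)[OF x refl] x(1) label_range[OF Tx, of "fst (a (T x))" "snd (a (T x))"]
        funpow_mem[OF bij x(1)]
      by (auto simp: tower_level_def intro!: bexI[of _ "fst (a (T x))"])
  qed
qed

end

section \<open>Nested sequences of labellings\<close>

definition labelled_sequence ::
  "'a::topological_space set \<Rightarrow> ('a \<Rightarrow> 'a) \<Rightarrow> (nat \<Rightarrow> nat) \<Rightarrow> (nat \<Rightarrow> nat \<Rightarrow> nat) \<Rightarrow> (nat \<Rightarrow> 'a \<Rightarrow> nat \<times> nat) \<Rightarrow> bool"
  where
  "labelled_sequence X T d h a \<longleftrightarrow>
     (\<forall>n. tower_labelling X T (d n) (h n) (a n)) \<and>
     (\<forall>n. \<forall>x\<in>X. snd (a (Suc n) x) = 0 \<longrightarrow> snd (a n x) = 0) \<and>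
     (\<forall>n. \<forall>x\<in>X. \<forall>y\<in>X. a (Suc n) x = a (Suc n) y \<longrightarrow> a n x = a n y) \<and>
     (\<exists>x. {x\<in>X. \<forall>n. snd (a n x) = 0} = {x}) \<and>
     (\<forall>U. \<forall>x\<in>U. openin (top_of_set X) U \<longrightarrow> (\<exists>n. \<forall>y\<in>X. a n y = a n x \<longrightarrow> y \<in> U))"

lemma labelled_sequenceD:
  assumes "labelled_sequence X T d h a"
  shows "tower_labelling X T (d n) (h n) (a n)"
    "x \<in> X \<Longrightarrow> snd (a (Suc n) x) = 0 \<Longrightarrow> snd (a n x) = 0"
    "x \<in> X \<Longrightarrow> y \<in> X \<Longrightarrow> a (Suc n) x = a (Suc n) y \<Longrightarrow> a n x = a n y"
    "\<exists>x. {x\<in>X. \<forall>n. snd (a n x) = 0} = {x}"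
    "x \<in> U \<Longrightarrow> openin (top_of_set X) U \<Longrightarrow> \<exists>n. \<forall>y\<in>X. a n y = a n x \<longrightarrow> y \<in> U"
proof -
  note S = assms[unfolded labelled_sequence_def]
  show "tower_labelling X T (d n) (h n) (a n)" by (rule S[THEN conjunct1, rule_format])
  show "x \<in> X \<Longrightarrow> snd (a (Suc n) x) = 0 \<Longrightarrow> snd (a n x) = 0"
    by (rule S[THEN conjunct2, THEN conjunct1, rule_format])
  show "x \<in> X \<Longrightarrow> y \<in> X \<Longrightarrow> a (Suc n) x = a (Suc n) y \<Longrightarrow> a n x = a n y"
    by (rule S[THEN conjunct2, THEN conjunct2, THEN conjunct1, rule_format])
  show "\<exists>x. {x\<in>X. \<forall>n. snd (a n x) = 0} = {x}"
    by (rule S[THEN conjunct2, THEN conjunct2, THEN conjunct2, THEN conjunct1])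
  show "x \<in> U \<Longrightarrow> openin (top_of_set X) U \<Longrightarrow> \<exists>n. \<forall>y\<in>X. a n y = a n x \<longrightarrow> y \<in> U"
    using S[THEN conjunct2, THEN conjunct2, THEN conjunct2, THEN conjunct2] by blast
qed

lemma labelled_sequence_nested:
  assumes bij: "bij_betw T X X" and seq: "labelled_sequence X T d h a" and "d 0 = 1" "h 0 0 = 1"
  shows "nested_ckr X T d h (\<lambda>n k. {x\<in>X. a n x = (k, 0)})"
proof -
  note lab = labelled_sequenceD(1)[OF seq] and base = labelled_sequenceD(2)[OF seq]
    and ref = labelled_sequenceD(3)[OF seq] and pt = labelled_sequenceD(4)[OF seq]
    and span = labelled_sequenceD(5)[OF seq]
  note rng = label_range[OF bij lab]
  have mem: "fst (a n x) < d n \<and> snd (a n x) < h n (fst (a n x))" if "x \<in> X" for n x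
    using rng[OF that] by (metis prod.collapse)
  let ?A = "\<Union>n. {{x\<in>X. a n x = (k, j)} | k j. k < d n \<and> j < h n k}"
  have fib: "{y\<in>X. a n y = a n x} \<in> ?A" if "x \<in> X" for n x
  proof -
    have "{y\<in>X. a n y = a n x} \<in> {{x\<in>X. a n x = (k, j)} | k j. k < d n \<and> j < h n k}"
      using mem[OF that, of n] by (intro CollectI exI[of _ "fst (a n x)"] exI[of _ "snd (a n x)"]) simp
    then show ?thesis by (rule UN_I[OF UNIV_I])
  qed
  have top: "topology_generated_by ?A = top_of_set X"
    unfolding topology_eq
  proof (intro allI iffI)
    fix U assume "openin (topology_generated_by ?A) U"
    then have "generate_topology_on ?A U" by (simp add: openin_topology_generated_by_iff)
    then show "openin (top_of_set X) U"
    proof induction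
      case (UN K) then show ?case by (blast intro: openin_Union)
    next
      case (Basis s)
      then show ?case using lab unfolding tower_labelling_def by auto
    qed (auto intro: openin_Int)
  next
    fix U assume U: "openin (top_of_set X) U"
    obtain n where n: "\<And>x y. x \<in> U \<Longrightarrow> y \<in> X \<Longrightarrow> a (n x) y = a (n x) x \<Longrightarrow> y \<in> U"
      using span[OF _ U] by metis
    have UX: "U \<subseteq> X" using U openin_subset by fastforce
    have "U = (\<Union>x\<in>U. {y\<in>X. a (n x) y = a (n x) x})" using n UX by auto
    moreover have "openin (topology_generated_by ?A) (\<Union>x\<in>U. {y\<in>X. a (n x) y = a (n x) x})"
      using fib UX by (intro openin_Union) (auto intro!: topology_generated_by_Basis)
    ultimately show "openin (topology_generated_by ?A) U" by simp
  qed
  obtain x0 where x0: "{x\<in>X. \<forall>n. snd (a n x) = 0} = {x0}" using pt by blast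
  show ?thesis
    unfolding nested_ckr_def ckr_atoms_label[OF bij lab] ckr_base_label[OF bij lab]
  proof (intro conjI allI ballI)
    show "ckr_partition X T (d n) (h n) (\<lambda>k. {x\<in>X. a n x = (k, 0)})" for n
      by (rule ckr_partition_label[OF bij lab])
    have "a 0 x = (0, 0)" if "x \<in> X" for x using mem[OF that, of 0] assms(3,4) by (cases "a 0 x") auto
    then have "{x\<in>X. a 0 x = (0, 0)} = X" by blast
    then show "{{x\<in>X. a 0 x = (k, j)} | k j. k < d 0 \<and> j < h 0 k} = {X}"
      using assms(3,4) by (auto intro!: exI[of _ 0])
    show "{x\<in>X. snd (a (Suc n) x) = 0} \<subseteq> {x\<in>X. snd (a n x) = 0}" for n
      using base[of _ n] by blast
    show "topology_generated_by ?A = top_of_set X" by (rule top)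
    show "\<exists>x. (\<Inter>n. {x\<in>X. snd (a n x) = 0}) = {x}"
    proof
      have "(\<Inter>n. {x\<in>X. snd (a n x) = 0}) = {x\<in>X. \<forall>n. snd (a n x) = 0}" by auto
      then show "(\<Inter>n. {x\<in>X. snd (a n x) = 0}) = {x0}" using x0 by simp
    qed
    fix n P assume "P \<in> {{x\<in>X. a (Suc n) x = (k, j)} | k j. k < d (Suc n) \<and> j < h (Suc n) k}"
    then obtain k j where P: "P = {x\<in>X. a (Suc n) x = (k, j)}" "k < d (Suc n)" "j < h (Suc n) k" by blast
    \<comment> \<open>A point of the atom is needed to name the fibre of level \<open>n\<close> that
      contains the atom. It is found by going back \<open>j\<close> steps from a base point.\<close>
    then have "P \<noteq> {}"
    proof -
      obtain y where y: "y \<in> X" "a (Suc n) y = (k, 0)" using label_onto[OF bij lab P(2)] by blast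
      obtain x where x: "x \<in> X" "(T ^^ j) x = y" using funpow_surj[OF bij y(1)] by blast
      then have "a (Suc n) x = (k, j)" using label_backward[OF bij lab x(1), of "Suc n" j k 0] y P(3) by simp
      then show ?thesis using P(1) x(1) by blast
    qed
    then obtain x where x: "x \<in> P" by blast
    have xP: "x \<in> X" "a (Suc n) x = (k, j)" using x unfolding P(1) by simp_all
    have "P \<subseteq> {y\<in>X. a n y = a n x}"
    proof
      fix y assume "y \<in> P"
      then have "y \<in> X" "a (Suc n) y = (k, j)" unfolding P(1) by simp_all
      then show "y \<in> {y\<in>X. a n y = a n x}" using ref[of y x n] xP by simp
    qed
    moreover have "{y\<in>X. a n y = a n x} \<in> {{x\<in>X. a n x = (k, j)} | k j. k < d n \<and> j < h n k}"
      using mem[OF xP(1), of n] by (intro CollectI exI[of _ "fst (a n x)"] exI[of _ "snd (a n x)"]) simp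
    ultimately show "\<exists>Q\<in>{{x\<in>X. a n x = (k, j)} | k j. k < d n \<and> j < h n k}. P \<subseteq> Q" by blast
  qed
qed

text \<open>The height of a tower is a return time of the base, since \<open>T^{-h(k)}B(k)\<close>
  consists of base points. These times grow because the bases shrink to one point of an infinite
  minimal system.\<close>

lemma labelled_sequence_heights_unbounded:
  fixes X :: "'a::metric_space set"
  assumes min: "minimal_system X T" and inf: "infinite X" and seq: "labelled_sequence X T d h a"
  shows "\<exists>N\<ge>M. \<forall>k<d N. h N k > L"
proof -
  note D = topological_dynamical_systemD[OF minimal_systemD(1)[OF min]]
  note bij = D(3)
  note lab = labelled_sequenceD(1)[OF seq] and base = labelled_sequenceD(2)[OF seq]
    and pt = labelled_sequenceD(4)[OF seq]
  \<comment> \<open>The sequence of bases is started at level \<open>M\<close>, so that the level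
    found is at least \<open>M\<close>.\<close>
  have "\<exists>N. \<forall>x\<in>{x\<in>X. snd (a (M + N) x) = 0}. \<forall>h. 1 \<le> h \<and> h \<le> L \<longrightarrow> (T ^^ h) x \<notin> {x\<in>X. snd (a (M + N) x) = 0}"
  proof (rule return_times_unbounded[OF min inf])
    show "closedin (top_of_set X) {x\<in>X. snd (a (M + n) x) = 0}" for n
      using label_fibre_closed[OF bij lab, of "M + n" "{v. snd v = 0}"] by simp
    show "{x\<in>X. snd (a (M + Suc n) x) = 0} \<subseteq> {x\<in>X. snd (a (M + n) x) = 0}" for n
      using base[of _ "M + n"] by auto
    have below: "snd (a n x) = 0" if "x \<in> X" "\<And>n. snd (a (M + n) x) = 0" for n x
    proof -
      have "m \<le> p \<Longrightarrow> snd (a p x) = 0 \<Longrightarrow> snd (a m x) = 0" for m p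
      proof (induction p rule: dec_induct)
        case (step p)
        then show ?case using base[OF that(1) step.prems] by blast
      qed
      then show ?thesis using that(2)[of n] by (meson le_add2)
    qed
    show "x = y" if "\<And>n. x \<in> {x\<in>X. snd (a (M + n) x) = 0}" "\<And>n. y \<in> {x\<in>X. snd (a (M + n) x) = 0}" for x y
    proof -
      have "x \<in> {x\<in>X. \<forall>n. snd (a n x) = 0}" "y \<in> {x\<in>X. \<forall>n. snd (a n x) = 0}"
        using that below by blast+
      moreover obtain z where "{x\<in>X. \<forall>n. snd (a n x) = 0} = {z}" using pt by blast
      ultimately show ?thesis by (metis singletonD)
    qed
  qed
  then obtain N where N: "\<And>x h. x \<in> X \<Longrightarrow> snd (a (M + N) x) = 0 \<Longrightarrow> 1 \<le> h \<Longrightarrow> h \<le> L \<Longrightarrow>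
      snd (a (M + N) ((T ^^ h) x)) = 0 \<Longrightarrow> False"
    using funpow_mem[OF bij] by blast
  have "L < h (M + N) k" if k: "k < d (M + N)" for k
  proof (rule ccontr)
    assume le: "\<not> ?thesis"
    obtain y where y: "y \<in> X" "a (M + N) y = (k, 0)"
      using label_onto[OF bij lab k] by blast
    have hk: "h (M + N) k > 0" using label_range[OF bij lab y] by simp
    obtain x where x: "x \<in> X" "(T ^^ h (M + N) k) x = y" using funpow_surj[OF bij y(1)] by blast
    have "x \<in> (\<Union>k<d (M + N). tower_level X T {x\<in>X. a (M + N) x = (k, 0)} (h (M + N) k))"
      using x y k by (auto simp: tower_level_def)
    then have "snd (a (M + N) x) = 0"
      using ckr_partition_label[OF bij lab, of "M + N"] ckr_base_label[OF bij lab, of "M + N"]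
      unfolding ckr_partition_def by auto
    then show False using N[OF x(1), of "h (M + N) k"] x y hk le by auto
  qed
  then show ?thesis by (intro exI[of _ "M + N"]) auto
qed

text \<open>Every point meets the top of each tower of level \<open>n\<close> within a bounded time.
  A tower that is taller than this time plus the height \<open>h n l\<close> has room for the
  complete crossing that follows.\<close>

lemma labelled_sequence_primitive:
  fixes X :: "'a::metric_space set"
  assumes min: "minimal_system X T" and inf: "infinite X" and seq: "labelled_sequence X T d h a"
  shows "primitive_ckr X T d h (\<lambda>n k. {x\<in>X. a n x = (k, 0)})"
  unfolding primitive_ckr_def
proof (intro allI impI)
  fix n :: nat
  note bij = topological_dynamical_systemD(3)[OF minimal_systemD(1)[OF min]]
  note lab = labelled_sequenceD(1)[OF seq]
  have hpos: "h n k > 0" if k: "k < d n" for k n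
  proof -
    obtain y where "y \<in> X" "a n y = (k, 0)" using label_onto[OF bij lab k] by blast
    then show ?thesis using label_range[OF bij lab, of y n k 0] by simp
  qed
  have "\<exists>L. \<forall>x\<in>X. \<exists>i<L. a n ((T ^^ i) x) = (l, h n l - 1)" if l: "l < d n" for l
  proof -
    obtain y where y: "y \<in> X" "a n y = (l, 0)" using label_onto[OF bij lab l] by blast
    obtain x where x: "x \<in> X" "(T ^^ (h n l - 1)) x = y" using funpow_surj[OF bij y(1)] by blast
    have "a n x = (l, h n l - 1)"
      using label_backward[OF bij lab x(1), of n "h n l - 1" l 0] x y hpos[OF l] by simp
    then have "{x\<in>X. a n x = (l, h n l - 1)} \<noteq> {}" using x(1) by blast
    then have "\<exists>L. \<forall>x\<in>X. \<exists>i<L. (T ^^ i) x \<in> {x\<in>X. a n x = (l, h n l - 1)}"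
      by (intro forward_recurrence[OF min] label_fibre_open[OF bij lab])
    then show ?thesis by blast
  qed
  then obtain L where L: "\<And>l x. l < d n \<Longrightarrow> x \<in> X \<Longrightarrow> \<exists>i<L l. a n ((T ^^ i) x) = (l, h n l - 1)" by metis
  define M where "M = (\<Sum>l<d n. L l + h n l)"
  have M: "L l + h n l \<le> M" if "l < d n" for l
    unfolding M_def using that by (intro member_le_sum) auto
  obtain N where N: "N \<ge> Suc n" "\<And>k. k < d N \<Longrightarrow> h N k > M"
    using labelled_sequence_heights_unbounded[OF min inf seq] by blast
  show "\<exists>N>n. \<forall>k<d N. \<forall>l<d n. \<forall>x\<in>tower_level X T {x \<in> X. a N x = (k, 0)} (h N k - 1).
           \<exists>i. i + (h n l - 1) \<le> h N k - 1 \<and>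
               (T ^^ i) x \<in> tower_level X T {x \<in> X. a n x = (l, 0)} (h n l - 1)"
  proof (rule exI[of _ N], intro conjI allI impI ballI)
    show "n < N" using N(1) by simp
    fix k l x assume k: "k < d N" and l: "l < d n" and x: "x \<in> tower_level X T {x \<in> X. a N x = (k, 0)} (h N k - 1)"
    then have xX: "x \<in> X" by (simp add: tower_level_def)
    obtain i where i: "i < L l" "a n ((T ^^ i) x) = (l, h n l - 1)" using L[OF l xX] by blast
    have "(T ^^ i) x \<in> tower_level X T {x \<in> X. a n x = (l, 0)} (h n l - 1)"
      using i(2) funpow_mem[OF bij xX, of i] hpos[OF l] by (simp add: tower_level_label[OF bij lab])
    moreover have "i + (h n l - 1) \<le> h N k - 1" using i(1) M[OF l] N(2)[OF k] by linarith
    ultimately show "\<exists>i. i + (h n l - 1) \<le> h N k - 1 \<and>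
               (T ^^ i) x \<in> tower_level X T {x \<in> X. a n x = (l, 0)} (h n l - 1)" by blast
  qed
qed

theorem labelled_sequence_rank:
  fixes X :: "'a::metric_space set"
  assumes "minimal_system X T" "infinite X" "labelled_sequence X T d h a"
    and "d 0 = 1" "h 0 0 = 1" "\<And>n. d n \<le> r"
  shows "has_ckr_rank_at_most X T r"
proof -
  note bij = topological_dynamical_systemD(3)[OF minimal_systemD(1)[OF assms(1)]]
  show ?thesis
    unfolding has_ckr_rank_at_most_def
    by (intro exI conjI) (rule labelled_sequence_nested[OF bij assms(3,4,5)],
      rule labelled_sequence_primitive[OF assms(1,2,3)], rule allI[OF assms(6)])
qed

section \<open>Subshifts\<close>

text \<open>With this instance the library provides the metric of the sequence spaces.\<close>

instantiation nat :: metric_space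
begin

definition dist_nat_def: "dist (m::nat) n = (if m = n then 0 else (1::real))"

definition uniformity_nat_def:
  "(uniformity :: (nat \<times> nat) filter) = (INF e\<in>{0<..}. principal {(x, y). dist x y < e})"

instance
proof
  show "open U \<longleftrightarrow> (\<forall>x\<in>U. \<forall>\<^sub>F (x', y) in uniformity. x' = x \<longrightarrow> y \<in> U)" for U :: "nat set"
  proof -
    have "\<forall>\<^sub>F (x', y) in uniformity. x' = x \<longrightarrow> y \<in> U" if "x \<in> U" for x
    proof -
      have "uniformity \<le> principal {(x::nat, y). dist x y < 1}"
        unfolding uniformity_nat_def by (rule INF_lower) simp
      moreover have "\<forall>\<^sub>F (x', y) in principal {(x::nat, y). dist x y < 1}. x' = x \<longrightarrow> y \<in> U"
        using that by (auto simp: eventually_principal dist_nat_def split: if_splits)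
      ultimately show ?thesis by (rule filter_leD)
    qed
    then show ?thesis by (simp add: open_discrete)
  qed
qed (auto simp: dist_nat_def uniformity_nat_def)

end

definition agree :: "nat \<Rightarrow> (int \<Rightarrow> 'b) \<Rightarrow> (int \<Rightarrow> 'b) \<Rightarrow> bool" where
  "agree m x y \<longleftrightarrow> (\<forall>i. \<bar>i\<bar> \<le> int m \<longrightarrow> x i = y i)"

definition translate :: "int \<Rightarrow> (int \<Rightarrow> 'b) \<Rightarrow> (int \<Rightarrow> 'b)" where
  "translate k x = (\<lambda>i. x (i + k))"

lemma agree_sym: "agree m x y \<Longrightarrow> agree m y x"
  by (simp add: agree_def)

lemma agree_refl [simp]: "agree m x x"
  by (simp add: agree_def)

lemma agree_trans: "agree m x y \<Longrightarrow> agree m y z \<Longrightarrow> agree m x z"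
  by (simp add: agree_def)

lemma agree_mono: "agree m x y \<Longrightarrow> k \<le> m \<Longrightarrow> agree k x y"
  by (simp add: agree_def)

lemma agree_translate: "agree (m + k) x y \<Longrightarrow> \<bar>i\<bar> \<le> int k \<Longrightarrow> agree m (translate i x) (translate i y)"
  by (simp add: agree_def translate_def)

lemma translate_0 [simp]: "translate 0 x = x"
  by (simp add: translate_def)

lemma translate_translate [simp]: "translate i (translate j x) = translate (i + j) x"
  by (simp add: translate_def add.assoc)

lemma shift_eq_translate: "shift x = translate 1 x"
  by (simp add: shift_def translate_def)

lemma funpow_shift: "(shift ^^ n) x = translate (int n) x"
  by (induction n) (auto simp: shift_eq_translate)

text \<open>Nonempty subshifts over a finite set of letters. Closedness is stated through agreement
  on windows, so that membership of a limit obtained from \<open>cluster_point\<close> is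
  immediate.\<close>

definition shift_space :: "(int \<Rightarrow> nat) set \<Rightarrow> bool" where
  "shift_space X \<longleftrightarrow> X \<noteq> {} \<and> (\<exists>F. finite F \<and> (\<forall>x\<in>X. \<forall>i. x i \<in> F)) \<and>
     (\<forall>x\<in>X. \<forall>i. translate i x \<in> X) \<and> (\<forall>x. (\<forall>m. \<exists>y\<in>X. agree m x y) \<longrightarrow> x \<in> X)"

lemma shift_space_translate: "shift_space X \<Longrightarrow> x \<in> X \<Longrightarrow> translate i x \<in> X"
  by (simp add: shift_space_def)

lemma shift_space_limit: "shift_space X \<Longrightarrow> (\<And>m. \<exists>y\<in>X. agree m x y) \<Longrightarrow> x \<in> X"
  by (simp add: shift_space_def)

section \<open>Cylinder sets, and shift spaces as dynamical systems\<close>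

lemma open_cylinder:
  fixes x :: "'i \<Rightarrow> 'b::discrete_topology"
  assumes "finite F"
  shows "open {y. \<forall>i\<in>F. y i = x i}"
proof -
  have "{y. \<forall>i\<in>F. y i = x i} = (\<Pi>\<^sub>E i\<in>UNIV. if i \<in> F then {x i} else UNIV)"
    by (auto simp: PiE_UNIV_domain Pi_iff split: if_splits)
  moreover have "open (\<Pi>\<^sub>E i\<in>UNIV. if i \<in> F then {x i} else UNIV)"
  proof (rule open_PiE)
    show "finite {i. (if i \<in> F then {x i} else UNIV) \<noteq> UNIV}"
      by (rule finite_subset[OF _ assms]) (auto split: if_splits)
  qed (auto simp: open_discrete)
  ultimately show ?thesis by simp
qed

lemma open_contains_cylinder:
  fixes U :: "('i \<Rightarrow> 'b::topological_space) set"
  assumes "open U" "x \<in> U"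
  shows "\<exists>F. finite F \<and> (\<forall>y. (\<forall>i\<in>F. y i = x i) \<longrightarrow> y \<in> U)"
proof -
  have "openin (product_topology (\<lambda>i. euclidean) UNIV) U" using assms(1) by (simp add: open_fun_def)
  from product_topology_open_contains_basis[OF this assms(2)] obtain V where V:
    "x \<in> (\<Pi>\<^sub>E i\<in>UNIV. V i)" "finite {i. V i \<noteq> UNIV}" "(\<Pi>\<^sub>E i\<in>UNIV. V i) \<subseteq> U"
    by auto
  have "y \<in> U" if y: "\<forall>i\<in>{i. V i \<noteq> UNIV}. y i = x i" for y
  proof -
    have "y i \<in> V i" for i
      using V(1) y by (cases "V i = UNIV") (auto simp: PiE_UNIV_domain Pi_iff)
    then show ?thesis using V(3) by (auto simp: PiE_UNIV_domain)
  qed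
  then show ?thesis using V(2) by blast
qed

lemma open_agree: "open {y :: int \<Rightarrow> nat. agree m x y}"
proof -
  have "{y. agree m x y} = {y. \<forall>i\<in>{- int m..int m}. y i = x i}"
    unfolding agree_def by (intro Collect_cong) (metis abs_le_iff atLeastAtMost_iff minus_le_iff)
  then show ?thesis by (simp only: open_cylinder finite_atLeastAtMost_int)
qed

lemma open_contains_agree:
  fixes U :: "(int \<Rightarrow> nat) set"
  assumes "open U" "x \<in> U"
  shows "\<exists>m. \<forall>y. agree m x y \<longrightarrow> y \<in> U"
proof -
  obtain F where F: "finite F" "\<And>y. (\<forall>i\<in>F. y i = x i) \<Longrightarrow> y \<in> U"
    using open_contains_cylinder[OF assms] by blast
  obtain m :: nat where m: "\<And>i. i \<in> F \<Longrightarrow> nat \<bar>i\<bar> \<le> m"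
    using F(1) by (metis finite_imageI finite_nat_set_iff_bounded_le imageI)
  have "y \<in> U" if "agree m x y" for y
  proof (rule F(2), intro ballI)
    fix i assume "i \<in> F"
    then have "\<bar>i\<bar> \<le> int m" using m[of i] by linarith
    then show "y i = x i" using that by (simp add: agree_def)
  qed
  then show ?thesis by blast
qed

lemma openin_locally_determined:
  fixes X :: "(int \<Rightarrow> nat) set"
  assumes "A \<subseteq> X" "\<And>x y. x \<in> A \<Longrightarrow> y \<in> X \<Longrightarrow> agree m x y \<Longrightarrow> y \<in> A"
  shows "openin (top_of_set X) A"
proof -
  have "A = X \<inter> (\<Union>x\<in>A. {y. agree m x y})" using assms by auto
  then show ?thesis using open_agree by (metis openin_open_Int open_UN)
qed

lemma shift_space_system:
  assumes X: "shift_space X"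
  shows "topological_dynamical_system X shift"
proof (rule topological_dynamical_systemI)
  show "X \<noteq> {}" using X by (simp add: shift_space_def)
  have "\<exists>F. finite F \<and> (\<forall>x\<in>X. \<forall>i. x i \<in> F)" using X by (simp add: shift_space_def)
  then obtain F where F: "finite F" "\<And>x i. x \<in> X \<Longrightarrow> x i \<in> F" by blast
  have "compact (\<Pi>\<^sub>E i\<in>(UNIV::int set). F)"
    using F(1) compactin_PiE[of "\<lambda>_::int. euclidean :: nat topology" UNIV "\<lambda>_. F"]
    by (simp add: euclidean_product_topology finite_imp_compact)
  moreover have "closed X"
  proof -
    have "\<exists>U. open U \<and> x \<in> U \<and> U \<subseteq> - X" if x: "x \<in> - X" for x
    proof -
      obtain m where m: "\<And>y. y \<in> X \<Longrightarrow> \<not> agree m x y"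
        using shift_space_limit[OF X, of x] x by blast
      then show ?thesis by (intro exI[of _ "{y. agree m x y}"]) (auto simp: open_agree)
    qed
    then have "open (- X)" by (subst open_subopen) blast
    then show ?thesis by (simp add: closed_def)
  qed
  moreover have "X \<subseteq> (\<Pi>\<^sub>E i\<in>UNIV. F)" using F(2) by (auto simp: PiE_UNIV_domain)
  ultimately show "compact X" by (metis compact_Int_closed inf.absorb_iff2 inf_commute)
  show "bij_betw shift X X"
    by (rule bij_betw_byWitness[where f' = "translate (- 1)"])
      (use shift_space_translate[OF X] in \<open>auto simp: shift_eq_translate\<close>)
  show "continuous_on X shift"
    unfolding shift_def by (rule continuous_on_coordinatewise_then_product) (rule continuous_on_product_coordinates[THEN continuous_on_subset], simp)
qed

lemma shift_space_recurrence:
  fixes X :: "(int \<Rightarrow> nat) set"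
  assumes "minimal_system X shift" "b \<in> X"
  shows "\<exists>L. \<forall>x\<in>X. \<exists>j<L. agree m (translate (int j) x) b"
proof -
  have "\<exists>L. \<forall>x\<in>X. \<exists>i<L. (shift ^^ i) x \<in> {y\<in>X. agree m y b}"
  proof (rule forward_recurrence[OF assms(1)])
    show "openin (top_of_set X) {y\<in>X. agree m y b}"
      by (rule openin_locally_determined[of _ _ m]) (auto intro: agree_trans agree_sym)
    show "{y\<in>X. agree m y b} \<noteq> {}" using assms(2) by auto
  qed
  then show ?thesis unfolding funpow_shift by blast
qed

subsection \<open>Cutting long words at a common context\<close>

text \<open>The image of \<open>x\<close> under the sliding block code with local rule
  \<open>G\<close>. That \<open>G\<close> looks only at a window of some radius \<open>M\<close> is
  a hypothesis wherever the code is used.\<close>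

definition coded :: "((int \<Rightarrow> nat) \<Rightarrow> 'b) \<Rightarrow> (int \<Rightarrow> nat) \<Rightarrow> int \<Rightarrow> 'b" where
  "coded G x = (\<lambda>i. G (translate i x))"

lemma coded_translate: "coded G (translate k x) = (\<lambda>i. coded G x (i + k))"
  by (simp add: coded_def)

lemma coded_cong:
  assumes "\<And>x y. x \<in> X \<Longrightarrow> y \<in> X \<Longrightarrow> agree M x y \<Longrightarrow> G x = G y"
    and "translate i x \<in> X" "translate i' y \<in> X" "\<And>t. \<bar>t\<bar> \<le> int M \<Longrightarrow> x (i + t) = y (i' + t)"
  shows "coded G x i = coded G y i'"
  unfolding coded_def by (rule assms(1)[OF assms(2,3)]) (use assms(4) in \<open>simp add: agree_def translate_def add.commute\<close>)

text \<open>Each word of \<open>W\<close> is cut at one occurrence of the context \<open>b\<close>. The word between two consecutive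
  cuts, coded by \<open>G\<close>, depends only on the two words of \<open>W\<close> in which the cuts lie.\<close>

lemma context_covering_family:
  fixes G :: "(int \<Rightarrow> nat) \<Rightarrow> 'b"
  assumes X: "shift_space X" and W: "finite W" "card W \<le> r" "\<And>w. w \<in> W \<Longrightarrow> length w \<ge> L + 2 * M + 1"
    and cov: "\<And>x. x \<in> X \<Longrightarrow> covers W x"
    and rec: "\<And>x. x \<in> X \<Longrightarrow> \<exists>j<L. agree M (translate (int j) x) b"
    and loc: "\<And>x y. x \<in> X \<Longrightarrow> y \<in> X \<Longrightarrow> agree M x y \<Longrightarrow> G x = G y"
    and flag: "\<And>x. x \<in> X \<Longrightarrow> agree M x b \<Longrightarrow> F (G x)"
  shows "\<exists>P. covering_family F (r\<^sup>2) (coded G ` X) P"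
proof -
  note trX = shift_space_translate[OF X]
  \<comment> \<open>The choice depends on the word \<open>w\<close> alone, so equal words are cut at
    equal places. The margin \<open>M\<close> on both sides keeps the window of the context inside
    \<open>w\<close>.\<close>
  define pos where "pos w = (SOME j. M \<le> j \<and> j + M < length w \<and> (\<forall>t. \<bar>t\<bar> \<le> int M \<longrightarrow> w ! nat (int j + t) = b t))" for w
  have pos: "M \<le> pos w \<and> pos w + M < length w \<and> (\<forall>t. \<bar>t\<bar> \<le> int M \<longrightarrow> w ! nat (int (pos w) + t) = b t)"
    if "x \<in> X" "segment x c e \<in> W" "w = segment x c e" for x c e w
  proof -
    \<comment> \<open>Recentring at \<open>c + M\<close> puts the context at an offset from
      \<open>M\<close> to below \<open>L + M\<close>, and the length \<open>L + 2 * M + 1\<close>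
      leaves room for the right half of its window.\<close>
    have xX: "translate (c + int M) x \<in> X" using trX that(1) by blast
    obtain j where j: "j < L" "agree M (translate (int j) (translate (c + int M) x)) b"
      using rec[OF xX] by blast
    have len: "length w \<ge> L + 2 * M + 1" using W(3) that by blast
    have "w ! nat (int (j + M) + t) = b t" if t: "\<bar>t\<bar> \<le> int M" for t
    proof -
      have "nat (int (j + M) + t) < length w" using t len j(1) by linarith
      moreover have "int (nat (int (j + M) + t)) = int (j + M) + t" using t by linarith
      ultimately have "w ! nat (int (j + M) + t) = x (c + (int (j + M) + t))"
        unfolding \<open>w = segment x c e\<close> segment_def by (simp del: int_nat_eq)
      also have "\<dots> = translate (int j) (translate (c + int M) x) t"
        by (simp add: translate_def algebra_simps)
      also have "\<dots> = b t" using j(2) t unfolding agree_def by blast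
      finally show ?thesis .
    qed
    moreover have "M \<le> j + M" "j + M + M < length w" using len j(1) by linarith+
    ultimately have "\<exists>j. M \<le> j \<and> j + M < length w \<and> (\<forall>t. \<bar>t\<bar> \<le> int M \<longrightarrow> w ! nat (int j + t) = b t)"
      by blast
    then show ?thesis unfolding pos_def by (rule someI_ex)
  qed
  define cut where "cut x c e = c + int (pos (segment x c e))" for x c e
  have cut: "c + int M \<le> cut x c e" "cut x c e + int M < e" "agree M (translate (cut x c e) x) b"
    if "x \<in> X" "segment x c e \<in> W" for x c e
  proof -
    note p = pos[OF that refl]
    have pl: "pos (segment x c e) + M < nat (e - c)" using p by simp
    show "c + int M \<le> cut x c e" "cut x c e + int M < e" using p pl unfolding cut_def by linarith+
    have "x (t + cut x c e) = b t" if t: "\<bar>t\<bar> \<le> int M" for t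
    proof -
      have n: "nat (int (pos (segment x c e)) + t) < nat (e - c)" using t pl by linarith
      have "int (pos (segment x c e)) + t \<ge> 0" using t p by linarith
      moreover have "segment x c e ! nat (int (pos (segment x c e)) + t) = b t" using p t by blast
      ultimately show ?thesis using n by (simp add: cut_def algebra_simps)
    qed
    then show "agree M (translate (cut x c e) x) b" by (simp add: agree_def translate_def)
  qed
  \<comment> \<open>A piece is read off at some occurrence of \<open>w\<close> followed by
    \<open>w'\<close>. Its independence of the occurrence is \<open>uniq\<close>, and this is what
    bounds the number of pieces by \<open>r\<^sup>2\<close>.\<close>
  define is_word where "is_word w w' v \<longleftrightarrow> (\<exists>x\<in>X. \<exists>c e g. segment x c e = w \<and> segment x e g = w' \<and>
      v = segment (coded G x) (cut x c e) (cut x e g))" for w w' v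
  define P where "P = {v. \<exists>w\<in>W. \<exists>w'\<in>W. is_word w w' v}"
  have uniq: "v1 = v2" if v: "is_word w w' v1" "is_word w w' v2" "w \<in> W" "w' \<in> W" for w w' v1 v2
  proof -
    obtain x c e g where 1: "x \<in> X" "segment x c e = w" "segment x e g = w'"
      "v1 = segment (coded G x) (cut x c e) (cut x e g)" using v(1) unfolding is_word_def by blast
    obtain y c' e' g' where 2: "y \<in> X" "segment y c' e' = w" "segment y e' g' = w'"
      "v2 = segment (coded G y) (cut y c' e') (cut y e' g')" using v(2) unfolding is_word_def by blast
    have ne: "w \<noteq> []" "w' \<noteq> []" using W(3) v(3,4) by force+
    have o: "c \<le> e" "e \<le> g" "c' \<le> e'" "e' \<le> g'" using 1(2,3) 2(2,3) ne by (auto simp: segment_def split: if_splits intro: ccontr)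
    have l: "e - c = e' - c'" "g - e = g' - e'"
      using arg_cong[OF 1(2), of length] arg_cong[OF 2(2), of length]
        arg_cong[OF 1(3), of length] arg_cong[OF 2(3), of length] o by auto
    have ww: "segment x c g = segment y c' g'"
      using 1(2,3) 2(2,3) o by (metis segment_append)
    have xy: "x (c + i) = y (c' + i)" if "0 \<le> i" "i < g - c" for i
    proof -
      have "segment x c g ! nat i = segment y c' g' ! nat i" using ww by simp
      then show ?thesis using that l by simp
    qed
    have p: "cut x c e - c = cut y c' e' - c'" "cut x e g - e = cut y e' g' - e'"
      using 1(2,3) 2(2,3) by (simp_all add: cut_def)
    note b1 = cut[OF 1(1), of c e] cut[OF 1(1), of e g]
    show ?thesis unfolding 1(4) 2(4)
    proof (rule nth_equalityI)
      show "length (segment (coded G x) (cut x c e) (cut x e g)) = length (segment (coded G y) (cut y c' e') (cut y e' g'))"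
        using p l by simp
      fix i assume "i < length (segment (coded G x) (cut x c e) (cut x e g))"
      then have i: "cut x c e + int i < cut x e g" "cut y c' e' + int i < cut y e' g'" using p l by auto
      have "coded G x (cut x c e + int i) = coded G y (cut y c' e' + int i)"
      proof (rule coded_cong[where X = X and G = G and M = M, OF loc])
        fix t :: int assume t: "\<bar>t\<bar> \<le> int M"
        \<comment> \<open>Cuts keep distance \<open>M\<close> from the ends of their words, so the
          window of radius \<open>M\<close> around any coordinate of the piece stays inside the
          occurrence of \<open>w @ w'\<close>.\<close>
        have "x (c + (cut x c e - c + int i + t)) = y (c' + (cut x c e - c + int i + t))"
          by (rule xy) (use t i b1 1(2,3) v(3,4) in auto)
        moreover have "c' + (cut x c e - c + int i + t) = cut y c' e' + int i + t" using p by simp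
        moreover have "c + (cut x c e - c + int i + t) = cut x c e + int i + t" by simp
        ultimately show "x (cut x c e + int i + t) = y (cut y c' e' + int i + t)" by metis
      qed (use trX 1(1) 2(1) in auto)
      then show "segment (coded G x) (cut x c e) (cut x e g) ! i = segment (coded G y) (cut y c' e') (cut y e' g') ! i"
        using i by simp
    qed
  qed
  define f where "f = (\<lambda>(w, w'). SOME v. is_word w w' v)"
  have "P \<subseteq> f ` (W \<times> W)"
  proof
    fix v assume "v \<in> P"
    then obtain w w' where w: "w \<in> W" "w' \<in> W" "is_word w w' v" unfolding P_def by blast
    then have "is_word w w' (f (w, w'))" unfolding f_def by (auto intro: someI)
    then have "v = f (w, w')" using uniq w by blast
    then show "v \<in> f ` (W \<times> W)" using w by blast
  qed
  then have finP: "finite P" and cardP: "card P \<le> card (W \<times> W)"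
    using W(1) surj_card_le[of "W \<times> W" P f] by (auto intro: finite_subset)
  have "card (W \<times> W) \<le> r\<^sup>2" using W(2) by (simp add: card_cartesian_product power2_eq_square mult_le_mono)
  then have cP: "card P \<le> r\<^sup>2" using cardP by simp
  have fl: "flagged F P"
    unfolding flagged_def
  proof (intro conjI ballI finP)
    fix v assume "v \<in> P"
    then obtain w w' x c e g where v: "w \<in> W" "w' \<in> W" "x \<in> X" "segment x c e = w" "segment x e g = w'"
      "v = segment (coded G x) (cut x c e) (cut x e g)" unfolding P_def is_word_def by blast
    have lt: "cut x c e < cut x e g"
      using cut(2)[of x c e] cut(1)[of x e g] v by auto
    then show "v \<noteq> []" using v(6) by (simp add: segment_eq_Nil_iff)
    have "hd v = G (translate (cut x c e) x)" using lt v(6) by (simp add: segment_hd coded_def)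
    then show "F (hd v)" using flag[OF trX[OF v(3)] cut(3)] v by auto
  qed
  have "covers P (coded G x)" if x: "x \<in> X" for x
  proof -
    have "[] \<notin> W" using W(3) by fastforce
    then obtain D where D: "factors W x D" using covers_imp_factors[OF W(1) _ cov[OF x]] by blast
    have "\<forall>c\<in>D. \<exists>e. e \<in> D \<and> c < e \<and> {c<..<e} \<inter> D = {} \<and> segment x c e \<in> W"
      using factors_next[OF D] by blast
    from bchoice[OF this] obtain nx where
      nx: "\<And>c. c \<in> D \<Longrightarrow> nx c \<in> D \<and> c < nx c \<and> {c<..<nx c} \<inter> D = {} \<and> segment x c (nx c) \<in> W"
      by blast
    define q where "q c = cut x c (nx c)" for c
    have q: "c \<le> q c" "q c < nx c" if "c \<in> D" for c
    proof -
      have "segment x c (nx c) \<in> W" using nx[OF that] by blast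
      note b = cut(1,2)[OF x this]
      show "c \<le> q c" "q c < nx c" using b unfolding q_def by linarith+
    qed
    have chain: "(nx ^^ n) c \<in> D \<and> c + int n \<le> (nx ^^ n) c \<and>
        (\<exists>ws\<in>lists P. segment (coded G x) (q c) (q ((nx ^^ n) c)) = concat ws)" if "c \<in> D" for c n
    proof (induction n)
      case 0
      then show ?case using that by (auto intro: bexI[of _ "[]"])
    next
      case (Suc n)
      define d where "d = (nx ^^ n) c"
      obtain ws where d: "d \<in> D" "c + int n \<le> d" and ws: "ws \<in> lists P" "segment (coded G x) (q c) (q d) = concat ws"
        using Suc unfolding d_def by blast
      have nd: "nx d \<in> D" "d < nx d" using nx d by auto
      have "is_word (segment x d (nx d)) (segment x (nx d) (nx (nx d))) (segment (coded G x) (q d) (q (nx d)))"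
        unfolding is_word_def q_def using x by blast
      then have "segment (coded G x) (q d) (q (nx d)) \<in> P"
        unfolding P_def using nx[OF d(1)] nx[OF nd(1)] by blast
      moreover have "q c \<le> q d"
      proof (cases "c = d")
        case False
        then have "c < d" using d(2) by linarith
        then have "nx c \<le> d" using nx[OF that] d(1) by force
        then show ?thesis using q[OF that] q[OF d(1)] by linarith
      qed simp
      moreover have "q d \<le> q (nx d)" using q[OF d(1)] q[OF nd(1)] by linarith
      ultimately have "ws @ [segment (coded G x) (q d) (q (nx d))] \<in> lists P"
        "segment (coded G x) (q c) (q (nx d)) = concat (ws @ [segment (coded G x) (q d) (q (nx d))])"
        using ws segment_append[of "q c" "q d" "q (nx d)" "coded G x"] by auto
      then have "\<exists>ws\<in>lists P. segment (coded G x) (q c) (q (nx d)) = concat ws" by blast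
      then show ?case using nd d by (simp add: d_def)
    qed
    show ?thesis unfolding covers_def
    proof (intro allI)
      fix u v
      obtain e where e: "e \<in> D" "e \<le> u" using D unfolding factors_def by blast
      \<comment> \<open>The cut inside the block that starts at \<open>e\<close> may lie to the
        right of \<open>u\<close>. The preceding block ends at \<open>e\<close>, so the cut inside
        it lies to the left of \<open>u\<close>.\<close>
      obtain c where c: "c \<in> D" "c < e" "{c<..<e} \<inter> D = {}" using factors_prev[OF D e(1)] by blast
      have "nx c = e" using nx[OF c(1)] c e by force
      then have qu: "q c \<le> u" using q(2)[OF c(1)] e(2) by simp
      define n where "n = nat (max u v - c)"
      obtain ws where ws: "ws \<in> lists P" "segment (coded G x) (q c) (q ((nx ^^ n) c)) = concat ws"
        and nn: "(nx ^^ n) c \<in> D" "c + int n \<le> (nx ^^ n) c" using chain[OF c(1), of n] by blast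
      have "max u v \<le> q ((nx ^^ n) c)" using q(1)[OF nn(1)] nn(2) unfolding n_def by linarith
      then have "sublist (segment (coded G x) u v) (concat ws)"
      proof (cases "u \<le> v")
        case True
        then show ?thesis using ws(2) sublist_segment[of "q c" u v] qu \<open>max u v \<le> _\<close> by (metis max.bounded_iff)
      next
        case False
        then have "segment (coded G x) u v = []" by (simp add: segment_eq_Nil_iff)
        then show ?thesis by simp
      qed
      then show "\<exists>ws\<in>lists P. sublist (segment (coded G x) u v) (concat ws)" using ws(1) by blast
    qed
  qed
  then show ?thesis using fl cP unfolding covering_family_def by auto
qed

subsection \<open>Refining a labelling\<close>

text \<open>All that the rank bound takes from a growing directive sequence of alphabet rank at most
  \<open>r\<close>. The condition speaks of \<open>X\<close> alone, so any such sequence generating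
  \<open>X\<close> may supply the words.\<close>

definition long_words :: "nat \<Rightarrow> (int \<Rightarrow> nat) set \<Rightarrow> bool" where
  "long_words r X \<longleftrightarrow> (\<forall>l. \<exists>W. finite W \<and> card W \<le> r \<and> (\<forall>w\<in>W. length w \<ge> l) \<and> (\<forall>x\<in>X. covers W x))"

text \<open>The block around \<open>i\<close> has length at most \<open>L\<close> and its code
  letters look \<open>M\<close> further, so one approximation on the window of radius
  \<open>\<bar>i\<bar> + L + M\<close> settles the claim at \<open>i\<close>.\<close>

lemma factors_coded_limit:
  fixes G :: "(int \<Rightarrow> nat) \<Rightarrow> 'b"
  assumes X: "shift_space X" and loc: "\<And>x y. x \<in> X \<Longrightarrow> y \<in> X \<Longrightarrow> agree M x y \<Longrightarrow> G x = G y"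
    and fin: "finite P" and x: "x \<in> X"
    and lim: "\<And>m. \<exists>y D'. y \<in> X \<and> agree m x y \<and> (\<forall>i. \<bar>i\<bar> \<le> int m \<longrightarrow> (i \<in> D \<longleftrightarrow> i \<in> D')) \<and> factors P (coded G y) D'"
  shows "factors P (coded G x) D"
  unfolding factors_def
proof
  fix i
  obtain L :: nat where L: "\<And>p. p \<in> P \<Longrightarrow> length p \<le> L"
    using fin by (metis finite_imageI finite_nat_set_iff_bounded_le imageI)
  define m where "m = nat \<bar>i\<bar> + L + M"
  obtain y D' where y: "y \<in> X" "agree m x y" and mem: "\<And>i. \<bar>i\<bar> \<le> int m \<Longrightarrow> (i \<in> D \<longleftrightarrow> i \<in> D')"
    and D': "factors P (coded G y) D'" using lim[of m] by blast
  obtain d e where de: "d \<in> D'" "e \<in> D'" "d \<le> i" "i < e" "{d<..<e} \<inter> D' = {}" "segment (coded G y) d e \<in> P"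
    using D' unfolding factors_def by blast
  have le: "e - d \<le> int L" using L[OF de(6)] de(3,4) by simp
  have b: "\<bar>t\<bar> \<le> int (nat \<bar>i\<bar> + L)" if "d \<le> t" "t \<le> e" for t using that le de(3,4) by linarith
  have bm: "\<bar>t\<bar> \<le> int m" if "d \<le> t" "t \<le> e" for t using b[OF that] unfolding m_def by linarith
  have "segment (coded G x) d e = segment (coded G y) d e"
  proof (rule segment_cong)
    fix t assume t: "d \<le> t" "t < e"
    have "agree (M + (nat \<bar>i\<bar> + L)) x y" using y(2) by (simp add: m_def add.commute)
    then have "agree M (translate t x) (translate t y)" using b[of t] t by (intro agree_translate) auto
    then show "coded G x t = coded G y t"
      unfolding coded_def using shift_space_translate[OF X] x y(1) by (intro loc) auto
  qed
  then have "segment (coded G x) d e \<in> P" using de(6) by simp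
  moreover have "d \<in> D" "e \<in> D" using mem[OF bm, of d] mem[OF bm, of e] de(1-4) by auto
  moreover have "{d<..<e} \<inter> D = {}"
  proof -
    have "t \<notin> D" if "t \<in> {d<..<e}" for t using mem[OF bm, of t] de(5) that by auto
    then show ?thesis by blast
  qed
  ultimately show "\<exists>d\<in>D. \<exists>e\<in>D. d \<le> i \<and> i < e \<and> {d<..<e} \<inter> D = {} \<and> segment (coded G x) d e \<in> P"
    using de(3,4) by blast
qed

text \<open>Uniqueness turns into continuity: if no window determined the cuts near 0, a limit point
  would inherit two cut sets that differ near 0. This is what makes the base of the new partition
  clopen.\<close>

lemma cut_set_locally_determined:
  fixes G :: "(int \<Rightarrow> nat) \<Rightarrow> 'b"
  assumes X: "shift_space X" and loc: "\<And>x y. x \<in> X \<Longrightarrow> y \<in> X \<Longrightarrow> agree M x y \<Longrightarrow> G x = G y"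
    and fin: "finite P" and uniq: "\<And>x. x \<in> X \<Longrightarrow> \<exists>!D. factors P (coded G x) D"
    and D: "\<And>x. x \<in> X \<Longrightarrow> factors P (coded G x) (D x)"
  shows "\<exists>m. \<forall>x\<in>X. \<forall>y\<in>X. agree m x y \<longrightarrow> (\<forall>i. \<bar>i\<bar> \<le> int l \<longrightarrow> (i \<in> D x \<longleftrightarrow> i \<in> D y))"
proof (rule ccontr)
  assume neg: "\<not> ?thesis"
  have "\<exists>x y. x \<in> X \<and> y \<in> X \<and> agree m x y \<and> \<not> (\<forall>i. \<bar>i\<bar> \<le> int l \<longrightarrow> (i \<in> D x \<longleftrightarrow> i \<in> D y))" for m
    using neg by blast
  then obtain x y where xy: "\<And>m. x m \<in> X" "\<And>m. y m \<in> X" "\<And>m. agree m (x m) (y m)"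
    and diff: "\<And>m. \<not> (\<forall>i. \<bar>i\<bar> \<le> int l \<longrightarrow> (i \<in> D (x m) \<longleftrightarrow> i \<in> D (y m)))"
    by metis
  have "\<exists>A. finite A \<and> (\<forall>x\<in>X. \<forall>i. x i \<in> A)" using X by (simp add: shift_space_def)
  then obtain A where A: "finite A" "\<And>x i. x \<in> X \<Longrightarrow> x i \<in> A" by blast
  \<comment> \<open>The points and both cut sets converge along common indices. The points
    \<open>y n\<close> get no component of their own, since they agree with \<open>x n\<close> on
    growing windows.\<close>
  have "\<exists>g. (\<forall>i. g i \<in> A \<times> (UNIV :: (bool \<times> bool) set)) \<and>
    (\<forall>m::nat. infinite {n. \<forall>i. \<bar>i\<bar> \<le> int m \<longrightarrow> (x n i, i \<in> D (x n), i \<in> D (y n)) = g i})"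
    by (rule cluster_point) (use A xy in \<open>auto simp: finite_Prod_UNIV\<close>)
  then obtain g where g: "\<And>m::nat. infinite {n. \<forall>i. \<bar>i\<bar> \<le> int m \<longrightarrow> (x n i, i \<in> D (x n), i \<in> D (y n)) = g i}"
    by blast
  define z where "z i = fst (g i)" for i
  define D1 where "D1 = {i. fst (snd (g i))}"
  define D2 where "D2 = {i. snd (snd (g i))}"
  have near: "\<exists>n\<ge>m. agree m z (x n) \<and> agree m z (y n) \<and>
      (\<forall>i. \<bar>i\<bar> \<le> int m \<longrightarrow> (i \<in> D1 \<longleftrightarrow> i \<in> D (x n)) \<and> (i \<in> D2 \<longleftrightarrow> i \<in> D (y n)))" for m
  proof -
    obtain n where n: "n \<ge> m" "\<forall>i. \<bar>i\<bar> \<le> int m \<longrightarrow> (x n i, i \<in> D (x n), i \<in> D (y n)) = g i"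
      using g[of m] unfolding infinite_nat_iff_unbounded_le by blast
    have gi: "g i = (x n i, i \<in> D (x n), i \<in> D (y n))" if "\<bar>i\<bar> \<le> int m" for i using n(2) that by metis
    have "agree m z (x n)" by (simp add: agree_def z_def gi)
    moreover have "agree m z (y n)"
      using agree_trans[OF \<open>agree m z (x n)\<close> agree_mono[OF xy(3) n(1)]] .
    ultimately show ?thesis using n(1) gi by (intro exI[of _ n]) (auto simp: D1_def D2_def)
  qed
  have zX: "z \<in> X" by (rule shift_space_limit[OF X]) (use near xy(1) in blast)
  have "factors P (coded G z) D1"
  proof (rule factors_coded_limit[OF X loc fin zX])
    fix m
    obtain n where n: "agree m z (x n)" "\<forall>i. \<bar>i\<bar> \<le> int m \<longrightarrow> (i \<in> D1 \<longleftrightarrow> i \<in> D (x n))"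
      using near[of m] by blast
    then show "\<exists>u D'. u \<in> X \<and> agree m z u \<and> (\<forall>i. \<bar>i\<bar> \<le> int m \<longrightarrow> (i \<in> D1 \<longleftrightarrow> i \<in> D')) \<and>
        factors P (coded G u) D'"
      using xy(1)[of n] D[OF xy(1)[of n]] by (intro exI[of _ "x n"] exI[of _ "D (x n)"]) blast
  qed
  moreover have "factors P (coded G z) D2"
  proof (rule factors_coded_limit[OF X loc fin zX])
    fix m
    obtain n where n: "agree m z (y n)" "\<forall>i. \<bar>i\<bar> \<le> int m \<longrightarrow> (i \<in> D2 \<longleftrightarrow> i \<in> D (y n))"
      using near[of m] by blast
    then show "\<exists>u D'. u \<in> X \<and> agree m z u \<and> (\<forall>i. \<bar>i\<bar> \<le> int m \<longrightarrow> (i \<in> D2 \<longleftrightarrow> i \<in> D')) \<and>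
        factors P (coded G u) D'"
      using xy(2)[of n] D[OF xy(2)[of n]] by (intro exI[of _ "y n"] exI[of _ "D (y n)"]) blast
  qed
  ultimately have "D1 = D2" using uniq[OF zX] by blast
  then show False using near[of l] diff by blast
qed

text \<open>The label of \<open>x\<close> is the index of the block of its code that covers
  coordinate 0, with the distance from 0 to the last coordinate of that block; a base point is one
  whose next cut is at 1. Since the code letters contain the old label and a window of radius
  \<open>n\<close>, equal new labels force agreement of both. Since every cut carries the context
  flag, all base points lie in one small cylinder inside the old base.\<close>

lemma refine_labelling:
  fixes X :: "(int \<Rightarrow> nat) set"
  assumes X: "shift_space X" and min: "minimal_system X shift" and lw: "long_words r X"
    and lab: "tower_labelling X shift d h a"
    and loc: "\<And>x y. x \<in> X \<Longrightarrow> y \<in> X \<Longrightarrow> agree m x y \<Longrightarrow> a x = a y"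
  shows "\<exists>d' h' a' m'. tower_labelling X shift d' h' a' \<and> d' \<le> r\<^sup>2 \<and>
    (\<forall>x\<in>X. \<forall>y\<in>X. agree m' x y \<longrightarrow> a' x = a' y) \<and>
    (\<forall>x\<in>X. snd (a' x) = 0 \<longrightarrow> snd (a x) = 0) \<and>
    (\<forall>x\<in>X. \<forall>y\<in>X. a' x = a' y \<longrightarrow> a x = a y \<and> agree n x y) \<and>
    (\<forall>x\<in>X. \<forall>y\<in>X. snd (a' x) = 0 \<and> snd (a' y) = 0 \<longrightarrow> agree n x y)"
proof -
  note trX = shift_space_translate[OF X]
  have bij: "bij_betw shift X X"
    using topological_dynamical_systemD(3)[OF shift_space_system[OF X]] .
  obtain z where z: "z \<in> X" using X unfolding shift_space_def by blast
  obtain k0 j0 where "a z = (k0, j0)" by (cases "a z")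
  then have "k0 < d" using label_range[OF bij lab z] by blast
  then obtain y0 where y0: "y0 \<in> X" "snd (a y0) = 0" using label_onto[OF bij lab] by (metis snd_conv)
  \<comment> \<open>Cuts sit one step after base points, so the context is taken around the
    successor of an old base point.\<close>
  define b where "b = shift y0"
  have bX: "b \<in> X" using trX[OF y0(1), of 1] by (simp add: b_def shift_eq_translate)
  \<comment> \<open>The extra 1 is lost when the agreement of shifted points is carried back by one
    step.\<close>
  define M where "M = max m n + 1"
  define G where "G x = (a x, segment x (- int n) (int n + 1), agree M x b)" for x
  define F where "F = (\<lambda>v :: (nat \<times> nat) \<times> nat list \<times> bool. snd (snd v))"
  have locG: "G x = G y" if "x \<in> X" "y \<in> X" "agree M x y" for x y
  proof -
    have "a x = a y" using that agree_mono[OF that(3), of m] by (intro loc) (auto simp: M_def)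
    moreover have "segment x (- int n) (int n + 1) = segment y (- int n) (int n + 1)"
    proof (rule segment_cong)
      fix i assume i: "- int n \<le> i" "i < int n + 1"
      have "agree n x y" using agree_mono[OF that(3), of n] by (auto simp: M_def)
      then show "x i = y i" using i unfolding agree_def by auto
    qed
    moreover have "agree M x b \<longleftrightarrow> agree M y b" using that(3) agree_trans agree_sym by metis
    ultimately show ?thesis by (simp add: G_def)
  qed
  obtain L where "\<forall>x\<in>X. \<exists>j<L. agree M (translate (int j) x) b"
    using shift_space_recurrence[OF min bX, of M] by (elim exE)
  then have L: "\<exists>j<L. agree M (translate (int j) x) b" if "x \<in> X" for x by (rule bspec) (rule that)
  have "\<exists>W. finite W \<and> card W \<le> r \<and> (\<forall>w\<in>W. length w \<ge> L + 2 * M + 1) \<and> (\<forall>x\<in>X. covers W x)"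
    using lw unfolding long_words_def by (rule spec)
  then obtain W where W: "finite W" "card W \<le> r" "\<And>w. w \<in> W \<Longrightarrow> length w \<ge> L + 2 * M + 1"
    "\<And>x. x \<in> X \<Longrightarrow> covers W x" by blast
  have "\<exists>P. covering_family F (r\<^sup>2) (coded G ` X) P"
    by (rule context_covering_family[OF X W L locG]) (auto simp: F_def G_def)
  then obtain P where min: "minimal_family F (r\<^sup>2) (coded G ` X) P" using ex_minimal_family by blast
  have fl: "flagged F P" and cP: "card P \<le> r\<^sup>2"
    using min unfolding minimal_family_def covering_family_def by auto
  then have finP: "finite P" by (simp add: flagged_def)
  have uniq: "\<exists>!D. factors P (coded G x) D" if "x \<in> X" for x
    using minimal_family_unique_factorization[OF min] that by blast
  define D where "D x = (THE D. factors P (coded G x) D)" for x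
  have D: "factors P (coded G x) (D x)" if "x \<in> X" for x
    unfolding D_def by (rule theI'[OF uniq[OF that]])
  have Deq: "E = D x" if "x \<in> X" "factors P (coded G x) E" for x E
    using uniq[OF that(1)] D[OF that(1)] that(2) by blast
  have Dtr: "D (translate k x) = (\<lambda>d. d - k) ` D x" if "x \<in> X" for k x
    using Deq[OF trX[OF that] factors_translate[OF D[OF that], of k, folded coded_translate]] by simp
  define blk where "blk x c e \<longleftrightarrow> c \<in> D x \<and> e \<in> D x \<and> c \<le> 0 \<and> 0 < e \<and> {c<..<e} \<inter> D x = {}" for x c e
  have blk_uniq: "c = c' \<and> e = e'" if "blk x c e" "blk x c' e'" for x c e c' e'
    using that unfolding blk_def
    by (metis disjoint_iff greaterThanLessThan_iff linorder_neqE_linordered_idom order_le_less_trans)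
  have "\<forall>x\<in>X. \<exists>c e. blk x c e \<and> segment (coded G x) c e \<in> P"
  proof
    fix x assume "x \<in> X"
    then show "\<exists>c e. blk x c e \<and> segment (coded G x) c e \<in> P"
      using D[of x] unfolding factors_def blk_def by blast
  qed
  then obtain lo hi where lh: "\<And>x. x \<in> X \<Longrightarrow> blk x (lo x) (hi x)"
    "\<And>x. x \<in> X \<Longrightarrow> segment (coded G x) (lo x) (hi x) \<in> P" by metis
  define word where "word x = segment (coded G x) (lo x) (hi x)" for x
  have lohi: "lo x = c" "hi x = e" if "x \<in> X" "blk x c e" for x c e
    using blk_uniq[OF lh(1)[OF that(1)] that(2)] by auto
  \<comment> \<open>Keeping only the words that cover coordinate 0 of some point makes every tower
    nonempty.\<close>
  define P' where "P' = word ` X"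
  have P'P: "P' \<subseteq> P" using lh(2) unfolding P'_def word_def by auto
  then have finP': "finite P'" and cP': "card P' \<le> r\<^sup>2"
    using finP cP card_mono[OF finP P'P] by (auto intro: finite_subset)
  obtain idx where idx: "bij_betw idx P' {0..<card P'}" using ex_bij_betw_finite_nat[OF finP'] by blast
  have inj: "inj_on idx P'" using idx by (simp add: bij_betw_def)
  define h' where "h' k = length (inv_into P' idx k)" for k
  define a' where "a' x = (idx (word x), nat (hi x - 1))" for x
  have wP': "word x \<in> P'" if "x \<in> X" for x using that by (simp add: P'_def)
  have h': "h' (idx (word x)) = length (word x)" if "x \<in> X" for x
    using inv_into_f_f[OF inj wP'[OF that]] by (simp add: h'_def)
  have pos: "lo x \<le> 0" "0 < hi x" "lo x \<in> D x" "hi x \<in> D x" "{lo x<..<hi x} \<inter> D x = {}" if "x \<in> X" for x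
    using lh(1)[OF that] by (simp_all add: blk_def)
  have lword: "length (word x) = nat (hi x - lo x)" for x by (simp add: word_def)
  have tr_blk: "blk (translate k x) (lo x - k) (hi x - k)" if "x \<in> X" "lo x \<le> k" "k < hi x" for x k
  proof -
    have "{lo x - k<..<hi x - k} \<inter> (\<lambda>d. d - k) ` D x = {}"
      using pos(5)[OF that(1)] by force
    then show ?thesis using pos[OF that(1)] that unfolding blk_def Dtr[OF that(1)] by auto
  qed
  have tr_lohi: "lo (translate k x) = lo x - k" "hi (translate k x) = hi x - k" "word (translate k x) = word x"
    if "x \<in> X" "lo x \<le> k" "k < hi x" for x k
  proof -
    show 1: "lo (translate k x) = lo x - k" "hi (translate k x) = hi x - k"
      using lohi[OF trX[OF that(1)] tr_blk[OF that]] by auto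
    show "word (translate k x) = word x"
      unfolding word_def 1 by (simp add: coded_translate segment_translate)
  qed
  have code_eq: "coded G x 0 = coded G y 0" if "x \<in> X" "y \<in> X" "word x = word y" "hi x = hi y" for x y
  proof -
    have "nat (hi x - lo x) = nat (hi y - lo y)" using that(3) lword by metis
    then have lo: "lo x = lo y" using pos[OF that(1)] pos[OF that(2)] that(4) by linarith
    show ?thesis
      by (rule segment_eqD[of _ "lo x" "hi x"])
        (use that lo pos[OF that(1)] in \<open>auto simp: word_def\<close>)
  qed
  have zero_iff: "snd (a' x) = 0 \<longleftrightarrow> hi x = 1" if "x \<in> X" for x
    using pos[OF that] by (auto simp: a'_def)
  have in_context: "agree M (translate 1 x) b" if "x \<in> X" "hi x = 1" for x
  proof -
    have "1 \<in> D x" using pos(4)[OF that(1)] that(2) by simp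
    then have "F (coded G x 1)" using flagged_at_cut[OF fl D[OF that(1)]] by blast
    then show ?thesis by (simp add: F_def coded_def G_def)
  qed
  have ctx: "agree (M - 1) x y" if "x \<in> X" "y \<in> X" "agree M (translate 1 x) (translate 1 y)" for x y
    unfolding agree_def
  proof (intro allI impI)
    fix i assume i: "\<bar>i\<bar> \<le> int (M - 1)"
    have "translate 1 x (i - 1) = translate 1 y (i - 1)"
      using that(3) i unfolding agree_def by (auto simp: M_def)
    then show "x i = y i" by (simp add: translate_def)
  qed
  have M1: "m \<le> M - 1" "n \<le> M - 1" by (auto simp: M_def)
  obtain Lp :: nat where Lp: "\<And>p. p \<in> P \<Longrightarrow> length p \<le> Lp"
    using finP by (metis finite_imageI finite_nat_set_iff_bounded_le imageI)
  have "\<exists>m. \<forall>x\<in>X. \<forall>y\<in>X. agree m x y \<longrightarrow> (\<forall>i. \<bar>i\<bar> \<le> int Lp \<longrightarrow> (i \<in> D x \<longleftrightarrow> i \<in> D y))"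
  proof (rule cut_set_locally_determined[where G = G and M = M and P = P, OF X _ finP])
    show "G x = G y" if "x \<in> X" "y \<in> X" "agree M x y" for x y by (rule locG[OF that])
    show "\<exists>!D. factors P (coded G x) D" if "x \<in> X" for x by (rule uniq[OF that])
    show "factors P (coded G x) (D x)" if "x \<in> X" for x by (rule D[OF that])
  qed
  then obtain m1 where m1: "\<And>x y i. x \<in> X \<Longrightarrow> y \<in> X \<Longrightarrow> agree m1 x y \<Longrightarrow> \<bar>i\<bar> \<le> int Lp \<Longrightarrow> (i \<in> D x \<longleftrightarrow> i \<in> D y)"
    by blast
  \<comment> \<open>Radius \<open>m1\<close> fixes the cuts up to distance \<open>Lp\<close>, which
    reaches both ends of the block at 0; the code letters of this block need \<open>M\<close>
    further coordinates.\<close>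
  define m' where "m' = max m1 (M + Lp)"
  have loc': "a' x = a' y" if x: "x \<in> X" and y: "y \<in> X" and xy: "agree m' x y" for x y
  proof -
    have "agree m1 x y" using agree_mono[OF xy] by (simp add: m'_def)
    then have DD: "i \<in> D x \<longleftrightarrow> i \<in> D y" if "\<bar>i\<bar> \<le> int Lp" for i using m1[OF x y] that by blast
    have "length (word x) \<le> Lp" using Lp[OF lh(2)[OF x]] unfolding word_def .
    then have "nat (hi x - lo x) \<le> Lp" by (simp add: lword)
    then have small: "\<bar>t\<bar> \<le> int Lp" if "lo x \<le> t" "t \<le> hi x" for t using that pos[OF x] by linarith
    have "{lo x<..<hi x} \<inter> D y = {}"
    proof -
      have "t \<notin> D y" if "t \<in> {lo x<..<hi x}" for t using DD[OF small, of t] pos(5)[OF x] that by auto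
      then show ?thesis by blast
    qed
    then have "blk y (lo x) (hi x)"
      using pos[OF x] DD[OF small, of "lo x"] DD[OF small, of "hi x"] by (auto simp: blk_def)
    then have eq: "lo y = lo x" "hi y = hi x" using lohi[OF y] by auto
    have "segment (coded G x) (lo x) (hi x) = segment (coded G y) (lo x) (hi x)"
    proof (rule segment_cong)
      fix t assume t: "lo x \<le> t" "t < hi x"
      have "agree (M + Lp) x y" using agree_mono[OF xy] by (simp add: m'_def)
      then have "agree M (translate t x) (translate t y)" using small[of t] t by (intro agree_translate) auto
      then show "coded G x t = coded G y t" unfolding coded_def using trX x y by (intro locG) auto
    qed
    then show ?thesis using eq by (simp add: a'_def word_def)
  qed
  have lab': "tower_labelling X shift (card P') h' a'"
    unfolding tower_labelling_def
  proof (intro conjI ballI allI impI)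
    fix x assume x: "x \<in> X"
    show "fst (a' x) < card P'" using idx wP'[OF x] by (auto simp: a'_def bij_betw_def)
    show "snd (a' x) < h' (fst (a' x))" using h'[OF x] lword[of x] pos[OF x] by (simp add: a'_def)
  next
    fix k assume "k < card P'"
    then have "k \<in> idx ` P'" using idx by (simp add: bij_betw_def)
    then obtain p where p: "p \<in> P'" "idx p = k" by blast
    then obtain x where x: "x \<in> X" "word x = p" by (auto simp: P'_def)
    have "lo x \<le> hi x - 1" "hi x - 1 < hi x" using pos[OF x(1)] by auto
    note t = tr_lohi[OF x(1) this]
    have "a' (translate (hi x - 1) x) = (k, 0)" using t p x by (simp add: a'_def)
    then show "\<exists>x\<in>X. a' x = (k, 0)" using trX[OF x(1)] by blast
  next
    fix x k j assume x: "x \<in> X" and a: "a' x = (k, Suc j)"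
    then have "hi x > 1" by (auto simp: a'_def)
    then have "lo x \<le> 1" "1 < hi x" using pos[OF x] by auto
    note t = tr_lohi[OF x this]
    show "a' (shift x) = (k, j)" using a t by (auto simp: a'_def shift_eq_translate)
  next
    fix x assume x: "x \<in> X" and a: "snd (a' x) = 0"
    then have "1 \<in> D x" using zero_iff pos(4)[OF x] by force
    then have 0: "0 \<in> D (shift x)" using Dtr[OF x, of 1] by (auto simp: shift_eq_translate image_iff)
    have sx: "shift x \<in> X" using trX[OF x] by (simp add: shift_eq_translate)
    \<comment> \<open>After a base point a new block begins at coordinate 0, so the distance to its
      end is as large as possible: the top of a tower.\<close>
    have "lo (shift x) = 0" using 0 pos[OF sx] by force
    then show "snd (a' (shift x)) = h' (fst (a' (shift x))) - 1"
      using h'[OF sx] lword[of "shift x"] pos[OF sx] by (simp add: a'_def nat_diff_distrib')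
  next
    fix v show "openin (top_of_set X) {x \<in> X. a' x = v}"
    proof (rule openin_locally_determined[of _ _ m'])
      fix x y assume x: "x \<in> {x \<in> X. a' x = v}" and y: "y \<in> X" "agree m' x y"
      then have "a' x = a' y" by (intro loc') auto
      then show "y \<in> {x \<in> X. a' x = v}" using x y(1) by simp
    qed auto
  qed
  show ?thesis
  proof (intro exI conjI ballI impI)
    show "tower_labelling X shift (card P') h' a'" by (rule lab')
    show "card P' \<le> r\<^sup>2" by (rule cP')
    show "a' x = a' y" if "x \<in> X" "y \<in> X" "agree m' x y" for x y using loc' that by blast
  next
    fix x assume x: "x \<in> X" and a: "snd (a' x) = 0"
    have "agree M (translate 1 x) (translate 1 y0)"
      using in_context[OF x] zero_iff[OF x] a by (simp add: b_def shift_eq_translate)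
    then have "agree (M - 1) x y0" using ctx x y0(1) by blast
    then have "a x = a y0" using agree_mono[OF _ M1(1)] loc x y0(1) by blast
    then show "snd (a x) = 0" using y0(2) by simp
  next
    fix x y assume x: "x \<in> X" and y: "y \<in> X" and a: "a' x = a' y"
    have "word x = word y" using a inj wP'[OF x] wP'[OF y] by (auto simp: a'_def dest: inj_onD)
    moreover have "hi x = hi y" using a pos(2)[OF x] pos(2)[OF y] by (auto simp: a'_def)
    \<comment> \<open>The code letter at coordinate 0 is \<open>G x\<close> itself, and a block
      together with the position of 0 in it determines this letter.\<close>
    ultimately have "G x = G y" using code_eq[OF x y] by (simp add: coded_def)
    then have "a x = a y" and s: "segment x (- int n) (int n + 1) = segment y (- int n) (int n + 1)"
      by (auto simp: G_def)
    then show "a x = a y" by simp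
    show "agree n x y" unfolding agree_def using segment_eqD[OF s] by auto
  next
    fix x y assume x: "x \<in> X" and y: "y \<in> X" and a: "snd (a' x) = 0 \<and> snd (a' y) = 0"
    have "agree M (translate 1 x) (translate 1 y)"
      using in_context[OF x] in_context[OF y] zero_iff[OF x] zero_iff[OF y] a agree_trans agree_sym by metis
    then have "agree (M - 1) x y" using ctx x y by blast
    then show "agree n x y" using agree_mono M1(2) by blast
  qed
qed

subsection \<open>The rank of a subshift with long words\<close>

text \<open>Refinement is iterated with radius \<open>n\<close> at step \<open>n\<close>. Equal
  labels of level \<open>Suc n\<close> force agreement up to \<open>n\<close>, which yields the
  topology; so do two base points, which leaves at most one point in all bases. That there is one
  follows from compactness, because each labelling depends on a finite window.\<close>

lemma shift_space_labelled_sequence: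
  assumes X: "shift_space X" and min: "minimal_system X shift" and lw: "long_words r X" and r: "r \<ge> 1"
  shows "\<exists>d h a. labelled_sequence X shift d h a \<and> d 0 = 1 \<and> h 0 0 = 1 \<and> (\<forall>n. d n \<le> r\<^sup>2)"
proof -
  have bij: "bij_betw shift X X"
    using topological_dynamical_systemD(3)[OF shift_space_system[OF X]] .
  define good where "good n v \<longleftrightarrow> (case v of (d, h, a) \<Rightarrow> tower_labelling X shift d h a \<and> d \<le> r\<^sup>2 \<and>
      (\<exists>m. \<forall>x\<in>X. \<forall>y\<in>X. agree m x y \<longrightarrow> a x = a y) \<and> (n = 0 \<longrightarrow> d = 1 \<and> h 0 = 1))"
    for n :: nat and v :: "nat \<times> (nat \<Rightarrow> nat) \<times> ((int \<Rightarrow> nat) \<Rightarrow> nat \<times> nat)"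
  define finer where "finer n v v' \<longleftrightarrow> (case v of (d, h, a) \<Rightarrow> case v' of (d', h', a') \<Rightarrow>
      (\<forall>x\<in>X. snd (a' x) = 0 \<longrightarrow> snd (a x) = 0) \<and>
      (\<forall>x\<in>X. \<forall>y\<in>X. a' x = a' y \<longrightarrow> a x = a y \<and> agree n x y) \<and>
      (\<forall>x\<in>X. \<forall>y\<in>X. snd (a' x) = 0 \<and> snd (a' y) = 0 \<longrightarrow> agree n x y))"
    for n and v v' :: "nat \<times> (nat \<Rightarrow> nat) \<times> ((int \<Rightarrow> nat) \<Rightarrow> nat \<times> nat)"
  have "\<exists>f. \<forall>n. good n (f n) \<and> finer n (f n) (f (Suc n))"
  proof (rule dependent_nat_choice)
    have "tower_labelling X shift 1 (\<lambda>_. 1) (\<lambda>_. (0, 0))"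
      unfolding tower_labelling_def
    proof (intro conjI ballI allI impI)
      show "\<exists>x\<in>X. (0::nat, 0::nat) = (k, 0)" if "k < 1" for k
        using X that by (auto simp: shift_space_def)
      show "openin (top_of_set X) {x \<in> X. (0, 0) = v}" for v :: "nat \<times> nat"
        by (cases "(0, 0) = v") auto
    qed auto
    moreover have "1 \<le> r\<^sup>2" using r by simp
    ultimately have "good 0 (1, \<lambda>_. 1, \<lambda>_. (0, 0))" by (simp add: good_def)
    then show "\<exists>v. good 0 v" by blast
  next
    fix v n assume v: "good n v"
    obtain d h a where dha: "v = (d, h, a)" by (cases v)
    have lab: "tower_labelling X shift d h a" using v dha by (simp add: good_def)
    have "\<exists>m. \<forall>x\<in>X. \<forall>y\<in>X. agree m x y \<longrightarrow> a x = a y" using v dha by (simp add: good_def)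
    then obtain m where m: "\<And>x y. x \<in> X \<Longrightarrow> y \<in> X \<Longrightarrow> agree m x y \<Longrightarrow> a x = a y" by blast
    obtain d' h' a' m' where v': "tower_labelling X shift d' h' a'" "d' \<le> r\<^sup>2"
      "\<forall>x\<in>X. \<forall>y\<in>X. agree m' x y \<longrightarrow> a' x = a' y"
      "\<forall>x\<in>X. snd (a' x) = 0 \<longrightarrow> snd (a x) = 0"
      "\<forall>x\<in>X. \<forall>y\<in>X. a' x = a' y \<longrightarrow> a x = a y \<and> agree n x y"
      "\<forall>x\<in>X. \<forall>y\<in>X. snd (a' x) = 0 \<and> snd (a' y) = 0 \<longrightarrow> agree n x y"
      using refine_labelling[OF X min lw lab, of m n] m by blast
    have "\<exists>m. \<forall>x\<in>X. \<forall>y\<in>X. agree m x y \<longrightarrow> a' x = a' y" using v'(3) by (rule exI)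
    then have "good (Suc n) (d', h', a')" using v'(1,2) by (simp add: good_def)
    moreover have "finer n v (d', h', a')" unfolding finer_def dha prod.case using v'(4-6) by (intro conjI)
    ultimately show "\<exists>v'. good (Suc n) v' \<and> finer n v v'" by blast
  qed
  then obtain f where f: "\<And>n. good n (f n)" "\<And>n. finer n (f n) (f (Suc n))" by blast
  define d h a where "d n = fst (f n)" and "h n = fst (snd (f n))" and "a n = snd (snd (f n))" for n
  have fn: "f n = (d n, h n, a n)" for n by (simp add: d_def h_def a_def)
  have g: "tower_labelling X shift (d n) (h n) (a n)" "d n \<le> r\<^sup>2"
    "\<exists>m. \<forall>x\<in>X. \<forall>y\<in>X. agree m x y \<longrightarrow> a n x = a n y" for n
    using f(1)[of n, unfolded good_def fn prod.case] by - (elim conjE, assumption)+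
  have "(0::nat) = 0 \<longrightarrow> d 0 = 1 \<and> h 0 0 = 1"
    using f(1)[of 0, unfolded good_def fn prod.case] by (elim conjE)
  then have g0: "d 0 = 1" "h 0 0 = 1" by simp_all
  have fi: "\<forall>x\<in>X. snd (a (Suc n) x) = 0 \<longrightarrow> snd (a n x) = 0"
    "\<forall>x\<in>X. \<forall>y\<in>X. a (Suc n) x = a (Suc n) y \<longrightarrow> a n x = a n y \<and> agree n x y"
    "\<forall>x\<in>X. \<forall>y\<in>X. snd (a (Suc n) x) = 0 \<and> snd (a (Suc n) y) = 0 \<longrightarrow> agree n x y" for n
    using f(2)[of n, unfolded finer_def fn prod.case] by - (elim conjE, assumption)+
  have down: "snd (a k x) = 0" if "k \<le> n" "x \<in> X" "snd (a n x) = 0" for k n x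
    using that(1,3)
  proof (induction n rule: dec_induct)
    case (step n)
    have "snd (a n x) = 0" using bspec[OF fi(1)[of n] that(2)] step.prems by (rule mp)
    then show ?case by (rule step.IH)
  qed
  have one: "\<exists>x\<in>X. \<forall>n. snd (a n x) = 0"
  proof -
    have "\<exists>x\<in>X. snd (a n x) = 0" for n
    proof -
      obtain z where z: "z \<in> X" using X unfolding shift_space_def by blast
      obtain k j where "a n z = (k, j)" by (cases "a n z")
      then have "k < d n" using label_range[OF bij g(1) z] by blast
      then show ?thesis using label_onto[OF bij g(1)] by (metis snd_conv)
    qed
    then obtain x where x: "\<And>n. x n \<in> X" "\<And>n. snd (a n (x n)) = 0" by metis
    have "\<exists>A. finite A \<and> (\<forall>x\<in>X. \<forall>i. x i \<in> A)" using X by (simp add: shift_space_def)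
    then obtain A where A: "finite A" "\<And>x i. x \<in> X \<Longrightarrow> x i \<in> A" by blast
    obtain g' where g': "\<And>m::nat. infinite {n. \<forall>i. \<bar>i\<bar> \<le> int m \<longrightarrow> x n i = g' i}"
      using cluster_point[of x A] A x(1) by blast
    have near: "\<exists>n\<ge>k. agree m g' (x n)" for m k
    proof -
      obtain n where "n \<ge> k" "\<forall>i. \<bar>i\<bar> \<le> int m \<longrightarrow> x n i = g' i"
        using g'[of m] unfolding infinite_nat_iff_unbounded_le by blast
      then show ?thesis by (auto simp: agree_def)
    qed
    have gX: "g' \<in> X" by (rule shift_space_limit[OF X]) (use near[of 0] x(1) in blast)
    moreover have "snd (a k g') = 0" for k
    proof -
      obtain m where m: "\<forall>x\<in>X. \<forall>y\<in>X. agree m x y \<longrightarrow> a k x = a k y" using g(3) by blast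
      obtain n where n: "n \<ge> k" "agree m g' (x n)" using near by blast
      have "a k g' = a k (x n)" using m gX x(1) n(2) by blast
      then show ?thesis using down[OF n(1) x(1) x(2)] by simp
    qed
    ultimately show ?thesis by blast
  qed
  then obtain x0 where x0: "x0 \<in> X" "\<And>n. snd (a n x0) = 0" by blast
  have "labelled_sequence X shift d h a"
    unfolding labelled_sequence_def
  proof (intro conjI allI ballI impI)
    show "tower_labelling X shift (d n) (h n) (a n)" for n by (rule g(1))
    show "snd (a n x) = 0" if "x \<in> X" "snd (a (Suc n) x) = 0" for n x using fi(1)[of n] that by blast
    show "a n x = a n y" if "x \<in> X" "y \<in> X" "a (Suc n) x = a (Suc n) y" for n x y using fi(2)[of n] that by blast
    have sing: "x = x0" if x: "x \<in> X" "\<forall>n. snd (a n x) = 0" for x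
    proof
      fix i
      have "agree (nat \<bar>i\<bar>) x x0" using fi(3)[of "nat \<bar>i\<bar>"] x(1) spec[OF x(2), of "Suc (nat \<bar>i\<bar>)"] x0(1) x0(2)[of "Suc (nat \<bar>i\<bar>)"] by blast
      then show "x i = x0 i" by (simp add: agree_def)
    qed
    have "{x \<in> X. \<forall>n. snd (a n x) = 0} = {x0}"
    proof (intro equalityI subsetI)
      show "x \<in> {x0}" if "x \<in> {x \<in> X. \<forall>n. snd (a n x) = 0}" for x using sing[of x] that by blast
    qed (use x0 in simp)
    then show "\<exists>x. {x \<in> X. \<forall>n. snd (a n x) = 0} = {x}" by blast
    fix U x assume x: "x \<in> U" and U: "openin (top_of_set X) U"
    obtain O' where O: "open O'" "U = X \<inter> O'" using U unfolding openin_open by blast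
    obtain m where m: "\<forall>y. agree m x y \<longrightarrow> y \<in> O'" using open_contains_agree[OF O(1)] x O(2) by blast
    have "y \<in> U" if "y \<in> X" "a (Suc m) y = a (Suc m) x" for y
    proof -
      have "x \<in> X" using x O(2) by blast
      then have "agree m y x" using fi(2)[of m] that by blast
      then have "agree m x y" by (rule agree_sym)
      then show ?thesis using m O(2) that(1) by blast
    qed
    then show "\<exists>n. \<forall>y\<in>X. a n y = a n x \<longrightarrow> y \<in> U" by blast
  qed
  then show ?thesis using g0 g(2) by blast
qed

subsection \<open>Transfer along a homeomorphism\<close>

lemma openin_vimage_homeomorphism:
  assumes "homeomorphism X Y f g" "openin (top_of_set X) U"
  shows "openin (top_of_set Y) {y\<in>Y. g y \<in> U}"
proof -
  have "continuous_on Y g" "g ` Y = X" using assms(1) by (auto simp: homeomorphism_def)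
  then have "openin (top_of_set Y) (Y \<inter> g -` U)"
    using assms(2) by (metis continuous_openin_preimage equalityD1 image_subset_iff_funcset)
  moreover have "Y \<inter> g -` U = {y\<in>Y. g y \<in> U}" by auto
  ultimately show ?thesis by simp
qed

text \<open>Labels are pulled back along \<open>g\<close>. The numbers and heights of the towers do
  not change, so a rank bound carries over to the copy of the system.\<close>

lemma labelled_sequence_transfer:
  fixes X :: "'a::topological_space set" and Y :: "'b::topological_space set"
  assumes hom: "homeomorphism X Y f g" and bij: "bij_betw T X X" and R: "\<And>y. y \<in> Y \<Longrightarrow> R y = f (T (g y))"
    and seq: "labelled_sequence X T d h a"
  shows "labelled_sequence Y R d h (\<lambda>n y. a n (g y))"
proof -
  have gY: "g y \<in> X" if "y \<in> Y" for y using hom that by (auto simp: homeomorphism_def)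
  have fX: "f x \<in> Y" if "x \<in> X" for x using hom that by (auto simp: homeomorphism_def)
  have gf: "g (f x) = x" if "x \<in> X" for x using hom that by (auto simp: homeomorphism_def)
  have fg: "f (g y) = y" if "y \<in> Y" for y using hom that by (auto simp: homeomorphism_def)
  have TX: "T x \<in> X" if "x \<in> X" for x using bij that by (auto simp: bij_betw_def)
  have gR: "g (R y) = T (g y)" if "y \<in> Y" for y using R[OF that] gf[OF TX[OF gY[OF that]]] by simp
  note L = labelled_sequenceD[OF seq]
  note lab = L(1)
  show ?thesis
    unfolding labelled_sequence_def
  proof (intro conjI allI ballI impI)
    fix n
    show "tower_labelling Y R (d n) (h n) (\<lambda>y. a n (g y))"
      unfolding tower_labelling_def
    proof (intro conjI allI ballI impI)
      fix y assume y: "y \<in> Y"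
      obtain k j where kj: "a n (g y) = (k, j)" by (cases "a n (g y)")
      show "fst (a n (g y)) < d n" "snd (a n (g y)) < h n (fst (a n (g y)))"
        using label_range[OF bij lab gY[OF y] kj] kj by auto
    next
      fix k assume "k < d n"
      then obtain x where "x \<in> X" "a n x = (k, 0)" using label_onto[OF bij lab] by blast
      then show "\<exists>y\<in>Y. a n (g y) = (k, 0)" using fX gf by (intro bexI[of _ "f x"]) auto
    next
      fix y k j assume y: "y \<in> Y" and k: "a n (g y) = (k, Suc j)"
      show "a n (g (R y)) = (k, j)" using label_step[OF bij lab gY[OF y] k] gR[OF y] by simp
    next
      fix y assume y: "y \<in> Y" and k: "snd (a n (g y)) = 0"
      then have "a n (g y) = (fst (a n (g y)), 0)" by (simp add: prod_eq_iff)
      then show "snd (a n (g (R y))) = h n (fst (a n (g (R y)))) - 1"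
        using label_step_base[OF bij lab gY[OF y]] gR[OF y] by metis
    next
      fix v
      have "openin (top_of_set Y) {y\<in>Y. g y \<in> {x\<in>X. a n x = v}}"
        by (rule openin_vimage_homeomorphism[OF hom label_fibre_open[OF bij lab]])
      moreover have "{y\<in>Y. g y \<in> {x\<in>X. a n x = v}} = {y\<in>Y. a n (g y) = v}" using gY by auto
      ultimately show "openin (top_of_set Y) {y\<in>Y. a n (g y) = v}" by simp
    qed
  next
    show "snd (a n (g y)) = 0" if "y \<in> Y" "snd (a (Suc n) (g y)) = 0" for n y
      using L(2)[OF gY[OF that(1)] that(2)] .
    show "a n (g y) = a n (g z)" if "y \<in> Y" "z \<in> Y" "a (Suc n) (g y) = a (Suc n) (g z)" for n y z
      using L(3)[OF gY[OF that(1)] gY[OF that(2)] that(3)] .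
    obtain x where x: "{x\<in>X. \<forall>n. snd (a n x) = 0} = {x}" using L(4) by blast
    have "{y\<in>Y. \<forall>n. snd (a n (g y)) = 0} = {f x}"
    proof (intro equalityI subsetI)
      fix y assume "y \<in> {y\<in>Y. \<forall>n. snd (a n (g y)) = 0}"
      then have y: "y \<in> Y" "g y \<in> {x\<in>X. \<forall>n. snd (a n x) = 0}" using gY by auto
      then have "g y = x" unfolding x by simp
      then show "y \<in> {f x}" using fg[OF y(1)] by auto
    next
      fix y assume "y \<in> {f x}"
      moreover have "x \<in> {x\<in>X. \<forall>n. snd (a n x) = 0}" unfolding x by simp
      ultimately show "y \<in> {y\<in>Y. \<forall>n. snd (a n (g y)) = 0}" using fX gf by auto
    qed
    then show "\<exists>y. {y\<in>Y. \<forall>n. snd (a n (g y)) = 0} = {y}" by blast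
    fix U y assume y: "y \<in> U" and U: "openin (top_of_set Y) U"
    have UY: "U \<subseteq> Y" using U openin_imp_subset by blast
    have yY: "y \<in> Y" using y UY by blast
    have "openin (top_of_set X) {x\<in>X. f x \<in> U}"
      using openin_vimage_homeomorphism[OF homeomorphism_symD[OF hom] U] .
    moreover have "g y \<in> {x\<in>X. f x \<in> U}" using y yY gY fg by simp
    ultimately have "\<exists>n. \<forall>x\<in>X. a n x = a n (g y) \<longrightarrow> x \<in> {x\<in>X. f x \<in> U}"
      by (intro L(5))
    then obtain n where n: "\<forall>x\<in>X. a n x = a n (g y) \<longrightarrow> x \<in> {x\<in>X. f x \<in> U}"
      by (elim exE)
    have "z \<in> U" if "z \<in> Y" "a n (g z) = a n (g y)" for z
    proof -
      have "g z \<in> {x\<in>X. f x \<in> U}" using n gY[OF that(1)] that(2) by blast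
      then show ?thesis using fg[OF that(1)] by simp
    qed
    then show "\<exists>n. \<forall>z\<in>Y. a n (g z) = a n (g y) \<longrightarrow> z \<in> U" by blast
  qed
qed

lemma minimal_systemI_forward:
  fixes X :: "'a::metric_space set"
  assumes tds: "topological_dynamical_system X T"
    and dense: "\<And>x U. x \<in> X \<Longrightarrow> openin (top_of_set X) U \<Longrightarrow> U \<noteq> {} \<Longrightarrow> \<exists>n. (T ^^ n) x \<in> U"
  shows "minimal_system X T"
  unfolding minimal_system_def
proof (intro conjI ballI tds subsetI)
  fix x y assume x: "x \<in> X" and y: "y \<in> X"
  note bij = topological_dynamical_systemD(3)[OF tds]
  show "y \<in> closure (range (\<lambda>n. iterate_int X T n x))"
    unfolding closure_iff_nhds_not_empty
  proof (intro allI impI)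
    fix A V assume "V \<subseteq> A" "open V" "y \<in> V"
    have "openin (top_of_set X) (X \<inter> V)" using \<open>open V\<close> by (rule openin_open_Int)
    then obtain n where "(T ^^ n) x \<in> X \<inter> V" using dense[OF x] y \<open>y \<in> V\<close> by blast
    then have "iterate_int X T (int n) x \<in> A"
      using \<open>V \<subseteq> A\<close> by (auto simp: iterate_int_of_nat[OF bij])
    then show "range (\<lambda>n. iterate_int X T n x) \<inter> A \<noteq> {}" by blast
  qed
qed

lemma minimal_system_transfer:
  fixes X :: "'a::metric_space set" and Y :: "'b::metric_space set"
  assumes hom: "homeomorphism X Y f g" and R: "\<And>y. y \<in> Y \<Longrightarrow> R y = f (T (g y))"
    and min: "minimal_system X T"
  shows "minimal_system Y R"
proof -
  note D = topological_dynamical_systemD[OF minimal_systemD(1)[OF min]]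
  have gY: "g y \<in> X" if "y \<in> Y" for y using hom that by (auto simp: homeomorphism_def)
  have fX: "f x \<in> Y" if "x \<in> X" for x using hom that by (auto simp: homeomorphism_def)
  have gf: "g (f x) = x" if "x \<in> X" for x using hom that by (auto simp: homeomorphism_def)
  have fg: "f (g y) = y" if "y \<in> Y" for y using hom that by (auto simp: homeomorphism_def)
  have bf: "bij_betw f X Y" and bg: "bij_betw g Y X"
    using hom homeomorphism_symD[OF hom] unfolding homeomorphism_def bij_betw_def by (auto intro: inj_on_inverseI)
  have bR: "bij_betw R Y Y"
  proof -
    have "bij_betw (f \<circ> (T \<circ> g)) Y Y"
      using bij_betw_trans[OF bij_betw_trans[OF bg D(3)] bf] .
    then show ?thesis by (rule bij_betw_cong[THEN iffD1, rotated]) (simp add: R)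
  qed
  have tds: "topological_dynamical_system Y R"
  proof (rule topological_dynamical_systemI)
    show "Y \<noteq> {}" using D(1) fX by blast
    have "Y = f ` X" "continuous_on X f" using hom by (auto simp: homeomorphism_def)
    then show "compact Y" using D(2) compact_continuous_image by blast
    show "bij_betw R Y Y" by (rule bR)
    have cg: "continuous_on Y g" using hom by (simp add: homeomorphism_def)
    have "continuous_on Y (\<lambda>y. f (T (g y)))"
    proof (rule continuous_on_compose2[OF \<open>continuous_on X f\<close>])
      show "continuous_on Y (\<lambda>y. T (g y))"
        by (rule continuous_on_compose2[OF D(4) cg]) (use gY in auto)
      show "(\<lambda>y. T (g y)) ` Y \<subseteq> X" using gY D(3) by (auto simp: bij_betw_def)
    qed
    then show "continuous_on Y R" by (rule continuous_on_eq) (simp add: R)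
  qed
  show ?thesis
  proof (rule minimal_systemI_forward[OF tds])
    fix y U assume y: "y \<in> Y" and U: "openin (top_of_set Y) U" "U \<noteq> {}"
    have o: "openin (top_of_set X) {x\<in>X. f x \<in> U}"
      using openin_vimage_homeomorphism[OF homeomorphism_symD[OF hom] U(1)] .
    obtain u where "u \<in> U" using U(2) by blast
    moreover have "u \<in> Y" using \<open>u \<in> U\<close> U(1) openin_imp_subset by blast
    ultimately have ne: "{x\<in>X. f x \<in> U} \<noteq> {}" using gY fg by force
    obtain L where "\<forall>x\<in>X. \<exists>i<L. (T ^^ i) x \<in> {x\<in>X. f x \<in> U}"
      using forward_recurrence[OF min o ne] by (elim exE)
    then obtain i where i: "f ((T ^^ i) (g y)) \<in> U" using gY[OF y] by blast
    have "(R ^^ i) y = f ((T ^^ i) (g y))"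
    proof (induction i)
      case 0 then show ?case using fg[OF y] by simp
    next
      case (Suc i)
      have m: "(T ^^ i) (g y) \<in> X" using funpow_mem[OF D(3) gY[OF y]] .
      show ?case using Suc R[OF fX[OF m]] gf[OF m] by simp
    qed
    then show "\<exists>n. (R ^^ n) y \<in> U" using i by metis
  qed
qed

text \<open>Perfectness comes from minimality and infinity. A coordinate maps a connected set onto a
  connected set of natural numbers, that is, to a single one, which gives total
  disconnectedness.\<close>

lemma zero_dimensional_cantor_set:
  fixes X :: "('i::countable \<Rightarrow> nat) set"
  assumes min: "minimal_system X T" and inf: "infinite X"
  shows "cantor_set X"
  unfolding cantor_set_def
proof (intro conjI ballI)
  note D = topological_dynamical_systemD[OF minimal_systemD(1)[OF min]]
  show "X \<noteq> {}" "compact X" using D by auto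
  show "metrizable_space (top_of_set X)"
    by (simp add: metrizable_space_euclidean metrizable_space_subtopology)
  show "x islimpt X" if "x \<in> X" for x by (rule infinite_minimal_islimpt[OF min inf that])
  fix x assume x: "x \<in> X"
  have "y = x" if y: "y \<in> connected_component_set X x" for y
  proof
    fix i
    obtain S where S: "connected S" "x \<in> S" "y \<in> S"
      using y unfolding connected_component_def by auto
    have "connected ((\<lambda>z. z i) ` S)"
      by (rule connected_continuous_image[OF _ S(1)])
        (rule continuous_on_subset[OF continuous_on_product_coordinates], simp)
    from connectedD[OF this open_discrete open_discrete, of "{x i}" "- {x i}"]
    show "y i = x i" using S(2,3) by auto
  qed
  then show "connected_component_set X x = {x}" using x by (auto simp: connected_component_refl)
qed

section \<open>Morphisms and S-adic subshifts\<close>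

lemma morphism_comp_self [simp]: "morphism_comp \<tau> n n = id"
  by (simp add: morphism_comp_def)

lemma morphism_comp_step: "n < N \<Longrightarrow> morphism_comp \<tau> n N w = morphism_ext (\<tau> n) (morphism_comp \<tau> (Suc n) N w)"
  by (simp add: morphism_comp_def upt_conv_Cons)

lemma morphism_ext_append [simp]: "morphism_ext f (u @ v) = morphism_ext f u @ morphism_ext f v"
  by (simp add: morphism_ext_def)

lemma morphism_ext_simps [simp]: "morphism_ext f [] = []" "morphism_ext f (a # w) = f a @ morphism_ext f w"
  by (simp_all add: morphism_ext_def)

lemma morphism_comp_compose:
  assumes "n \<le> k" "k \<le> N"
  shows "morphism_comp \<tau> n N w = morphism_comp \<tau> n k (morphism_comp \<tau> k N w)"
  using assms
proof (induction "k - n" arbitrary: n)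
  case (Suc d)
  then have "n < k" by simp
  then show ?case using Suc.hyps(1)[of "Suc n"] Suc.hyps(2) Suc.prems by (simp add: morphism_comp_step)
qed simp

lemma morphism_comp_Suc: "n \<le> N \<Longrightarrow> morphism_comp \<tau> n (Suc N) w = morphism_comp \<tau> n N (morphism_ext (\<tau> N) w)"
  using morphism_comp_compose[of n N "Suc N" \<tau> w] by (simp add: morphism_comp_step)

lemma morphism_comp_append [simp]:
  "n \<le> N \<Longrightarrow> morphism_comp \<tau> n N (u @ v) = morphism_comp \<tau> n N u @ morphism_comp \<tau> n N v"
proof (induction "N - n" arbitrary: n)
  case (Suc d)
  then have "n < N" by simp
  then show ?case using Suc.hyps(1)[of "Suc n"] Suc.hyps(2) by (simp add: morphism_comp_step)
qed simp

lemma morphism_comp_Nil [simp]: "n \<le> N \<Longrightarrow> morphism_comp \<tau> n N [] = []"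
  using morphism_comp_append[of n N \<tau> "[]" "[]"] by simp

lemma morphism_comp_concat:
  "n \<le> N \<Longrightarrow> morphism_comp \<tau> n N w = concat (map (\<lambda>a. morphism_comp \<tau> n N [a]) w)"
proof (induction w)
  case (Cons a w)
  then show ?case using morphism_comp_append[of n N \<tau> "[a]" w] by simp
qed simp

section \<open>Languages and points of the levels of a directive sequence\<close>

lemma segment_eq_map: "segment x i (i + int m) = map (\<lambda>j. x (i + int j)) [0..<m]"
  by (simp add: segment_def)

lemma subshift_level_segment:
  "x \<in> subshift_level A \<tau> n \<longleftrightarrow> (\<forall>i. x i \<in> A n) \<and> (\<forall>i j. i \<le> j \<longrightarrow> segment x i j \<in> language_level A \<tau> n)"
proof -
  have "(\<forall>i m. segment x i (i + int m) \<in> language_level A \<tau> n) \<longleftrightarrow> (\<forall>i j. i \<le> j \<longrightarrow> segment x i j \<in> language_level A \<tau> n)"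
  proof (intro iffI allI impI)
    fix i j :: int assume *: "\<forall>i m. segment x i (i + int m) \<in> language_level A \<tau> n" and "i \<le> j"
    then have "j = i + int (nat (j - i))" by simp
    then show "segment x i j \<in> language_level A \<tau> n" using * by metis
  qed auto
  then show ?thesis by (simp add: subshift_level_def segment_eq_map)
qed

context
  fixes A :: "nat \<Rightarrow> nat set" and \<tau> :: "nat \<Rightarrow> nat \<Rightarrow> nat list"
  assumes dir: "directive_sequence A \<tau>"
begin

lemma alphabet: "finite (A n)" "A n \<noteq> {}"
  using dir by (auto simp: directive_sequence_def)

lemma morphism_letter: "a \<in> A (Suc n) \<Longrightarrow> \<tau> n a \<noteq> []" "a \<in> A (Suc n) \<Longrightarrow> set (\<tau> n a) \<subseteq> A n"
  using dir by (auto simp: directive_sequence_def)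

lemma morphism_comp_letters:
  "n \<le> N \<Longrightarrow> set w \<subseteq> A N \<Longrightarrow> set (morphism_comp \<tau> n N w) \<subseteq> A n"
proof (induction "N - n" arbitrary: n)
  case (Suc d)
  then have "n < N" by simp
  moreover have "set (morphism_comp \<tau> (Suc n) N w) \<subseteq> A (Suc n)" using Suc.hyps(1)[of "Suc n"] Suc.hyps(2) Suc.prems by simp
  ultimately show ?case using morphism_letter(2)[of _ n] by (auto simp: morphism_comp_step morphism_ext_def)
qed simp

lemma length_morphism_comp:
  assumes "n \<le> N" "set w \<subseteq> A N"
  shows "length w \<le> length (morphism_comp \<tau> n N w)"
  using assms
proof (induction "N - n" arbitrary: n)
  case (Suc d)
  have ext: "set v \<subseteq> A (Suc n) \<Longrightarrow> length v \<le> length (morphism_ext (\<tau> n) v)" for v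
  proof (induction v)
    case (Cons a v)
    then have "\<tau> n a \<noteq> []" using morphism_letter(1)[of a n] by simp
    then show ?case using Cons by (cases "\<tau> n a") auto
  qed simp
  have lt: "n < N" using Suc by simp
  then have "length w \<le> length (morphism_comp \<tau> (Suc n) N w)" using Suc.hyps(1)[of "Suc n"] Suc.hyps(2) Suc.prems by simp
  also have "\<dots> \<le> length (morphism_comp \<tau> n N w)"
    using ext[OF morphism_comp_letters[of "Suc n" N w]] lt Suc.prems by (simp add: morphism_comp_step)
  finally show ?case .
qed simp

lemma morphism_comp_ne: "n \<le> N \<Longrightarrow> a \<in> A N \<Longrightarrow> morphism_comp \<tau> n N [a] \<noteq> []"
  using length_morphism_comp[of n N "[a]"] by auto

lemma morphism_comp_bounded: "\<exists>L. \<forall>N'\<le>N. \<forall>a\<in>A N'. length (morphism_comp \<tau> n N' [a]) \<le> L"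
proof -
  have "finite (\<Union>N'\<le>N. (\<lambda>a. length (morphism_comp \<tau> n N' [a])) ` A N')" using alphabet(1) by simp
  then obtain L where "\<forall>l\<in>(\<Union>N'\<le>N. (\<lambda>a. length (morphism_comp \<tau> n N' [a])) ` A N'). l \<le> L"
    using finite_nat_set_iff_bounded_le by blast
  then show ?thesis by (intro exI[of _ L]) auto
qed

text \<open>Images of letters from levels up to \<open>N\<close> have bounded length, so a window
  enlarged beyond this bound must occur in the image of a letter from a higher level; such an image
  is a concatenation of images of letters of level \<open>N\<close>.\<close>

lemma subshift_level_covers:
  assumes x: "x \<in> subshift_level A \<tau> n" and N: "n \<le> N"
  shows "covers ((\<lambda>a. morphism_comp \<tau> n N [a]) ` A N) x"
  unfolding covers_def
proof (intro allI)
  fix a b :: int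
  obtain L where L: "\<And>N' a. N' \<le> N \<Longrightarrow> a \<in> A N' \<Longrightarrow> length (morphism_comp \<tau> n N' [a]) \<le> L"
    using morphism_comp_bounded[of N n] by blast
  define b' where "b' = max b a + int L + 1"
  have "segment x a b' \<in> language_level A \<tau> n" using x by (simp add: subshift_level_segment b'_def)
  then obtain N' c where N': "N' > n" "c \<in> A N'" "sublist (segment x a b') (morphism_comp \<tau> n N' [c])"
    unfolding language_level_def by blast
  have "L < length (segment x a b')" by (simp add: b'_def)
  then have "L < length (morphism_comp \<tau> n N' [c])" using sublist_length_le[OF N'(3)] by linarith
  then have NN: "N \<le> N'" using L[of N' c] N'(2) by (meson leD nat_le_linear)
  have c: "set (morphism_comp \<tau> N N' [c]) \<subseteq> A N" using morphism_comp_letters[OF NN, of "[c]"] N'(2) by simp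
  have "morphism_comp \<tau> n N' [c] = concat (map (\<lambda>a. morphism_comp \<tau> n N [a]) (morphism_comp \<tau> N N' [c]))"
    using morphism_comp_compose[OF N NN, of \<tau> "[c]"] morphism_comp_concat[OF N, of \<tau> "morphism_comp \<tau> N N' [c]"] by simp
  moreover have "map (\<lambda>a. morphism_comp \<tau> n N [a]) (morphism_comp \<tau> N N' [c]) \<in> lists ((\<lambda>a. morphism_comp \<tau> n N [a]) ` A N)"
    using c by (fastforce simp: in_lists_conv_set)
  moreover have "sublist (segment x a b) (segment x a b')"
  proof (cases "a \<le> b")
    case True then show ?thesis by (intro sublist_segment) (auto simp: b'_def)
  next
    case False then have "segment x a b = []" by (simp add: segment_eq_Nil_iff)
    then show ?thesis by simp
  qed
  ultimately show "\<exists>ws\<in>lists ((\<lambda>a. morphism_comp \<tau> n N [a]) ` A N). sublist (segment x a b) (concat ws)"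
    using N'(3) sublist_order.order.trans by metis
qed

lemma subshift_level_shift_space:
  assumes "subshift_level A \<tau> n \<noteq> {}"
  shows "shift_space (subshift_level A \<tau> n)"
  unfolding shift_space_def
proof (intro conjI ballI allI impI)
  show "subshift_level A \<tau> n \<noteq> {}" by (rule assms)
  show "\<exists>F. finite F \<and> (\<forall>x\<in>subshift_level A \<tau> n. \<forall>i. x i \<in> F)"
    using alphabet(1)[of n] by (intro exI[of _ "A n"]) (simp add: subshift_level_def)
  show "translate i x \<in> subshift_level A \<tau> n" if "x \<in> subshift_level A \<tau> n" for x i
    using that unfolding subshift_level_segment translate_def segment_translate by simp
  fix x assume lim: "\<forall>m. \<exists>y\<in>subshift_level A \<tau> n. agree m x y"
  show "x \<in> subshift_level A \<tau> n"
    unfolding subshift_level_segment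
  proof (intro conjI allI impI)
    fix i
    obtain y where "y \<in> subshift_level A \<tau> n" "agree (nat \<bar>i\<bar>) x y" using lim by blast
    then show "x i \<in> A n" by (simp add: agree_def subshift_level_def)
  next
    fix i j :: int assume "i \<le> j"
    obtain y where y: "y \<in> subshift_level A \<tau> n" "agree (nat \<bar>i\<bar> + nat \<bar>j\<bar>) x y" using lim by blast
    have "segment x i j = segment y i j"
      by (rule segment_cong) (use y(2) in \<open>auto simp: agree_def\<close>)
    then show "segment x i j \<in> language_level A \<tau> n" using y(1) \<open>i \<le> j\<close> by (simp add: subshift_level_segment)
  qed
qed

text \<open>One long image for each length is enough. With coordinate 0 placed \<open>m\<close>
  letters after its start and at least \<open>m\<close> letters before its end, a cluster point has
  all its segments in the language. The default letter \<open>c\<close> outside the window keeps the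
  values in the finite alphabet.\<close>

lemma subshift_level_nonempty:
  assumes long: "\<And>l. \<exists>N>n. \<exists>a\<in>A N. length (morphism_comp \<tau> n N [a]) \<ge> l"
  shows "subshift_level A \<tau> n \<noteq> {}"
proof -
  have "\<exists>N a. N > n \<and> a \<in> A N \<and> length (morphism_comp \<tau> n N [a]) \<ge> 2 * m + 1" for m
    using long[of "2 * m + 1"] by blast
  then obtain N a where Na: "\<And>m. N m > n" "\<And>m. a m \<in> A (N m)"
    "\<And>m. length (morphism_comp \<tau> n (N m) [a m]) \<ge> 2 * m + 1" by metis
  define w where "w m = morphism_comp \<tau> n (N m) [a m]" for m
  obtain c where c: "c \<in> A n" using alphabet(2)[of n] by blast
  define f where "f m i = (if \<bar>i\<bar> \<le> int m then w m ! nat (i + int m) else c)" for m i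
  have "f m i \<in> A n" for m i
  proof (cases "\<bar>i\<bar> \<le> int m")
    case True
    then have "nat (i + int m) < length (w m)" using Na(3)[of m] unfolding w_def by linarith
    moreover have "set (w m) \<subseteq> A n" unfolding w_def using Na(1,2)[of m] by (intro morphism_comp_letters) auto
    ultimately show ?thesis using True nth_mem by (auto simp: f_def)
  qed (simp add: f_def c)
  then obtain g where g: "\<And>i. g i \<in> A n" "\<And>m::nat. infinite {k. \<forall>i. \<bar>i\<bar> \<le> int m \<longrightarrow> f k i = g i}"
    using cluster_point[of f "A n"] alphabet(1) by blast
  have "segment g i j \<in> language_level A \<tau> n" if "i \<le> j" for i j
  proof -
    define m where "m = nat \<bar>i\<bar> + nat \<bar>j\<bar>"
    obtain k where k: "k \<ge> m" "\<forall>i. \<bar>i\<bar> \<le> int m \<longrightarrow> f k i = g i"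
      using g(2)[of m] unfolding infinite_nat_iff_unbounded_le by blast
    have "segment g i j = segment (\<lambda>t. w k ! nat (t + int k)) i j"
    proof (rule segment_cong)
      fix t assume "i \<le> t" "t < j"
      then have "\<bar>t\<bar> \<le> int m" "\<bar>t\<bar> \<le> int k" using k(1) unfolding m_def by linarith+
      then have "g t = f k t" using k(2) by metis
      then show "g t = w k ! nat (t + int k)" using \<open>\<bar>t\<bar> \<le> int k\<close> by (simp add: f_def)
    qed
    also have "\<dots> = take (nat (j - i)) (drop (nat (i + int k)) (w k))"
    proof (rule nth_equalityI)
      have lo: "0 \<le> i + int k" "j + int k \<le> 2 * int k" using k(1) unfolding m_def by linarith+
      have len: "length (w k) \<ge> 2 * k + 1" using Na(3)[of k] by (simp add: w_def)
      show "length (segment (\<lambda>t. w k ! nat (t + int k)) i j) = length (take (nat (j - i)) (drop (nat (i + int k)) (w k)))"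
        using lo len that by simp
      fix t assume "t < length (segment (\<lambda>t. w k ! nat (t + int k)) i j)"
      then have t: "t < nat (j - i)" by simp
      have "nat (i + int t + int k) = nat (i + int k) + t" using lo by linarith
      then show "segment (\<lambda>t. w k ! nat (t + int k)) i j ! t = take (nat (j - i)) (drop (nat (i + int k)) (w k)) ! t"
        using t lo len by (simp add: add.commute add.left_commute)
    qed
    also have "sublist \<dots> (w k)"
      using sublist_order.order.trans[OF sublist_take sublist_drop] .
    finally have "sublist (segment g i j) (w k)" .
    then show ?thesis unfolding language_level_def w_def using Na(1,2)[of k] by blast
  qed
  then have "g \<in> subshift_level A \<tau> n" using g(1) by (simp add: subshift_level_segment)
  then show ?thesis by blast
qed

text \<open>A point of the subshift has segments of length \<open>l\<close>, so some letter has an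
  image at least that long. By primitivity this letter occurs in the image of every letter of a
  later level, and images from still higher levels contain those.\<close>

lemma primitive_imp_growing:
  assumes prim: "primitive_sequence A \<tau>" and ne: "sadic_subshift A \<tau> \<noteq> {}"
  shows "\<exists>N0. \<forall>N\<ge>N0. \<forall>a\<in>A N. l \<le> length (morphism_comp \<tau> 0 N [a])"
proof -
  obtain x where "x \<in> subshift_level A \<tau> 0" using ne unfolding sadic_subshift_def by blast
  then have "segment x 0 (int l) \<in> language_level A \<tau> 0" by (simp add: subshift_level_segment)
  then obtain N a where N: "N > 0" "a \<in> A N" "sublist (segment x 0 (int l)) (morphism_comp \<tau> 0 N [a])"
    unfolding language_level_def by blast
  have la: "l \<le> length (morphism_comp \<tau> 0 N [a])" using sublist_length_le[OF N(3)] by simp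
  obtain N' where N': "N' > N" "\<And>b. b \<in> A N' \<Longrightarrow> A N \<subseteq> set (morphism_comp \<tau> N N' [b])"
    using prim unfolding primitive_sequence_def by blast
  have base: "l \<le> length (morphism_comp \<tau> 0 N' [b])" if b: "b \<in> A N'" for b
  proof -
    obtain u v where uv: "morphism_comp \<tau> N N' [b] = u @ a # v"
      using N'(2)[OF b] N(2) by (meson split_list subsetD)
    have "morphism_comp \<tau> 0 N' [b] = morphism_comp \<tau> 0 N (u @ [a] @ v)"
      using morphism_comp_compose[of 0 N N' \<tau> "[b]"] N'(1) uv by simp
    then show ?thesis using la by (simp del: append_Cons)
  qed
  have "l \<le> length (morphism_comp \<tau> 0 M [b])" if M: "N' \<le> M" "b \<in> A M" for M b
  proof -
    obtain c where c: "c \<in> set (morphism_comp \<tau> N' M [b])"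
      using morphism_comp_ne[OF M] by (metis last_in_set)
    then have cA: "c \<in> A N'" using morphism_comp_letters[OF M(1), of "[b]"] M(2) by auto
    obtain u v where uv: "morphism_comp \<tau> N' M [b] = u @ c # v" using c by (meson split_list)
    have "morphism_comp \<tau> 0 M [b] = morphism_comp \<tau> 0 N' (u @ [c] @ v)"
      using morphism_comp_compose[of 0 N' M \<tau> "[b]"] M(1) uv by simp
    then show ?thesis using base[OF cA] by (simp del: append_Cons)
  qed
  then show ?thesis by blast
qed

lemma everywhere_growing_iff:
  "everywhere_growing A \<tau> \<longleftrightarrow> (\<forall>l. \<exists>N0. \<forall>N\<ge>N0. \<forall>a\<in>A N. l \<le> length (morphism_comp \<tau> 0 N [a]))"
  unfolding everywhere_growing_def filterlim_at_top eventually_sequentially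
  using alphabet by (simp add: Min_ge_iff)

text \<open>A window of \<open>y\<close> occurs in the image of some letter, hence by primitivity in
  the image of every letter of a level \<open>N'\<close>. As \<open>x\<close> factors into these
  images, it contains the window.\<close>

lemma primitive_minimal:
  assumes prim: "primitive_sequence A \<tau>" and ne: "sadic_subshift A \<tau> \<noteq> {}"
  shows "minimal_system (sadic_subshift A \<tau>) shift"
proof (rule minimal_systemI_forward)
  have X: "shift_space (sadic_subshift A \<tau>)"
    using subshift_level_shift_space[of 0] ne by (simp add: sadic_subshift_def)
  show "topological_dynamical_system (sadic_subshift A \<tau>) shift" by (rule shift_space_system[OF X])
  fix x U assume x: "x \<in> sadic_subshift A \<tau>" and U: "openin (top_of_set (sadic_subshift A \<tau>)) U" "U \<noteq> {}"
  obtain O' where O: "open O'" "U = sadic_subshift A \<tau> \<inter> O'" using U(1) unfolding openin_open by blast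
  obtain y where y: "y \<in> sadic_subshift A \<tau>" "y \<in> O'" using U(2) O(2) by blast
  obtain m where m: "\<forall>z. agree m y z \<longrightarrow> z \<in> O'" using open_contains_agree[OF O(1) y(2)] by blast
  have "segment y (- int m) (int m + 1) \<in> language_level A \<tau> 0"
    using y(1) unfolding sadic_subshift_def subshift_level_segment by simp
  then obtain N a where N: "N > 0" "a \<in> A N" "sublist (segment y (- int m) (int m + 1)) (morphism_comp \<tau> 0 N [a])"
    unfolding language_level_def by blast
  obtain N' where N': "N' > N" "\<And>b. b \<in> A N' \<Longrightarrow> A N \<subseteq> set (morphism_comp \<tau> N N' [b])"
    using prim unfolding primitive_sequence_def by blast
  define W where "W = (\<lambda>a. morphism_comp \<tau> 0 N' [a]) ` A N'"
  have "covers W x" unfolding W_def by (rule subshift_level_covers) (use x in \<open>simp_all add: sadic_subshift_def\<close>)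
  moreover have "[] \<notin> W"
  proof
    assume "[] \<in> W"
    then obtain b where "b \<in> A N'" "morphism_comp \<tau> 0 N' [b] = []" unfolding W_def by force
    then show False using morphism_comp_ne[of 0 N' b] by simp
  qed
  moreover have "finite W" using alphabet(1) by (simp add: W_def)
  ultimately obtain D where D: "factors W x D" using covers_imp_factors by blast
  \<comment> \<open>The block is taken to the right of 0, so that the visit happens in forward
    time.\<close>
  obtain d0 where "d0 \<in> D" "0 < d0" using D unfolding factors_def by blast
  then obtain d e where de: "d \<in> D" "0 < d" "d < e" "segment x d e \<in> W" using factors_next[OF D] by metis
  then obtain b where b: "b \<in> A N'" "segment x d e = morphism_comp \<tau> 0 N' [b]" unfolding W_def by blast
  obtain u v where uv: "morphism_comp \<tau> N N' [b] = u @ a # v"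
    using N'(2)[OF b(1)] N(2) by (meson split_list subsetD)
  have "morphism_comp \<tau> 0 N' [b] = morphism_comp \<tau> 0 N (u @ [a] @ v)"
    using morphism_comp_compose[of 0 N N' \<tau> "[b]"] N'(1) uv by simp
  then have "sublist (morphism_comp \<tau> 0 N [a]) (segment x d e)" using b(2) by (simp del: append_Cons)
  then have "sublist (segment y (- int m) (int m + 1)) (segment x d e)"
    using N(3) sublist_order.order.trans by blast
  then obtain p q where pq: "segment x d e = p @ segment y (- int m) (int m + 1) @ q" unfolding sublist_def by blast
  define k where "k = nat d + length p + m"
  have "translate (int k) x i = y i" if i: "\<bar>i\<bar> \<le> int m" for i
  proof -
    have l: "length (p @ segment y (- int m) (int m + 1) @ q) = nat (e - d)" using arg_cong[OF pq, of length] by simp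
    have n: "length p + nat (i + int m) < nat (e - d)" using l i by simp
    have "segment x d e ! (length p + nat (i + int m)) = segment y (- int m) (int m + 1) ! nat (i + int m)"
    proof -
      have "nat (i + int m) < length (segment y (- int m) (int m + 1))" using i by (simp del: nth_segment)
      then show ?thesis unfolding pq by (simp add: nth_append del: length_segment nth_segment)
    qed
    then have "x (d + int (length p + nat (i + int m))) = y (- int m + int (nat (i + int m)))"
      using n i by simp
    moreover have "d + int (length p + nat (i + int m)) = i + int k" using i de(2) by (simp add: k_def)
    moreover have "- int m + int (nat (i + int m)) = i" using i by linarith
    ultimately have "x (i + int k) = y i" by metis
    then show ?thesis by (simp add: translate_def)
  qed
  then have "agree m y (translate (int k) x)" by (simp add: agree_def)
  then have "(shift ^^ k) x \<in> O'" using m by (simp add: funpow_shift)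
  then show "\<exists>n. (shift ^^ n) x \<in> U" using O(2) shift_space_translate[OF X x] by (auto simp: funpow_shift)
qed

text \<open>A lower limit at most \<open>r\<close> means at most \<open>r\<close> letters at
  infinitely many levels, and beyond some level all images are as long as required.\<close>

lemma growing_long_words:
  assumes grow: "everywhere_growing A \<tau>" and r: "alphabet_rank A \<le> enat r"
  shows "long_words r (sadic_subshift A \<tau>)"
  unfolding long_words_def
proof
  fix l
  obtain N0 where N0: "\<And>N a. N \<ge> N0 \<Longrightarrow> a \<in> A N \<Longrightarrow> l \<le> length (morphism_comp \<tau> 0 N [a])"
    using grow unfolding everywhere_growing_iff by blast
  have "\<exists>N\<ge>N0. card (A N) \<le> r"
  proof (rule ccontr)
    assume "\<not> ?thesis"
    then have "enat (Suc r) \<le> enat (card (A N))" if "N \<ge> N0" for N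
      using that by (metis Suc_leI enat_ord_simps(1) not_le)
    then have "\<forall>\<^sub>F N in sequentially. enat (Suc r) \<le> enat (card (A N))" unfolding eventually_sequentially by blast
    then have "enat (Suc r) \<le> alphabet_rank A" unfolding alphabet_rank_def by (rule Liminf_bounded)
    then have "enat (Suc r) \<le> enat r" using r by (rule order_trans)
    then show False by simp
  qed
  then obtain N where N: "N \<ge> N0" "card (A N) \<le> r" by blast
  let ?W = "(\<lambda>a. morphism_comp \<tau> 0 N [a]) ` A N"
  have "finite ?W" "card ?W \<le> r"
    using alphabet(1) order_trans[OF card_image_le[OF alphabet(1)] N(2)] by auto
  moreover have "\<forall>w\<in>?W. l \<le> length w" using N0[OF N(1)] by auto
  moreover have "\<forall>x\<in>sadic_subshift A \<tau>. covers ?W x"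
    using subshift_level_covers[of _ 0 N] by (simp add: sadic_subshift_def)
  ultimately show "\<exists>W. finite W \<and> card W \<le> r \<and> (\<forall>w\<in>W. l \<le> length w) \<and> (\<forall>x\<in>sadic_subshift A \<tau>. covers W x)"
    by blast
qed

lemma alphabet_rank_pos: "1 \<le> alphabet_rank A"
  unfolding alphabet_rank_def
proof (rule Liminf_bounded)
  have "1 \<le> enat (card (A n))" for n
    using alphabet[of n] by (simp add: one_enat_def card_gt_0_iff Suc_le_eq)
  then show "\<forall>\<^sub>F n in sequentially. 1 \<le> enat (card (A n))" by simp
qed

end

subsection \<open>Morphisms on two-sided sequences\<close>

lemma cut_position_0 [simp]: "cut_position f y 0 = 0"
  by (simp add: cut_position_def)

lemma cut_position_step: "cut_position f y (k + 1) = cut_position f y k + int (length (f (y k)))"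
proof (cases "0 \<le> k")
  case True
  then have "{0..<k + 1} = insert k {0..<k}" "{k + 1..<0} = {}" "{k..<0} = {}" by auto
  then show ?thesis by (simp add: cut_position_def)
next
  case False
  then have "{k..<0} = insert k {k + 1..<0}" "{0..<k} = {}" "{0..<k + 1} = {}" by auto
  then show ?thesis by (simp add: cut_position_def)
qed

context
  fixes f :: "'l \<Rightarrow> 'm list" and y :: "int \<Rightarrow> 'l"
  assumes ne: "\<And>k. f (y k) \<noteq> []"
begin

lemma cut_position_less: "j < k \<Longrightarrow> cut_position f y j < cut_position f y k"
proof (induction k rule: int_gr_induct)
  case base
  then show ?case using ne[of j] by (simp add: cut_position_step)
next
  case (step k)
  then show ?case using ne[of k] by (simp add: cut_position_step)
qed

lemma cut_position_mono: "j \<le> k \<Longrightarrow> cut_position f y j \<le> cut_position f y k"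
  using cut_position_less[of j k] by (cases "j = k") auto

lemma cut_position_ge: "0 \<le> k \<Longrightarrow> k \<le> cut_position f y k"
proof (induction k rule: int_ge_induct)
  case (step k)
  then show ?case using cut_position_less[of k "k + 1"] by simp
qed simp

lemma cut_position_le: "k \<le> 0 \<Longrightarrow> cut_position f y k \<le> k"
proof (induction k rule: int_le_induct)
  case (step k)
  then show ?case using cut_position_less[of "k - 1" k] by simp
qed simp

lemma ex_cut_position: "\<exists>k. cut_position f y k \<le> i \<and> i < cut_position f y (k + 1)"
proof -
  define n where "n = nat \<bar>i\<bar> + 1"
  have lo: "cut_position f y (- int n) \<le> i" using cut_position_le[of "- int n"] unfolding n_def by linarith
  have hi: "i < cut_position f y (int n)" using cut_position_ge[of "int n"] unfolding n_def by linarith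
  have "i < cut_position f y (- int n + int m) \<Longrightarrow> \<exists>k. cut_position f y k \<le> i \<and> i < cut_position f y (k + 1)" for m
  proof (induction m)
    case (Suc m)
    then show ?case
    proof (cases "i < cut_position f y (- int n + int m)")
      case False
      then show ?thesis using Suc.prems by (intro exI[of _ "- int n + int m"]) (simp add: algebra_simps)
    qed blast
  qed (use lo in simp)
  from this[of "2 * n"] show ?thesis using hi by simp
qed

lemma biinfinite_ext_eq:
  assumes "cut_position f y k \<le> i" "i < cut_position f y (k + 1)"
  shows "biinfinite_ext f y i = f (y k) ! nat (i - cut_position f y k)"
proof -
  have "(THE k. cut_position f y k \<le> i \<and> i < cut_position f y (k + 1)) = k"
  proof (rule the_equality)
    show "cut_position f y k \<le> i \<and> i < cut_position f y (k + 1)" using assms by blast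
    fix j assume j: "cut_position f y j \<le> i \<and> i < cut_position f y (j + 1)"
    have "\<not> j < k" using cut_position_mono[of "j + 1" k] j assms by linarith
    moreover have "\<not> k < j" using cut_position_mono[of "k + 1" j] j assms by linarith
    ultimately show "j = k" by simp
  qed
  then show ?thesis by (simp add: biinfinite_ext_def)
qed

lemma segment_biinfinite_ext_step:
  "segment (biinfinite_ext f y) (cut_position f y k) (cut_position f y (k + 1)) = f (y k)"
proof (rule nth_equalityI)
  fix t assume "t < length (segment (biinfinite_ext f y) (cut_position f y k) (cut_position f y (k + 1)))"
  then have t: "t < length (f (y k))" by (simp add: cut_position_step)
  then show "segment (biinfinite_ext f y) (cut_position f y k) (cut_position f y (k + 1)) ! t = f (y k) ! t"
    using biinfinite_ext_eq[of k "cut_position f y k + int t"] by (simp add: cut_position_step)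
qed (simp add: cut_position_step)

lemma segment_biinfinite_ext:
  "j \<le> k \<Longrightarrow> segment (biinfinite_ext f y) (cut_position f y j) (cut_position f y k) = morphism_ext f (segment y j k)"
proof (induction k rule: int_ge_induct)
  case (step k)
  have "segment (biinfinite_ext f y) (cut_position f y j) (cut_position f y (k + 1)) =
      segment (biinfinite_ext f y) (cut_position f y j) (cut_position f y k) @ f (y k)"
    using segment_append[of "cut_position f y j" "cut_position f y k" "cut_position f y (k + 1)" "biinfinite_ext f y"]
      cut_position_mono[of j k] cut_position_mono[of k "k + 1"] step.hyps segment_biinfinite_ext_step[of k] by simp
  moreover have "segment y j (k + 1) = segment y j k @ [y k]"
    using segment_append[of j k "k + 1" y] step.hyps by (simp add: segment_def)
  ultimately show ?case using step.IH by simp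
qed simp

lemma biinfinite_ext_nth: "t < length (f (y 0)) \<Longrightarrow> biinfinite_ext f y (int t) = f (y 0) ! t"
  using biinfinite_ext_eq[of 0 "int t"] cut_position_step[of f y 0] by simp

end

context
  fixes A :: "nat \<Rightarrow> nat set" and \<tau> :: "nat \<Rightarrow> nat \<Rightarrow> nat list"
  assumes dir: "directive_sequence A \<tau>"
begin

lemma subshift_level_morphism_ne: "y \<in> subshift_level A \<tau> (Suc n) \<Longrightarrow> \<tau> n (y k) \<noteq> []"
  using morphism_letter(1)[OF dir] by (simp add: subshift_level_def)

text \<open>A window of the image is covered by the images of finitely many consecutive letters of
  \<open>y\<close>. These letters occur in an image of a single letter, and applying
  \<open>\<tau> n\<close> stays within images of that letter.\<close>

lemma biinfinite_ext_subshift_level: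
  assumes y: "y \<in> subshift_level A \<tau> (Suc n)"
  shows "biinfinite_ext (\<tau> n) y \<in> subshift_level A \<tau> n"
proof -
  note ne = subshift_level_morphism_ne[OF y]
  let ?x = "biinfinite_ext (\<tau> n) y"
  have seg: "segment ?x i j \<in> language_level A \<tau> n" if "i \<le> j" for i j
  proof -
    define m where "m = nat \<bar>i\<bar> + nat \<bar>j\<bar>"
    have lo: "cut_position (\<tau> n) y (- int m) \<le> i"
      using cut_position_le[of "\<tau> n" y "- int m", OF ne] unfolding m_def by linarith
    have hi: "j \<le> cut_position (\<tau> n) y (int m)"
      using cut_position_ge[of "\<tau> n" y "int m", OF ne] unfolding m_def by linarith
    have "segment y (- int m) (int m) \<in> language_level A \<tau> (Suc n)"
      using y by (simp add: subshift_level_segment)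
    then obtain N a where N: "N > Suc n" "a \<in> A N" "sublist (segment y (- int m) (int m)) (morphism_comp \<tau> (Suc n) N [a])"
      unfolding language_level_def by blast
    have "sublist (morphism_ext (\<tau> n) (segment y (- int m) (int m))) (morphism_ext (\<tau> n) (morphism_comp \<tau> (Suc n) N [a]))"
      using N(3) unfolding sublist_def by (elim exE) (simp, blast)
    then have "sublist (morphism_ext (\<tau> n) (segment y (- int m) (int m))) (morphism_comp \<tau> n N [a])"
      using N(1) by (simp add: morphism_comp_step)
    moreover have "sublist (segment ?x i j) (morphism_ext (\<tau> n) (segment y (- int m) (int m)))"
      using segment_biinfinite_ext[of "\<tau> n" y "- int m" "int m", OF ne] sublist_segment[OF lo that hi, of ?x] by simp
    ultimately have "sublist (segment ?x i j) (morphism_comp \<tau> n N [a])"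
      using sublist_order.order.trans by blast
    then show ?thesis unfolding language_level_def using N(1,2) by (auto intro: Suc_lessD)
  qed
  have "?x i \<in> A n" for i
  proof -
    have "segment ?x i (i + 1) \<in> language_level A \<tau> n" by (rule seg) simp
    then obtain N a where N: "N > n" "a \<in> A N" "sublist (segment ?x i (i + 1)) (morphism_comp \<tau> n N [a])"
      unfolding language_level_def by blast
    have "?x i \<in> set (segment ?x i (i + 1))" by (simp add: segment_def)
    then show ?thesis using set_mono_sublist[OF N(3)] morphism_comp_letters[OF dir, of n N "[a]"] N(1,2) by auto
  qed
  then show ?thesis using seg by (simp add: subshift_level_segment)
qed

text \<open>By recognizability, the points $S^k\tau_n(y)$ with $y \in X^{(n+1)}$ and $k < |\tau_n(y_0)|$ are pairwise
  distinct points of $X^{(n)}$. Hence the sum of $|\tau_{[0,n)}(y_0)|$ over $X^{(n)}$ does not increase with $n$.\<close>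

lemma recognizable_finite_level:
  assumes rec: "recognizable_sequence A \<tau>" and fin: "finite (subshift_level A \<tau> 0)"
  shows "finite (subshift_level A \<tau> n) \<and>
    (\<Sum>y\<in>subshift_level A \<tau> n. length (morphism_comp \<tau> 0 n [y 0])) \<le> card (subshift_level A \<tau> 0)"
proof (induction n)
  case 0
  then show ?case using fin by simp
next
  case (Suc n)
  let ?X = "subshift_level A \<tau> n" and ?Y = "subshift_level A \<tau> (Suc n)"
  define S where "S = (SIGMA y:?Y. {..<length (\<tau> n (y 0))})"
  define g where "g = (\<lambda>(y, k). translate (int k) (biinfinite_ext (\<tau> n) y))"
  have gX: "g p \<in> ?X" if pS: "p \<in> S" for p
  proof -
    obtain y k where p: "p = (y, k)" "y \<in> ?Y" using pS by (auto simp: S_def)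
    have b: "biinfinite_ext (\<tau> n) y \<in> ?X" by (rule biinfinite_ext_subshift_level[OF p(2)])
    then have "shift_space ?X" by (intro subshift_level_shift_space[OF dir]) blast
    then show ?thesis using b p(1) by (simp add: g_def shift_space_translate)
  qed
  have inj: "inj_on g S"
  proof (rule inj_onI)
    fix p q assume p: "p \<in> S" and q: "q \<in> S" and eq: "g p = g q"
    obtain y k where pk: "p = (y, k)" by (cases p)
    obtain z l where ql: "q = (z, l)" by (cases q)
    have "\<forall>i. g p i \<in> A n" using gX[OF p] by (simp add: subshift_level_def)
    then have "Uniq (\<lambda>(k::nat, y). y \<in> ?Y \<and> k < length (\<tau> n (y 0)) \<and> g p = (shift ^^ k) (biinfinite_ext (\<tau> n) y))"
      using rec unfolding recognizable_sequence_def recognizable_in_def by blast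
    then have "(k, y) = (l, z)"
    proof (rule Uniq_D)
      show "case (k, y) of (k, y) \<Rightarrow> y \<in> ?Y \<and> k < length (\<tau> n (y 0)) \<and> g p = (shift ^^ k) (biinfinite_ext (\<tau> n) y)"
        using p by (simp add: pk S_def g_def funpow_shift)
      show "case (l, z) of (k, y) \<Rightarrow> y \<in> ?Y \<and> k < length (\<tau> n (y 0)) \<and> g p = (shift ^^ k) (biinfinite_ext (\<tau> n) y)"
        unfolding eq using q by (simp add: ql S_def g_def funpow_shift)
    qed
    then show "p = q" using pk ql by simp
  qed
  have finS: "finite S"
    by (rule inj_on_finite[OF inj _ conjunct1[OF Suc.IH]]) (use gX in blast)
  have "?Y \<subseteq> fst ` S"
  proof
    fix y assume y: "y \<in> ?Y"
    then have "(y, 0) \<in> S" using subshift_level_morphism_ne[OF y, of 0] by (simp add: S_def)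
    then show "y \<in> fst ` S" by force
  qed
  then have finY: "finite ?Y" using finS by (meson finite_imageI finite_subset)
  \<comment> \<open>The letters of \<open>\<tau> n (y 0)\<close> are the letters at coordinate 0 of
    the points \<open>g (y, k)\<close>, so the length of the composed image splits into the summands
    of level \<open>n\<close> at these points.\<close>
  have "(\<Sum>y\<in>?Y. length (morphism_comp \<tau> 0 (Suc n) [y 0])) =
      (\<Sum>y\<in>?Y. \<Sum>k<length (\<tau> n (y 0)). length (morphism_comp \<tau> 0 n [g (y, k) 0]))"
  proof (rule sum.cong[OF refl])
    fix y assume y: "y \<in> ?Y"
    have "length (morphism_comp \<tau> 0 (Suc n) [y 0]) = length (morphism_comp \<tau> 0 n (\<tau> n (y 0)))"
      by (simp add: morphism_comp_Suc)
    also have "\<dots> = (\<Sum>k<length (\<tau> n (y 0)). length (morphism_comp \<tau> 0 n [\<tau> n (y 0) ! k]))"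
      by (subst morphism_comp_concat) (simp_all add: length_concat sum_list_sum_nth atLeast0LessThan)
    also have "\<dots> = (\<Sum>k<length (\<tau> n (y 0)). length (morphism_comp \<tau> 0 n [g (y, k) 0]))"
    proof (rule sum.cong[OF refl])
      fix k assume "k \<in> {..<length (\<tau> n (y 0))}"
      then have "g (y, k) 0 = \<tau> n (y 0) ! k"
        using biinfinite_ext_nth[of "\<tau> n" y k] subshift_level_morphism_ne[OF y] by (simp add: g_def translate_def)
      then show "length (morphism_comp \<tau> 0 n [\<tau> n (y 0) ! k]) = length (morphism_comp \<tau> 0 n [g (y, k) 0])" by simp
    qed
    finally show "length (morphism_comp \<tau> 0 (Suc n) [y 0]) =
      (\<Sum>k<length (\<tau> n (y 0)). length (morphism_comp \<tau> 0 n [g (y, k) 0]))" .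
  qed
  also have "\<dots> = (\<Sum>p\<in>S. length (morphism_comp \<tau> 0 n [g p 0]))"
    unfolding S_def using finY by (subst sum.Sigma) (auto simp: case_prod_beta)
  also have "\<dots> = (\<Sum>z\<in>g ` S. length (morphism_comp \<tau> 0 n [z 0]))"
    by (simp add: sum.reindex[OF inj])
  also have "\<dots> \<le> (\<Sum>z\<in>?X. length (morphism_comp \<tau> 0 n [z 0]))"
    by (rule sum_mono2) (use Suc.IH gX in auto)
  finally show ?case using Suc.IH finY by simp
qed

text \<open>If there were \<open>C\<close> points, a level all of whose images are longer than
  \<open>C\<close> would violate the bound on the sum of lengths as soon as that level has a point;
  the rest is to produce such a point.\<close>

lemma recognizable_imp_infinite:
  assumes rec: "recognizable_sequence A \<tau>" and prim: "primitive_sequence A \<tau>" and ne: "sadic_subshift A \<tau> \<noteq> {}"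
  shows "infinite (sadic_subshift A \<tau>)"
proof
  assume "finite (sadic_subshift A \<tau>)"
  then have fin: "finite (subshift_level A \<tau> 0)" by (simp add: sadic_subshift_def)
  define C where "C = card (subshift_level A \<tau> 0)"
  obtain n where n: "\<forall>N\<ge>n. \<forall>a\<in>A N. Suc C \<le> length (morphism_comp \<tau> 0 N [a])"
    using primitive_imp_growing[OF dir prim ne, of "Suc C"] by (elim exE)
  have "subshift_level A \<tau> n \<noteq> {}"
  proof (rule subshift_level_nonempty[OF dir])
    fix l
    \<comment> \<open>Images from far above are long already at level \<open>n\<close>: passing from
      level \<open>n\<close> down to level 0 multiplies lengths by at most \<open>B\<close>.\<close>
    obtain B where B: "\<forall>N'\<le>n. \<forall>a\<in>A N'. length (morphism_comp \<tau> 0 N' [a]) \<le> B"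
      using morphism_comp_bounded[OF dir, of n 0] by (elim exE)
    obtain N0 where N0: "\<forall>N\<ge>N0. \<forall>a\<in>A N. B * l \<le> length (morphism_comp \<tau> 0 N [a])"
      using primitive_imp_growing[OF dir prim ne, of "B * l"] by (elim exE)
    define N where "N = max N0 (Suc n)"
    obtain a where a: "a \<in> A N" using alphabet(2)[OF dir, of N] by blast
    have "B * l \<le> length (morphism_comp \<tau> 0 N [a])" using N0 a by (simp add: N_def)
    also have "\<dots> = length (morphism_comp \<tau> 0 n (morphism_comp \<tau> n N [a]))"
      using morphism_comp_compose[of 0 n N \<tau> "[a]"] by (simp add: N_def)
    also have "\<dots> \<le> B * length (morphism_comp \<tau> n N [a])"
    proof -
      have "length (morphism_comp \<tau> 0 n w) \<le> B * length w" if "set w \<subseteq> A n" for w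
        using that
      proof (induction w)
        case (Cons b w)
        then show ?case using B morphism_comp_append[of 0 n \<tau> "[b]" w] by (auto simp: add_mono)
      qed simp
      moreover have "set (morphism_comp \<tau> n N [a]) \<subseteq> A n"
        by (rule morphism_comp_letters[OF dir]) (use a in \<open>auto simp: N_def\<close>)
      ultimately show ?thesis by blast
    qed
    finally have "B * l \<le> B * length (morphism_comp \<tau> n N [a])" .
    moreover have "B > 0"
    proof -
      obtain b where "b \<in> A 0" using alphabet(2)[OF dir, of 0] by blast
      then show ?thesis using B by force
    qed
    ultimately have "l \<le> length (morphism_comp \<tau> n N [a])" by simp
    then show "\<exists>N>n. \<exists>a\<in>A N. l \<le> length (morphism_comp \<tau> n N [a])"
      using a by (intro exI[of _ N]) (auto simp: N_def)
  qed
  then obtain y where y: "y \<in> subshift_level A \<tau> n" by blast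
  then have "y 0 \<in> A n" by (simp add: subshift_level_def)
  then have "Suc C \<le> length (morphism_comp \<tau> 0 n [y 0])" using n by simp
  also have "\<dots> \<le> (\<Sum>y\<in>subshift_level A \<tau> n. length (morphism_comp \<tau> 0 n [y 0]))"
    using recognizable_finite_level[OF rec fin, of n] y
    by (intro member_le_sum[where f = "\<lambda>y. length (morphism_comp \<tau> 0 n [y 0])"]) auto
  also have "\<dots> \<le> C" using recognizable_finite_level[OF rec fin, of n] by (simp add: C_def)
  finally show False by simp
qed

end

subsection \<open>Odometers\<close>

text \<open>The inverse limit of the cyclic groups of order \<open>p * 2 ^ n\<close>, written with
  least residues. The group at index 0 has order \<open>p\<close>, so that a cycle of length
  \<open>p\<close> is a factor.\<close>

definition odometer :: "nat \<Rightarrow> (nat \<Rightarrow> nat) set" where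
  "odometer p = {y. \<forall>n. y n < p * 2 ^ n \<and> y (Suc n) mod (p * 2 ^ n) = y n}"

definition odometer_map :: "nat \<Rightarrow> (nat \<Rightarrow> nat) \<Rightarrow> (nat \<Rightarrow> nat)" where
  "odometer_map p y = (\<lambda>n. (y n + 1) mod (p * 2 ^ n))"

context
  fixes p :: nat
  assumes p: "p \<ge> 1"
begin

lemma odometer_modulus_pos: "0 < p * 2 ^ n"
  using p by simp

lemma odometer_add:
  assumes "y \<in> odometer p"
  shows "(\<lambda>n. (y n + k) mod (p * 2 ^ n)) \<in> odometer p"
  unfolding odometer_def
proof (intro CollectI allI conjI)
  fix n
  show "(y n + k) mod (p * 2 ^ n) < p * 2 ^ n" using odometer_modulus_pos by simp
  have "p * 2 ^ n dvd p * 2 ^ Suc n" by simp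
  then have "(y (Suc n) + k) mod (p * 2 ^ Suc n) mod (p * 2 ^ n) = (y (Suc n) + k) mod (p * 2 ^ n)"
    by (rule mod_mod_cancel)
  also have "\<dots> = (y (Suc n) mod (p * 2 ^ n) + k) mod (p * 2 ^ n)" by (simp add: mod_add_left_eq)
  also have "\<dots> = (y n + k) mod (p * 2 ^ n)" using assms by (simp add: odometer_def)
  finally show "(y (Suc n) + k) mod (p * 2 ^ Suc n) mod (p * 2 ^ n) = (y n + k) mod (p * 2 ^ n)" .
qed

lemma odometer_zero: "(\<lambda>n. 0) \<in> odometer p"
  using p by (simp add: odometer_def)

lemma odometer_of_nat: "(\<lambda>n. k mod (p * 2 ^ n)) \<in> odometer p"
  using odometer_add[OF odometer_zero, of k] by simp

lemma odometer_less: "y \<in> odometer p \<Longrightarrow> y n < p * 2 ^ n"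
  by (simp add: odometer_def)

lemma odometer_map_mem: "y \<in> odometer p \<Longrightarrow> odometer_map p y \<in> odometer p"
  using odometer_add[of y 1] by (simp add: odometer_map_def)

lemma funpow_odometer_map: "y \<in> odometer p \<Longrightarrow> (odometer_map p ^^ k) y n = (y n + k) mod (p * 2 ^ n)"
proof (induction k)
  case (Suc k)
  then show ?case by (simp add: odometer_map_def mod_Suc_eq)
qed (simp add: odometer_less)

lemma odometer_eq_below:
  assumes "y \<in> odometer p" "z \<in> odometer p" "y n = z n" "m \<le> n"
  shows "y m = z m"
  using assms(4,3)
proof (induction n rule: dec_induct)
  case (step n)
  then show ?case using assms(1,2) unfolding odometer_def by (metis (mono_tags, lifting) mem_Collect_eq)
qed

lemma odometer_open_contains:
  assumes "openin (top_of_set (odometer p)) U" "y \<in> U"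
  shows "\<exists>n. \<forall>z\<in>odometer p. z n = y n \<longrightarrow> z \<in> U"
proof -
  obtain O' where O: "open O'" "U = odometer p \<inter> O'" using assms(1) unfolding openin_open by blast
  obtain F where F: "finite F" "\<And>z. (\<forall>i\<in>F. z i = y i) \<Longrightarrow> z \<in> O'"
    using open_contains_cylinder[OF O(1), of y] assms(2) O(2) by blast
  obtain n where n: "\<forall>i\<in>F. i \<le> n" using F(1) finite_nat_set_iff_bounded_le by blast
  have "z \<in> U" if z: "z \<in> odometer p" "z n = y n" for z
  proof -
    have y: "y \<in> odometer p" using assms(2) O(2) by blast
    have "z \<in> O'" by (rule F(2)) (use odometer_eq_below[OF z(1) y z(2)] n in blast)
    then show ?thesis using O(2) z(1) by blast
  qed
  then show ?thesis by blast
qed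

lemma odometer_system: "topological_dynamical_system (odometer p) (odometer_map p)"
proof (rule topological_dynamical_systemI)
  show "odometer p \<noteq> {}" using odometer_zero by blast
  show "compact (odometer p)"
  proof -
    have "compact (\<Pi>\<^sub>E n\<in>(UNIV::nat set). {..<p * 2 ^ n})"
      using compactin_PiE[of "\<lambda>_::nat. euclidean :: nat topology" UNIV "\<lambda>n. {..<p * 2 ^ n}"]
      by (simp add: euclidean_product_topology finite_imp_compact)
    moreover have "closed (odometer p)"
    proof -
      have "\<exists>U. open U \<and> y \<in> U \<and> U \<subseteq> - odometer p" if y: "y \<in> - odometer p" for y
      proof -
        obtain n where n: "\<not> (y n < p * 2 ^ n \<and> y (Suc n) mod (p * 2 ^ n) = y n)"
          using y unfolding odometer_def by blast
        have "{z. \<forall>i\<in>{n, Suc n}. z i = y i} \<subseteq> - odometer p"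
        proof
          fix z assume z: "z \<in> {z. \<forall>i\<in>{n, Suc n}. z i = y i}"
          show "z \<in> - odometer p"
          proof
            assume "z \<in> odometer p"
            then have "z n < p * 2 ^ n \<and> z (Suc n) mod (p * 2 ^ n) = z n" by (simp add: odometer_def)
            then show False using z n by simp
          qed
        qed
        then show ?thesis using open_cylinder[of "{n, Suc n}" y] by (intro exI[of _ "{z. \<forall>i\<in>{n, Suc n}. z i = y i}"]) simp
      qed
      then have "open (- odometer p)" by (subst open_subopen) blast
      then show ?thesis by (simp add: closed_def)
    qed
    moreover have "odometer p \<subseteq> (\<Pi>\<^sub>E n\<in>UNIV. {..<p * 2 ^ n})" by (auto simp: PiE_UNIV_domain odometer_def)
    ultimately show ?thesis by (metis compact_Int_closed inf.absorb_iff2 inf_commute)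
  qed
  show "bij_betw (odometer_map p) (odometer p) (odometer p)"
  proof (rule bij_betwI)
    define g where "g y = (\<lambda>n. (y n + (p * 2 ^ n - 1)) mod (p * 2 ^ n))" for y :: "nat \<Rightarrow> nat"
    have fg: "(((a + (q - 1)) mod q) + 1) mod q = a" if "a < q" for a q :: nat
      using that by (simp add: mod_Suc_eq)
    have gf: "(((a + 1) mod q) + (q - 1)) mod q = a" if "a < q" for a q :: nat
      using that by (metis fg add.assoc add.commute mod_add_left_eq)
    show "odometer_map p \<in> odometer p \<rightarrow> odometer p" using odometer_map_mem by blast
    show "g \<in> odometer p \<rightarrow> odometer p"
    proof
      fix y assume y: "y \<in> odometer p"
      show "g y \<in> odometer p"
        unfolding odometer_def
      proof (intro CollectI allI conjI)
        fix n
        let ?q = "p * 2 ^ n"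
        show "g y n < ?q" using odometer_modulus_pos by (simp add: g_def)
        have "?q dvd p * 2 ^ Suc n" by simp
        then have "g y (Suc n) mod ?q = (y (Suc n) + (p * 2 ^ Suc n - 1)) mod ?q" unfolding g_def by (rule mod_mod_cancel)
        also have "y (Suc n) + (p * 2 ^ Suc n - 1) = y (Suc n) + (?q - 1) + ?q"
        proof -
          have "p * 2 ^ Suc n = ?q + ?q" by simp
          then show ?thesis using odometer_modulus_pos[of n] by linarith
        qed
        also have "(y (Suc n) + (?q - 1) + ?q) mod ?q = (y (Suc n) + (?q - 1)) mod ?q" by simp
        also have "\<dots> = (y (Suc n) mod ?q + (?q - 1)) mod ?q" by (simp add: mod_add_left_eq)
        also have "\<dots> = g y n" using y by (simp add: odometer_def g_def)
        finally show "g y (Suc n) mod ?q = g y n" .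
      qed
    qed
    show "g (odometer_map p y) = y" if "y \<in> odometer p" for y
      using gf[OF odometer_less[OF that]] by (intro ext) (simp add: g_def odometer_map_def)
    show "odometer_map p (g y) = y" if "y \<in> odometer p" for y
      using fg[OF odometer_less[OF that]] by (intro ext) (simp add: g_def odometer_map_def)
  qed
  show "continuous_on (odometer p) (odometer_map p)"
    unfolding odometer_map_def
  proof (rule continuous_on_coordinatewise_then_product)
    fix n
    show "continuous_on (odometer p) (\<lambda>y. (y n + 1) mod (p * 2 ^ n))"
      by (rule continuous_on_compose2[of UNIV "\<lambda>a. (a + 1) mod (p * 2 ^ n)" _ "\<lambda>y. y n"])
        (auto intro: continuous_on_subset[OF continuous_on_product_coordinates])
  qed
qed

text \<open>A coordinate determines all earlier ones, so every nonempty open set contains a residue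
  class modulo some \<open>p * 2 ^ n\<close>, and adding a suitable number reaches that
  class.\<close>

lemma odometer_minimal: "minimal_system (odometer p) (odometer_map p)"
proof (rule minimal_systemI_forward[OF odometer_system])
  fix y U assume y: "y \<in> odometer p" and U: "openin (top_of_set (odometer p)) U" "U \<noteq> {}"
  obtain u where u: "u \<in> U" using U(2) by blast
  then obtain n where n: "\<And>z. z \<in> odometer p \<Longrightarrow> z n = u n \<Longrightarrow> z \<in> U"
    using odometer_open_contains[OF U(1)] by blast
  have uY: "u \<in> odometer p" using u U(1) openin_imp_subset by blast
  define k where "k = u n + (p * 2 ^ n - y n)"
  have "y n + k = u n + p * 2 ^ n" using odometer_less[OF y, of n] by (simp add: k_def)
  then have "(odometer_map p ^^ k) y n = u n"
    using funpow_odometer_map[OF y, of k n] odometer_less[OF uY, of n] by simp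
  moreover have "(odometer_map p ^^ k) y \<in> odometer p"
    using funpow_mem[OF topological_dynamical_systemD(3)[OF odometer_system] y] .
  ultimately show "\<exists>k. (odometer_map p ^^ k) y \<in> U" using n by blast
qed

lemma odometer_infinite: "infinite (odometer p)"
proof
  assume fin: "finite (odometer p)"
  have "inj (\<lambda>k n. k mod (p * 2 ^ n) :: nat)"
  proof (rule injI)
    fix k l :: nat assume eq: "(\<lambda>n. k mod (p * 2 ^ n)) = (\<lambda>n. l mod (p * 2 ^ n))"
    have "(2::nat) ^ (k + l) \<le> p * 2 ^ (k + l)" using p by simp
    moreover have "k + l < 2 ^ (k + l)" by (rule less_exp)
    ultimately have "k < p * 2 ^ (k + l)" "l < p * 2 ^ (k + l)" by linarith+
    then show "k = l" using fun_cong[OF eq, of "k + l"] by simp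
  qed
  then have "infinite (range (\<lambda>k n. k mod (p * 2 ^ n) :: nat))" by (simp add: finite_image_iff)
  moreover have "range (\<lambda>k n. k mod (p * 2 ^ n)) \<subseteq> odometer p" using odometer_of_nat by blast
  ultimately show False using fin finite_subset by blast
qed

text \<open>Level \<open>m + 1\<close> is a single tower whose base is the class of the largest
  residue modulo \<open>p * 2 ^ m\<close>; adding 1 climbs towards it. The bases shrink to the point
  all of whose coordinates are maximal. Level 0 is the trivial partition, whence the index
  shift.\<close>

lemma odometer_rank: "has_ckr_rank_at_most (odometer p) (odometer_map p) 1"
proof -
  define h :: "nat \<Rightarrow> nat \<Rightarrow> nat" where "h n k = (case n of 0 \<Rightarrow> 1 | Suc m \<Rightarrow> p * 2 ^ m)" for n k
  define a :: "nat \<Rightarrow> (nat \<Rightarrow> nat) \<Rightarrow> nat \<times> nat"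
    where "a n y = (case n of 0 \<Rightarrow> (0, 0) | Suc m \<Rightarrow> (0, p * 2 ^ m - 1 - y m))" for n y
  have a_eq: "y m = z m" if "y \<in> odometer p" "z \<in> odometer p" "a (Suc m) y = a (Suc m) z" for y z m
    using that odometer_less[OF that(1), of m] odometer_less[OF that(2), of m] by (simp add: a_def)
  have top: "(\<lambda>n. p * 2 ^ n - 1) \<in> odometer p"
    unfolding odometer_def
  proof (intro CollectI allI conjI)
    fix n
    have q: "0 < p * 2 ^ n" by (rule odometer_modulus_pos)
    then show "p * 2 ^ n - 1 < p * 2 ^ n" by simp
    have "p * 2 ^ Suc n - 1 = (p * 2 ^ n - 1) + p * 2 ^ n" using q by simp
    show "(p * 2 ^ Suc n - 1) mod (p * 2 ^ n) = p * 2 ^ n - 1"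
      unfolding \<open>p * 2 ^ Suc n - 1 = _\<close> mod_add_self2 using q by simp
  qed
  have "labelled_sequence (odometer p) (odometer_map p) (\<lambda>_. 1) h a"
    unfolding labelled_sequence_def
  proof (intro conjI allI ballI impI)
    fix n
    show "tower_labelling (odometer p) (odometer_map p) 1 (h n) (a n)"
      unfolding tower_labelling_def
    proof (intro conjI allI ballI impI)
      fix y assume y: "y \<in> odometer p"
      show "fst (a n y) < 1" by (simp add: a_def split: nat.split)
      show "snd (a n y) < h n (fst (a n y))" using odometer_modulus_pos by (auto simp: a_def h_def split: nat.split)
    next
      fix k :: nat assume "k < 1"
      then show "\<exists>y\<in>odometer p. a n y = (k, 0)"
        by (intro bexI[OF _ top]) (simp add: a_def split: nat.split)
    next
      fix y k j assume y: "y \<in> odometer p" and a: "a n y = (k, Suc j)"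
      then obtain m where n: "n = Suc m" by (cases n) (auto simp: a_def)
      then have "k = 0" "p * 2 ^ m - 1 - y m = Suc j" using a by (auto simp: a_def)
      moreover from this have "odometer_map p y m = y m + 1" by (simp add: odometer_map_def)
      ultimately show "a n (odometer_map p y) = (k, j)" by (simp add: n a_def)
    next
      fix y assume y: "y \<in> odometer p" and a: "snd (a n y) = 0"
      show "snd (a n (odometer_map p y)) = h n (fst (a n (odometer_map p y))) - 1"
      proof (cases n)
        case (Suc m)
        then have "y m + 1 = p * 2 ^ m" using a odometer_less[OF y, of m] by (simp add: a_def)
        then have "odometer_map p y m = 0" by (simp add: odometer_map_def)
        then show ?thesis by (simp add: Suc a_def h_def)
      qed (simp add: a_def h_def)
    next
      fix v
      have "openin (top_of_set (odometer p)) (\<Union>y\<in>{y \<in> odometer p. a n y = v}. odometer p \<inter> {z. \<forall>i\<in>{n - 1}. z i = y i})"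
      proof (intro openin_Union)
        fix S assume "S \<in> (\<lambda>y. odometer p \<inter> {z. \<forall>i\<in>{n - 1}. z i = y i}) ` {y \<in> odometer p. a n y = v}"
        then obtain y where "S = odometer p \<inter> {z. \<forall>i\<in>{n - 1}. z i = y i}" by blast
        then show "openin (top_of_set (odometer p)) S"
          using openin_open_Int[OF open_cylinder[of "{n - 1}" y]] by simp
      qed
      moreover have "(\<Union>y\<in>{y \<in> odometer p. a n y = v}. odometer p \<inter> {z. \<forall>i\<in>{n - 1}. z i = y i}) = {y \<in> odometer p. a n y = v}"
        by (cases n) (auto simp: a_def)
      ultimately show "openin (top_of_set (odometer p)) {y \<in> odometer p. a n y = v}" by simp
    qed
  next
    fix n y assume y: "y \<in> odometer p" and a: "snd (a (Suc n) y) = 0"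
    show "snd (a n y) = 0"
    proof (cases n)
      case (Suc m)
      have "y n = p * 2 ^ n - 1" using a odometer_less[OF y, of n] by (simp add: a_def)
      then have "y m = p * 2 ^ m - 1"
        using odometer_eq_below[OF y top, of n m] Suc by simp
      then show ?thesis by (simp add: Suc a_def)
    qed (simp add: a_def)
  next
    fix n y z assume yz: "y \<in> odometer p" "z \<in> odometer p" "a (Suc n) y = a (Suc n) z"
    show "a n y = a n z"
    proof (cases n)
      case (Suc m)
      have "y m = z m" using odometer_eq_below[OF yz(1,2) a_eq[OF yz], of m] Suc by simp
      then show ?thesis by (simp add: Suc a_def)
    qed (simp add: a_def)
  next
    have "{y \<in> odometer p. \<forall>n. snd (a n y) = 0} = {\<lambda>n. p * 2 ^ n - 1}"
    proof (intro equalityI subsetI)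
      fix y assume y: "y \<in> {y \<in> odometer p. \<forall>n. snd (a n y) = 0}"
      have "y n = p * 2 ^ n - 1" for n
      proof -
        have "snd (a (Suc n) y) = 0" "y \<in> odometer p" using y by blast+
        then show ?thesis using odometer_less[of y n] by (simp add: a_def)
      qed
      then show "y \<in> {\<lambda>n. p * 2 ^ n - 1}" by (simp add: fun_eq_iff)
    next
      fix y assume "y \<in> {\<lambda>n. p * 2 ^ n - 1}"
      then show "y \<in> {y \<in> odometer p. \<forall>n. snd (a n y) = 0}" using top by (simp add: a_def split: nat.split)
    qed
    then show "\<exists>y. {y \<in> odometer p. \<forall>n. snd (a n y) = 0} = {y}" by blast
  next
    fix U y assume y: "y \<in> U" and U: "openin (top_of_set (odometer p)) U"
    obtain n where n: "\<And>z. z \<in> odometer p \<Longrightarrow> z n = y n \<Longrightarrow> z \<in> U"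
      using odometer_open_contains[OF U y] by blast
    have yY: "y \<in> odometer p" using y U openin_imp_subset by blast
    have "z \<in> U" if "z \<in> odometer p" "a (Suc n) z = a (Suc n) y" for z
      by (rule n[OF that(1) a_eq[OF that(1) yY that(2)]])
    then show "\<exists>n. \<forall>z\<in>odometer p. a n z = a n y \<longrightarrow> z \<in> U" by blast
  qed
  then show ?thesis
    by (rule labelled_sequence_rank[OF odometer_minimal odometer_infinite]) (simp_all add: h_def)
qed

lemma odometer_cantor: "minimal_cantor_system (odometer p) (odometer_map p)"
  unfolding minimal_cantor_system_def
  using odometer_minimal zero_dimensional_cantor_set[OF odometer_minimal odometer_infinite] by blast

end

text \<open>A finite minimal system is one cycle. If \<open>p\<close> is a period of
  \<open>x0\<close>, the point \<open>(T ^^ (y 0)) x0\<close> is compatible with addition modulo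
  \<open>p\<close>, and it is continuous because it depends on one coordinate.\<close>

lemma finite_minimal_odometer_factor:
  fixes X :: "'a::metric_space set"
  assumes min: "minimal_system X T" and fin: "finite X"
  shows "\<exists>p \<pi>. p \<ge> 1 \<and> factor_map (odometer p) (odometer_map p) X T \<pi>"
proof -
  note D = topological_dynamical_systemD[OF minimal_systemD(1)[OF min]]
  obtain x0 where x0: "x0 \<in> X" using D(1) by blast
  have hit: "\<exists>i. (T ^^ i) x = z" if x: "x \<in> X" and z: "z \<in> X" for x z
  proof -
    have "finite (X - {z})" using fin by simp
    then have "open (- (X - {z}))" by (intro open_Compl finite_imp_closed)
    moreover have "{z} = X \<inter> - (X - {z})" using z by blast
    ultimately have "openin (top_of_set X) {z}" by (metis openin_open_Int)
    then show ?thesis using forward_recurrence[OF min, of "{z}"] x by auto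
  qed
  have Tx: "T x0 \<in> X" using D(3) x0 by (auto simp: bij_betw_def)
  obtain i where "(T ^^ i) (T x0) = x0" using hit[OF Tx x0] by blast
  then have per: "(T ^^ Suc i) x0 = x0" by (simp add: funpow_swap1)
  define p where "p = Suc i"
  have p: "p \<ge> 1" by (simp add: p_def)
  have pmod: "(T ^^ (k mod p)) x0 = (T ^^ k) x0" for k
    by (rule funpow_mod_eq) (use per in \<open>simp add: p_def\<close>)
  define \<pi> where "\<pi> y = (T ^^ (y 0)) x0" for y :: "nat \<Rightarrow> nat"
  have "factor_map (odometer p) (odometer_map p) X T \<pi>"
    unfolding factor_map_def
  proof (intro conjI ballI)
    show "continuous_on (odometer p) \<pi>"
      unfolding \<pi>_def
      by (rule continuous_on_compose2[of UNIV "\<lambda>k. (T ^^ k) x0" _ "\<lambda>y. y 0"])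
        (auto intro: continuous_on_subset[OF continuous_on_product_coordinates])
    show "\<pi> ` odometer p = X"
    proof (intro equalityI subsetI)
      fix z assume "z \<in> X"
      then obtain k where "(T ^^ k) x0 = z" using hit[OF x0] by blast
      then have "\<pi> (\<lambda>n. k mod (p * 2 ^ n)) = z" using pmod[of k] by (simp add: \<pi>_def)
      then show "z \<in> \<pi> ` odometer p" using odometer_of_nat[OF p] by blast
    qed (auto simp: \<pi>_def funpow_mem[OF D(3) x0])
    show "\<pi> (odometer_map p y) = T (\<pi> y)" if "y \<in> odometer p" for y
      using pmod[of "Suc (y 0)"] by (simp add: \<pi>_def odometer_map_def)
  qed
  then show ?thesis using p by blast
qed

subsection \<open>S-adic subshifts as factors\<close>

text \<open>The extended natural numbers are well-ordered and the given sequence makes the set of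
  competitors nonempty, so the infimum is a minimum.\<close>

lemma subshift_alphabet_rank_attained:
  assumes "directive_sequence A \<tau>" "everywhere_growing A \<tau>"
  shows "\<exists>A' \<tau>'. directive_sequence A' \<tau>' \<and> everywhere_growing A' \<tau>' \<and>
    sadic_subshift A' \<tau>' = sadic_subshift A \<tau> \<and> alphabet_rank A' = subshift_alphabet_rank (sadic_subshift A \<tau>)"
proof -
  let ?S = "{alphabet_rank A' | A' \<tau>'. directive_sequence A' \<tau>' \<and> everywhere_growing A' \<tau>' \<and>
    sadic_subshift A' \<tau>' = sadic_subshift A \<tau>}"
  have S: "alphabet_rank A \<in> ?S" using assms by blast
  then have "(LEAST x. x \<in> ?S) \<in> ?S" by (rule LeastI)
  then have "Inf ?S \<in> ?S" using S unfolding Inf_enat_def by (metis (no_types, lifting) empty_iff)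
  then have "subshift_alphabet_rank (sadic_subshift A \<tau>) \<in> ?S" unfolding subshift_alphabet_rank_def .
  then show ?thesis
    by (elim CollectE exE conjE) (intro exI conjI, assumption+, rule sym, assumption)
qed

text \<open>Two directive sequences are at work. The given one is primitive and yields minimality
  and, when recognizable, infinitely many points. The optimal one, \<open>A'\<close>, is known only
  to be growing and supplies the long words behind the bound by the square. For infinite
  \<open>X\<close> the factor map is the inverse of a renumbering of coordinates.\<close>

theorem sadic_subshift_factor:
  assumes dir: "directive_sequence A \<tau>" and prim: "primitive_sequence A \<tau>"
    and fin: "alphabet_rank A < \<infinity>" and ne: "sadic_subshift A \<tau> \<noteq> {}"
  shows "\<exists>(Y :: (nat \<Rightarrow> nat) set) R \<pi>.
     minimal_cantor_system Y R \<and> finite_topological_rank Y R \<and>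
     enat (topological_rank Y R) \<le> (subshift_alphabet_rank (sadic_subshift A \<tau>))\<^sup>2 \<and>
     factor_map Y R (sadic_subshift A \<tau>) shift \<pi> \<and>
     (recognizable_sequence A \<tau> \<longrightarrow>
        topological_conjugacy Y R (sadic_subshift A \<tau>) shift \<pi> \<and>
        minimal_cantor_system (sadic_subshift A \<tau>) shift \<and>
        finite_topological_rank (sadic_subshift A \<tau>) shift)"
proof -
  define X where "X = sadic_subshift A \<tau>"
  have min: "minimal_system X shift" unfolding X_def by (rule primitive_minimal[OF dir prim ne])
  have X: "shift_space X"
    unfolding X_def sadic_subshift_def by (rule subshift_level_shift_space[OF dir]) (use ne in \<open>simp add: sadic_subshift_def\<close>)
  have grow: "everywhere_growing A \<tau>"
    unfolding everywhere_growing_iff[OF dir] using primitive_imp_growing[OF dir prim ne] by blast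
  obtain A' \<tau>' where A': "directive_sequence A' \<tau>'" "everywhere_growing A' \<tau>'"
    "sadic_subshift A' \<tau>' = X" "alphabet_rank A' = subshift_alphabet_rank X"
    using subshift_alphabet_rank_attained[OF dir grow] unfolding X_def by blast
  have "subshift_alphabet_rank X \<le> alphabet_rank A"
    unfolding subshift_alphabet_rank_def X_def by (rule Inf_lower) (use dir grow in blast)
  then have "subshift_alphabet_rank X < \<infinity>" using fin by (rule le_less_trans)
  then obtain r where r: "subshift_alphabet_rank X = enat r" by (elim less_infinityE)
  have r1: "r \<ge> 1" using alphabet_rank_pos[OF A'(1)] A'(4) r by (simp add: one_enat_def)
  have r2: "(subshift_alphabet_rank X)\<^sup>2 = enat (r\<^sup>2)" by (simp add: r power2_eq_square)
  show ?thesis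
  proof (cases "finite X")
    case True
    then obtain p \<pi> where p: "p \<ge> 1" "factor_map (odometer p) (odometer_map p) X shift \<pi>"
      using finite_minimal_odometer_factor[OF min] by blast
    have rank: "has_ckr_rank_at_most (odometer p) (odometer_map p) 1" by (rule odometer_rank[OF p(1)])
    then have "topological_rank (odometer p) (odometer_map p) \<le> 1"
      unfolding topological_rank_def by (rule Least_le)
    also have "1 \<le> r\<^sup>2" using r1 by simp
    finally have "enat (topological_rank (odometer p) (odometer_map p)) \<le> (subshift_alphabet_rank X)\<^sup>2"
      by (simp add: r2)
    \<comment> \<open>The claims made under recognizability hold vacuously for finite
      \<open>X\<close>.\<close>
    moreover have "\<not> recognizable_sequence A \<tau>"
      using recognizable_imp_infinite[OF dir _ prim ne] True by (auto simp: X_def)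
    ultimately show ?thesis
      using odometer_cantor[OF p(1)] rank p(2) unfolding X_def finite_topological_rank_def by blast
  next
    case inf: False
    have lw: "long_words r X"
      using growing_long_words[OF A'(1,2), of r] A'(3,4) r by simp
    obtain d h a where lab: "labelled_sequence X shift d h a" "d 0 = 1" "h 0 0 = 1" "\<And>n. d n \<le> r\<^sup>2"
      using shift_space_labelled_sequence[OF X min lw r1] by blast
    \<comment> \<open>Coordinates are renumbered by natural numbers, so that the system has the same
      type as the odometers of the finite case.\<close>
    define f :: "(int \<Rightarrow> nat) \<Rightarrow> (nat \<Rightarrow> nat)" where "f x = x \<circ> int_decode" for x
    define g :: "(nat \<Rightarrow> nat) \<Rightarrow> (int \<Rightarrow> nat)" where "g y = y \<circ> int_encode" for y
    have gf: "g (f x) = x" and fg: "f (g y) = y" for x y by (simp_all add: f_def g_def fun_eq_iff)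
    define Y where "Y = f ` X"
    define R where "R y = f (shift (g y))" for y
    have hom: "homeomorphism X Y f g"
    proof
      show "continuous_on X f"
        unfolding f_def comp_def
        by (rule continuous_on_coordinatewise_then_product)
          (rule continuous_on_subset[OF continuous_on_product_coordinates], simp)
      show "continuous_on Y g"
        unfolding g_def comp_def
        by (rule continuous_on_coordinatewise_then_product)
          (rule continuous_on_subset[OF continuous_on_product_coordinates], simp)
    qed (auto simp: Y_def gf)
    have minY: "minimal_system Y R" by (rule minimal_system_transfer[OF hom _ min]) (simp add: R_def)
    have infY: "infinite Y" unfolding Y_def using inf gf by (metis finite_imageD inj_on_inverseI)
    have bij: "bij_betw shift X X"
      using topological_dynamical_systemD(3)[OF minimal_systemD(1)[OF min]] .
    have "labelled_sequence Y R d h (\<lambda>n y. a n (g y))"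
      by (rule labelled_sequence_transfer[OF hom bij _ lab(1)]) (simp add: R_def)
    from labelled_sequence_rank[OF minY infY this lab(2,3)] lab(4)
    have rankY: "has_ckr_rank_at_most Y R (r\<^sup>2)" by blast
    then have "topological_rank Y R \<le> r\<^sup>2" unfolding topological_rank_def by (rule Least_le)
    then have "enat (topological_rank Y R) \<le> (subshift_alphabet_rank X)\<^sup>2" by (simp add: r2)
    moreover have "minimal_cantor_system Y R"
      unfolding minimal_cantor_system_def using minY zero_dimensional_cantor_set[OF minY infY] by blast
    moreover have "minimal_cantor_system X shift"
      unfolding minimal_cantor_system_def using min zero_dimensional_cantor_set[OF min inf] by blast
    moreover have "has_ckr_rank_at_most X shift (r\<^sup>2)"
      using labelled_sequence_rank[OF min inf lab(1,2,3)] lab(4) by blast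
    moreover have "topological_conjugacy Y R X shift g"
      unfolding topological_conjugacy_def factor_map_def
    proof (intro conjI ballI)
      show "continuous_on Y g" using hom by (simp add: homeomorphism_def)
      show "g ` Y = X" using hom by (simp add: homeomorphism_def)
      show "g (R y) = shift (g y)" for y by (simp add: R_def gf)
      show "bij_betw g Y X" using \<open>g ` Y = X\<close> fg by (auto simp: bij_betw_def intro: inj_on_inverseI)
    qed
    ultimately show ?thesis
      using rankY unfolding X_def finite_topological_rank_def topological_conjugacy_def by blast
  qed
qed

section \<open>Coding an expansive system by its towers\<close>

text \<open>A point of \<open>D m\<close> starts its climb through the tower number \<open>K m\<close> of level \<open>m\<close>, whose height is
  \<open>H m (K m x)\<close>.\<close>

locale tower_coding =
  fixes X :: "'a::metric_space set" and T :: "'a \<Rightarrow> 'a"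
    and D :: "nat \<Rightarrow> 'a set" and K :: "nat \<Rightarrow> 'a \<Rightarrow> nat" and H :: "nat \<Rightarrow> nat \<Rightarrow> nat"
  assumes min: "minimal_system X T" and infX: "infinite X"
    and D_0: "D 0 = X" and H_0: "H 0 k = 1"
    and fibre_open: "openin (top_of_set X) {x\<in>D m. K m x = k}"
    and D_closed: "closedin (top_of_set X) (D m)"
    and letters_finite: "finite (K m ` D m)"
    and D_Suc: "D (Suc m) \<subseteq> D m"
    and return_pos: "x \<in> D m \<Longrightarrow> 1 \<le> H m (K m x)"
    and return_mem: "x \<in> D m \<Longrightarrow> (T ^^ H m (K m x)) x \<in> D m"
    and return_first: "x \<in> D m \<Longrightarrow> 0 < j \<Longrightarrow> j < H m (K m x) \<Longrightarrow> (T ^^ j) x \<notin> D m"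
    and return_back: "y \<in> X \<Longrightarrow> \<exists>x\<in>D m. \<exists>j<H m (K m x). (T ^^ j) x = y"
    and refine_mem: "x \<in> D (Suc m) \<Longrightarrow> y \<in> D (Suc m) \<Longrightarrow> K (Suc m) x = K (Suc m) y \<Longrightarrow>
      j < H (Suc m) (K (Suc m) x) \<Longrightarrow> (T ^^ j) x \<in> D m \<Longrightarrow> (T ^^ j) y \<in> D m"
    and refine_letter: "x \<in> D (Suc m) \<Longrightarrow> y \<in> D (Suc m) \<Longrightarrow> K (Suc m) x = K (Suc m) y \<Longrightarrow>
      j < H (Suc m) (K (Suc m) x) \<Longrightarrow> (T ^^ j) x \<in> D m \<Longrightarrow> K m ((T ^^ j) x) = K m ((T ^^ j) y)"
    and separating: "x \<in> X \<Longrightarrow> y \<in> X \<Longrightarrow> x \<noteq> y \<Longrightarrow>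
      \<exists>i. K 0 (iterate_int X T i x) \<noteq> K 0 (iterate_int X T i y)"
    and tall: "\<exists>N>M. \<forall>x\<in>D N. H N (K N x) > L"
begin

section \<open>First return maps to the sets of tower tops\<close>

lemma tds: "topological_dynamical_system X T"
  by (rule minimal_systemD(1)[OF min])

lemmas bijT = topological_dynamical_systemD(3)[OF tds]

lemma D_subset: "D m \<subseteq> X"
  using D_closed[of m] closedin_imp_subset by blast

lemma D_antimono: "m \<le> n \<Longrightarrow> D n \<subseteq> D m"
  by (rule lift_Suc_antimono_le[of D]) (use D_Suc in auto)

lemma D_nonempty: "D m \<noteq> {}"
  using return_back[of _ m] topological_dynamical_systemD(1)[OF tds] by blast

lemma aperiodic:
  assumes "x \<in> X" "(T ^^ i) x = (T ^^ j) x"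
  shows "i = j"
proof -
  have "i = j" if "i \<le> j" "(T ^^ i) x = (T ^^ j) x" for i j
  proof (rule ccontr)
    assume "i \<noteq> j"
    have "(T ^^ i) ((T ^^ (j - i)) x) = (T ^^ i) x"
      using that funpow_add[of i "j - i" T] by (simp add: comp_def)
    then have "(T ^^ (j - i)) x = x"
      using inj_on_funpow[OF bijT, of i] funpow_mem[OF bijT assms(1)] assms(1) by (auto dest: inj_onD)
    moreover have "1 \<le> j - i" using that(1) \<open>i \<noteq> j\<close> by simp
    ultimately show False using periodic_imp_finite[OF min assms(1)] infX by blast
  qed
  then show ?thesis using assms(2) by (metis nat_le_linear)
qed

text \<open>The first return map of \<open>T\<close> to \<open>D m\<close>: the time is that of
  \<open>return_mem\<close>, and \<open>return_first\<close> excludes earlier returns.\<close>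

definition induced :: "nat \<Rightarrow> 'a \<Rightarrow> 'a" where
  "induced m x = (T ^^ H m (K m x)) x"

lemma induced_mem: "x \<in> D m \<Longrightarrow> induced m x \<in> D m"
  by (simp add: induced_def return_mem)

lemma induced_0: "induced 0 = T"
  by (simp add: induced_def H_0 fun_eq_iff)

lemma funpow_diff:
  assumes "x \<in> X" "y \<in> X" "(T ^^ i) x = (T ^^ j) y" "i \<le> j"
  shows "x = (T ^^ (j - i)) y"
proof -
  have "(T ^^ i) x = (T ^^ i) ((T ^^ (j - i)) y)"
    using assms(3,4) funpow_add[of i "j - i" T] by (simp add: comp_def)
  then show ?thesis
    using inj_on_funpow[OF bijT, of i] assms(1) funpow_mem[OF bijT assms(2)] by (auto dest: inj_onD)
qed

text \<open>Of two points with the same first return, the one with the longer return time would pass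
  through the other before returning. For surjectivity, the predecessor of a point of
  \<open>D m\<close> lies on some climb, and it must be the last step of it.\<close>

lemma bij_induced: "bij_betw (induced m) (D m) (D m)"
  unfolding bij_betw_def
proof (intro conjI)
  have eq: "x = y" if x: "x \<in> D m" and y: "y \<in> D m" and e: "induced m x = induced m y"
    and le: "H m (K m x) \<le> H m (K m y)" for x y
  proof -
    have xy: "x = (T ^^ (H m (K m y) - H m (K m x))) y"
      using funpow_diff[of x y] x y D_subset e le unfolding induced_def by blast
    have "\<not> 0 < H m (K m y) - H m (K m x)"
    proof
      assume "0 < H m (K m y) - H m (K m x)"
      moreover have "H m (K m y) - H m (K m x) < H m (K m y)"
        using return_pos[OF x] le by simp
      ultimately show False using return_first[OF y] xy x by metis
    qed
    then show ?thesis using xy by simp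
  qed
  show "inj_on (induced m) (D m)"
  proof (rule inj_onI)
    fix x y assume "x \<in> D m" "y \<in> D m" "induced m x = induced m y"
    then show "x = y" using eq[of x y] eq[of y x] by (cases "H m (K m x) \<le> H m (K m y)") auto
  qed
  show "induced m ` D m = D m"
  proof (intro equalityI subsetI)
    fix y assume y: "y \<in> D m"
    have "y \<in> T ` X" using bij_betw_imp_surj_on[OF bijT] y D_subset[of m] by auto
    then obtain z where z: "z \<in> X" "T z = y" by blast
    obtain x j where x: "x \<in> D m" "j < H m (K m x)" "(T ^^ j) x = z" using return_back[OF z(1)] by blast
    have yj: "(T ^^ Suc j) x = y" using x(3) z(2) by simp
    then have "\<not> Suc j < H m (K m x)" using return_first[OF x(1), of "Suc j"] y by auto
    then have "Suc j = H m (K m x)" using x(2) by simp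
    then have "induced m x = y" using yj by (simp add: induced_def)
    then show "y \<in> induced m ` D m" using x(1) by blast
  qed (auto simp: induced_mem)
qed

section \<open>Itineraries and tower words\<close>

definition itinerary :: "nat \<Rightarrow> 'a \<Rightarrow> int \<Rightarrow> nat" where
  "itinerary m x = (\<lambda>i. K m (iterate_int (D m) (induced m) i x))"

definition visits :: "nat \<Rightarrow> 'a \<Rightarrow> nat \<Rightarrow> nat list" where
  "visits m x n = map (\<lambda>j. K m ((T ^^ j) x)) (filter (\<lambda>j. (T ^^ j) x \<in> D m) [0..<n])"

text \<open>The visits on an orbit piece that ends in \<open>D m\<close> are consecutive returns,
  \<open>c\<close> in number. The last clause places the iterates of \<open>induced m\<close> at
  times below \<open>n\<close>; it serves to show that none of them, apart from the start, meets
  \<open>D (Suc m)\<close> during a climb.\<close>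

lemma visits_induced:
  assumes "x \<in> D m" "(T ^^ n) x \<in> D m"
  shows "\<exists>c. visits m x n = map (\<lambda>i. K m ((induced m ^^ i) x)) [0..<c] \<and> (induced m ^^ c) x = (T ^^ n) x \<and>
    (\<forall>i<c. \<exists>j<n. (0 < i \<longrightarrow> 0 < j) \<and> (induced m ^^ i) x = (T ^^ j) x)"
  using assms
proof (induction n arbitrary: x rule: less_induct)
  case (less n)
  show ?case
  proof (cases "n = 0")
    case True then show ?thesis by (intro exI[of _ 0]) (simp add: visits_def)
  next
    case False
    define h where "h = H m (K m x)"
    have h: "1 \<le> h" "h \<le> n" using return_pos[OF less.prems(1)] return_first[OF less.prems(1), of n] less.prems(2) False
      unfolding h_def by (auto simp: not_less[symmetric])
    define x' where "x' = induced m x"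
    have x': "x' = (T ^^ h) x" "x' \<in> D m" by (simp_all add: x'_def induced_def h_def return_mem less.prems)
    have sh: "(T ^^ j) x' = (T ^^ (j + h)) x" for j unfolding x'(1) by (simp add: funpow_add)
    obtain c where c: "visits m x' (n - h) = map (\<lambda>i. K m ((induced m ^^ i) x')) [0..<c]"
      "(induced m ^^ c) x' = (T ^^ (n - h)) x'"
      "\<forall>i<c. \<exists>j<n - h. (0 < i \<longrightarrow> 0 < j) \<and> (induced m ^^ i) x' = (T ^^ j) x'"
      using less.IH[of "n - h" x'] x'(2) h sh[of "n - h"] less.prems(2) by auto
    have "filter (\<lambda>j. (T ^^ j) x \<in> D m) [0..<h] = [0]"
    proof -
      have "[0..<h] = 0 # [1..<h]" using h(1) by (simp add: upt_conv_Cons)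
      moreover have "filter (\<lambda>j. (T ^^ j) x \<in> D m) [1..<h] = []"
        using return_first[OF less.prems(1)] by (auto simp: filter_empty_conv h_def)
      ultimately show ?thesis using less.prems(1) by simp
    qed
    moreover have "[0..<n] = [0..<h] @ map (\<lambda>j. j + h) [0..<n - h]"
      using upt_add_eq_append[of 0 h "n - h"] h(2) by (simp add: map_add_upt)
    ultimately have "visits m x n = K m x # visits m x' (n - h)"
      unfolding visits_def by (simp add: filter_map comp_def sh)
    also have "\<dots> = map (\<lambda>i. K m ((induced m ^^ i) x)) [0..<Suc c]"
      unfolding c(1) by (simp add: upt_conv_Cons x'_def funpow_swap1 map_Suc_upt[symmetric] del: upt_Suc)
    finally have "visits m x n = map (\<lambda>i. K m ((induced m ^^ i) x)) [0..<Suc c]" .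
    moreover have "(induced m ^^ Suc c) x = (T ^^ n) x"
      using c(2) sh[of "n - h"] h(2) by (simp add: x'_def funpow_swap1)
    moreover have "\<exists>j<n. (0 < i \<longrightarrow> 0 < j) \<and> (induced m ^^ i) x = (T ^^ j) x" if i: "i < Suc c" for i
    proof (cases i)
      case 0 then show ?thesis using False by (intro exI[of _ 0]) simp
    next
      case (Suc i')
      then obtain j where j: "j < n - h" "(induced m ^^ i') x' = (T ^^ j) x'" using c(3) i by auto
      then have "(induced m ^^ i) x = (T ^^ (j + h)) x" using Suc sh by (simp add: x'_def funpow_swap1)
      then show ?thesis using j(1) h(1) by (intro exI[of _ "j + h"]) auto
    qed
    ultimately show ?thesis by blast
  qed
qed

text \<open>Any point of \<open>D (Suc m)\<close> with letter \<open>k\<close> may represent the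
  tower, by \<open>refine_mem\<close> and \<open>refine_letter\<close>.\<close>

definition tower_word :: "nat \<Rightarrow> nat \<Rightarrow> nat list" where
  "tower_word m k = visits m (SOME x. x \<in> D (Suc m) \<and> K (Suc m) x = k) (H (Suc m) k)"

lemma tower_word_eq:
  assumes x: "x \<in> D (Suc m)"
  shows "tower_word m (K (Suc m) x) = visits m x (H (Suc m) (K (Suc m) x))"
proof -
  define y where "y = (SOME y. y \<in> D (Suc m) \<and> K (Suc m) y = K (Suc m) x)"
  have y: "y \<in> D (Suc m)" "K (Suc m) y = K (Suc m) x"
    using someI[of "\<lambda>y. y \<in> D (Suc m) \<and> K (Suc m) y = K (Suc m) x" x] x unfolding y_def by auto
  have mem: "(T ^^ j) y \<in> D m \<longleftrightarrow> (T ^^ j) x \<in> D m" if "j < H (Suc m) (K (Suc m) x)" for j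
    using refine_mem[OF x y(1) y(2)[symmetric] that] refine_mem[OF y(1) x y(2)] y(2) that by metis
  have "visits m y (H (Suc m) (K (Suc m) x)) = visits m x (H (Suc m) (K (Suc m) x))"
    unfolding visits_def
  proof (rule map_cong)
    show "filter (\<lambda>j. (T ^^ j) y \<in> D m) [0..<H (Suc m) (K (Suc m) x)] =
        filter (\<lambda>j. (T ^^ j) x \<in> D m) [0..<H (Suc m) (K (Suc m) x)]"
      by (rule filter_cong) (use mem in auto)
    fix j assume "j \<in> set (filter (\<lambda>j. (T ^^ j) x \<in> D m) [0..<H (Suc m) (K (Suc m) x)])"
    then show "K m ((T ^^ j) y) = K m ((T ^^ j) x)"
      using refine_letter[OF x y(1) y(2)[symmetric], of j] by simp
  qed
  then show ?thesis by (simp add: tower_word_def y_def)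
qed

text \<open>A tower word is the stretch of the itinerary of level \<open>m\<close> between two
  consecutive visits to \<open>D (Suc m)\<close>. It is nonempty because an empty one would make the
  point periodic.\<close>

lemma tower_word_induced:
  assumes x: "x \<in> D (Suc m)"
  defines "w \<equiv> tower_word m (K (Suc m) x)"
  shows "w = map (\<lambda>i. K m ((induced m ^^ i) x)) [0..<length w]"
    "(induced m ^^ length w) x = induced (Suc m) x"
    "w \<noteq> []"
    "0 < i \<Longrightarrow> i < length w \<Longrightarrow> (induced m ^^ i) x \<notin> D (Suc m)"
proof -
  have xm: "x \<in> D m" using x D_Suc by blast
  have "(T ^^ H (Suc m) (K (Suc m) x)) x \<in> D m" using return_mem[OF x] D_Suc by blast
  from visits_induced[OF xm this] obtain c where c:
    "w = map (\<lambda>i. K m ((induced m ^^ i) x)) [0..<c]" "(induced m ^^ c) x = induced (Suc m) x"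
    "\<forall>i<c. \<exists>j<H (Suc m) (K (Suc m) x). (0 < i \<longrightarrow> 0 < j) \<and> (induced m ^^ i) x = (T ^^ j) x"
    unfolding w_def tower_word_eq[OF x] by (auto simp: induced_def)
  have l: "length w = c" using c(1) by simp
  show "w = map (\<lambda>i. K m ((induced m ^^ i) x)) [0..<length w]" using c(1) l by simp
  show "(induced m ^^ length w) x = induced (Suc m) x" using c(2) l by simp
  show "w \<noteq> []"
  proof
    assume "w = []"
    then have "(T ^^ 0) x = (T ^^ H (Suc m) (K (Suc m) x)) x" using c(2) l by (simp add: induced_def)
    then have "0 = H (Suc m) (K (Suc m) x)" by (rule aperiodic[rotated]) (use x D_subset in blast)
    then show False using return_pos[OF x] by simp
  qed
  show "(induced m ^^ i) x \<notin> D (Suc m)" if i: "0 < i" "i < length w"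
  proof -
    obtain j where "j < H (Suc m) (K (Suc m) x)" "0 < j" "(induced m ^^ i) x = (T ^^ j) x"
      using c(3) i l by auto
    then show ?thesis using return_first[OF x] by metis
  qed
qed

lemma itinerary_translate:
  "x \<in> D m \<Longrightarrow> itinerary m (iterate_int (D m) (induced m) k x) = translate k (itinerary m x)"
  by (simp add: itinerary_def translate_def iterate_int_add[OF bij_induced])

lemma itinerary_tower_word_ne: "x \<in> D (Suc m) \<Longrightarrow> tower_word m (itinerary (Suc m) x k) \<noteq> []"
  using tower_word_induced(3)[OF iterate_int_mem[OF bij_induced]] by (simp add: itinerary_def)

text \<open>The length of a tower word counts the returns to \<open>D m\<close> during one return to
  \<open>D (Suc m)\<close>, so the cut positions convert one count of returns into the other.
  Backwards in time the step is cancelled by injectivity.\<close>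

lemma iterate_cut_position:
  assumes x: "x \<in> D (Suc m)"
  shows "iterate_int (D (Suc m)) (induced (Suc m)) k x =
    iterate_int (D m) (induced m) (cut_position (tower_word m) (itinerary (Suc m) x) k) x"
proof -
  let ?it = "\<lambda>k. iterate_int (D (Suc m)) (induced (Suc m)) k x"
  let ?c = "cut_position (tower_word m) (itinerary (Suc m) x)"
  have xm: "x \<in> D m" using x D_Suc by blast
  have step: "?it (k + 1) = (induced m ^^ length (tower_word m (itinerary (Suc m) x k))) (?it k)" for k
    using tower_word_induced(2)[OF iterate_int_mem[OF bij_induced x, of k]]
      iterate_int_step[OF bij_induced x, of k] by (simp add: itinerary_def)
  show ?thesis
  proof (induction k rule: int_induct[of _ 0])
    case base then show ?case by (simp add: iterate_int_0[OF bij_induced])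
  next
    case (step1 k)
    then show ?case
      using step[of k] funpow_iterate_int[OF bij_induced xm] by (simp add: cut_position_step)
  next
    case (step2 k)
    define l where "l = length (tower_word m (itinerary (Suc m) x (k - 1)))"
    have c: "?c k = ?c (k - 1) + int l" using cut_position_step[of "tower_word m" _ "k - 1"] by (simp add: l_def)
    have "(induced m ^^ l) (?it (k - 1)) = iterate_int (D m) (induced m) (?c k) x"
      using step[of "k - 1"] step2 by (simp add: l_def)
    also have "\<dots> = (induced m ^^ l) (iterate_int (D m) (induced m) (?c (k - 1)) x)"
      using funpow_iterate_int[OF bij_induced xm] by (simp add: c)
    finally show ?case
      using inj_on_funpow[OF bij_induced, of l m] iterate_int_mem[OF bij_induced xm]
        iterate_int_mem[OF bij_induced x] D_Suc by (meson inj_onD subsetD)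
  qed
qed

text \<open>At the cut number \<open>k\<close> both sides continue from the same point, the return
  number \<open>k\<close> to \<open>D (Suc m)\<close>, and its tower word lists the letters up to
  the next cut.\<close>

lemma biinfinite_ext_itinerary:
  assumes x: "x \<in> D (Suc m)"
  shows "biinfinite_ext (tower_word m) (itinerary (Suc m) x) = itinerary m x"
proof
  fix i
  let ?y = "itinerary (Suc m) x" and ?f = "tower_word m"
  have ne: "?f (?y k) \<noteq> []" for k by (rule itinerary_tower_word_ne[OF x])
  have xm: "x \<in> D m" using x D_Suc by blast
  obtain k where k: "cut_position ?f ?y k \<le> i" "i < cut_position ?f ?y (k + 1)"
    using ex_cut_position[of ?f ?y i, OF ne] by blast
  define t where "t = nat (i - cut_position ?f ?y k)"
  define z where "z = iterate_int (D (Suc m)) (induced (Suc m)) k x"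
  have z: "z \<in> D (Suc m)" unfolding z_def by (rule iterate_int_mem[OF bij_induced x])
  have yk: "?y k = K (Suc m) z" by (simp add: itinerary_def z_def)
  have t: "t < length (?f (?y k))" using k unfolding t_def cut_position_step by linarith
  have "biinfinite_ext ?f ?y i = ?f (?y k) ! t"
    using biinfinite_ext_eq[of ?f ?y k i, OF ne k] by (simp add: t_def)
  also have "\<dots> = K m ((induced m ^^ t) z)"
    using t unfolding yk by (subst tower_word_induced(1)[OF z]) simp
  also have "(induced m ^^ t) z = iterate_int (D m) (induced m) (cut_position ?f ?y k + int t) x"
    unfolding z_def iterate_cut_position[OF x] by (rule funpow_iterate_int[OF bij_induced xm])
  also have "cut_position ?f ?y k + int t = i" using k(1) by (simp add: t_def)
  finally show "biinfinite_ext ?f ?y i = itinerary m x i" by (simp add: itinerary_def)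
qed

text \<open>The itinerary of a level determines that of the level below through the morphism, so
  injectivity passes upwards from level 0, where it is the separation of points by the
  coding.\<close>

lemma itinerary_inj: "x \<in> D m \<Longrightarrow> y \<in> D m \<Longrightarrow> itinerary m x = itinerary m y \<Longrightarrow> x = y"
proof (induction m)
  case 0
  show ?case
  proof (rule ccontr)
    assume "x \<noteq> y"
    then obtain i where "K 0 (iterate_int X T i x) \<noteq> K 0 (iterate_int X T i y)"
      using separating[of x y] 0 D_0 by blast
    then show False using fun_cong[OF 0(3), of i] by (simp add: itinerary_def D_0 induced_0)
  qed
next
  case (Suc m)
  have "itinerary m x = itinerary m y"
    using biinfinite_ext_itinerary[OF Suc.prems(1)] biinfinite_ext_itinerary[OF Suc.prems(2)] Suc.prems(3) by simp
  then show ?case using Suc.IH Suc.prems D_Suc by blast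
qed

section \<open>The directive sequence of the towers, and its primitivity\<close>

definition alphabet_of :: "nat \<Rightarrow> nat set" where
  "alphabet_of m = K m ` D m"

lemma itinerary_letter: "x \<in> D m \<Longrightarrow> itinerary m x i \<in> alphabet_of m"
  using iterate_int_mem[OF bij_induced] by (simp add: itinerary_def alphabet_of_def)

lemma funpow_induced_mem: "x \<in> D m \<Longrightarrow> (induced m ^^ i) x \<in> D m"
  by (rule funpow_mem[OF bij_induced])

lemma directive: "directive_sequence alphabet_of tower_word"
  unfolding directive_sequence_def
proof (intro allI conjI ballI)
  fix m
  show "finite (alphabet_of m)" using letters_finite by (simp add: alphabet_of_def)
  show "alphabet_of m \<noteq> {}" using D_nonempty by (simp add: alphabet_of_def)
  fix a assume "a \<in> alphabet_of (Suc m)"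
  then obtain x where x: "x \<in> D (Suc m)" "a = K (Suc m) x" unfolding alphabet_of_def by blast
  show "tower_word m a \<noteq> []" using tower_word_induced(3)[OF x(1)] x(2) by simp
  have xm: "x \<in> D m" using x(1) D_Suc by blast
  have "set (map (\<lambda>i. K m ((induced m ^^ i) x)) [0..<length (tower_word m a)]) \<subseteq> alphabet_of m"
    using funpow_induced_mem[OF xm] by (auto simp: alphabet_of_def)
  then show "set (tower_word m a) \<subseteq> alphabet_of m"
    using tower_word_induced(1)[OF x(1)] x(2) by simp
qed

text \<open>Composed tower words still describe orbit pieces: \<open>l\<close> is the number of
  returns to \<open>D m\<close> during \<open>n\<close> returns to \<open>D N\<close>.\<close>

lemma morphism_comp_segment:
  assumes "m \<le> N" "x \<in> D N"
  shows "\<exists>l. morphism_comp tower_word m N (segment (itinerary N x) 0 (int n)) = segment (itinerary m x) 0 (int l) \<and>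
    (induced m ^^ l) x = (induced N ^^ n) x"
  using assms(1)
proof (induction "N - m" arbitrary: m)
  case 0
  then show ?case by auto
next
  case (Suc e)
  then have lt: "m < N" by simp
  obtain l where l: "morphism_comp tower_word (Suc m) N (segment (itinerary N x) 0 (int n)) = segment (itinerary (Suc m) x) 0 (int l)"
    "(induced (Suc m) ^^ l) x = (induced N ^^ n) x"
    using Suc.hyps(1)[of "Suc m"] Suc_diff_Suc[OF lt] Suc.hyps(2) Suc_leI[OF lt] by force
  have x: "x \<in> D (Suc m)" using D_antimono[of "Suc m" N] lt assms(2) by auto
  have xm: "x \<in> D m" using x D_Suc by blast
  let ?y = "itinerary (Suc m) x" and ?f = "tower_word m"
  have ne: "?f (?y k) \<noteq> []" for k by (rule itinerary_tower_word_ne[OF x])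
  have "cut_position ?f ?y (int l) \<ge> 0" using cut_position_ge[of ?f ?y "int l", OF ne] by simp
  then obtain l' where l': "cut_position ?f ?y (int l) = int l'" by (metis nonneg_int_cases)
  have "morphism_comp tower_word m N (segment (itinerary N x) 0 (int n)) = morphism_ext ?f (segment ?y 0 (int l))"
    using l(1) lt by (simp add: morphism_comp_step)
  also have "\<dots> = segment (itinerary m x) 0 (int l')"
    using segment_biinfinite_ext[of ?f ?y 0 "int l", OF ne] l' by (simp add: biinfinite_ext_itinerary[OF x])
  finally have 1: "morphism_comp tower_word m N (segment (itinerary N x) 0 (int n)) = segment (itinerary m x) 0 (int l')" .
  have "(induced m ^^ l') x = (induced (Suc m) ^^ l) x"
    using iterate_cut_position[OF x, of "int l"] l' by (simp add: iterate_int_of_nat[OF bij_induced])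
  then show ?case using 1 l(2) by auto
qed

lemma morphism_comp_letter:
  assumes "m \<le> N" "x \<in> D N"
  shows "\<exists>l. morphism_comp tower_word m N [K N x] = segment (itinerary m x) 0 (int l) \<and>
    (induced m ^^ l) x = induced N x"
proof -
  have "segment (itinerary N x) 0 (int 1) = [K N x]"
    by (simp add: segment_def itinerary_def iterate_int_0[OF bij_induced])
  then show ?thesis using morphism_comp_segment[OF assms, of 1] by simp
qed

lemma funpow_induced_eq_funpow: "x \<in> D m \<Longrightarrow> \<exists>j\<ge>i. (induced m ^^ i) x = (T ^^ j) x"
proof (induction i)
  case (Suc i)
  then obtain j where j: "j \<ge> i" "(induced m ^^ i) x = (T ^^ j) x" by blast
  define h where "h = H m (K m ((induced m ^^ i) x))"
  have "h \<ge> 1" unfolding h_def by (rule return_pos[OF funpow_induced_mem[OF Suc.prems]])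
  moreover have "(induced m ^^ Suc i) x = (T ^^ (h + j)) x"
    using j(2) by (simp add: induced_def h_def funpow_add)
  ultimately show ?case using j(1) by (intro exI[of _ "h + j"]) auto
qed (auto intro: exI[of _ 0])

text \<open>A visit to \<open>D m\<close> during the climb through a tower of level \<open>N\<close> contributes a letter to the
  word of this tower, since otherwise the point would be periodic.\<close>

lemma visit_letter_in_word:
  assumes "m \<le> N" "x \<in> D N" "i < H N (K N x)" "(T ^^ i) x \<in> D m"
  shows "K m ((T ^^ i) x) \<in> set (morphism_comp tower_word m N [K N x])"
proof -
  have xm: "x \<in> D m" using D_antimono[OF assms(1)] assms(2) by blast
  obtain c where c: "(induced m ^^ c) x = (T ^^ i) x" using visits_induced[OF xm assms(4)] by blast
  obtain l where l: "morphism_comp tower_word m N [K N x] = segment (itinerary m x) 0 (int l)"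
    "(induced m ^^ l) x = induced N x" using morphism_comp_letter[OF assms(1,2)] by blast
  have "c < l"
  proof (rule ccontr)
    assume "\<not> c < l"
    then have "(induced m ^^ c) x = (induced m ^^ (c - l)) ((induced m ^^ l) x)"
      using funpow_add[of "c - l" l "induced m"] by (simp add: comp_def)
    also have "\<dots> = (induced m ^^ (c - l)) (induced N x)" using l(2) by simp
    also obtain j where "\<dots> = (T ^^ j) (induced N x)"
      using funpow_induced_eq_funpow[of "induced N x" m "c - l"] induced_mem[OF assms(2)] D_antimono[OF assms(1)] by blast
    also have "\<dots> = (T ^^ (j + H N (K N x))) x" by (simp add: induced_def funpow_add)
    finally have "(T ^^ i) x = (T ^^ (j + H N (K N x))) x" using c by simp
    then have "i = j + H N (K N x)" by (rule aperiodic[rotated]) (use xm D_subset in blast)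
    then show False using assms(3) by simp
  qed
  then have "itinerary m x (int c) \<in> set (segment (itinerary m x) 0 (int l))"
    by (force simp: segment_def)
  then show ?thesis using l(1) c by (simp add: itinerary_def iterate_int_of_nat[OF bij_induced])
qed

text \<open>Every letter of level \<open>m\<close> is met from any point within a bounded time, and
  at a suitable level \<open>N\<close> all towers are taller than these bounds.\<close>

lemma primitive: "primitive_sequence alphabet_of tower_word"
  unfolding primitive_sequence_def
proof
  fix m
  have "\<exists>L. \<forall>x\<in>X. \<exists>i<L. (T ^^ i) x \<in> {x\<in>D m. K m x = a}" if "a \<in> alphabet_of m" for a
  proof (rule forward_recurrence[OF min fibre_open])
    show "{x\<in>D m. K m x = a} \<noteq> {}" using that unfolding alphabet_of_def by blast
  qed
  then obtain L where L: "\<And>a x. a \<in> alphabet_of m \<Longrightarrow> x \<in> X \<Longrightarrow> \<exists>i<L a. (T ^^ i) x \<in> {x\<in>D m. K m x = a}"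
    by metis
  have fin: "finite (alphabet_of m)" using letters_finite by (simp add: alphabet_of_def)
  define B where "B = (\<Sum>a\<in>alphabet_of m. L a)"
  have B: "L a \<le> B" if "a \<in> alphabet_of m" for a
    unfolding B_def using that fin by (intro member_le_sum) auto
  obtain N where N: "N > m" "\<And>x. x \<in> D N \<Longrightarrow> H N (K N x) > B" using tall[of m B] by blast
  have "alphabet_of m \<subseteq> set (morphism_comp tower_word m N [b])" if b: "b \<in> alphabet_of N" for b
  proof
    fix a assume a: "a \<in> alphabet_of m"
    obtain x where x: "x \<in> D N" "b = K N x" using b unfolding alphabet_of_def by blast
    obtain i where i: "i < L a" "(T ^^ i) x \<in> D m" "K m ((T ^^ i) x) = a"
      using L[OF a, of x] x(1) D_subset by blast
    have "i < H N (K N x)" using i(1) B[OF a] N(2)[OF x(1)] by linarith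
    then show "a \<in> set (morphism_comp tower_word m N [b])"
      using visit_letter_in_word[OF less_imp_le[OF N(1)] x(1) _ i(2)] i(3) x(2) by blast
  qed
  then show "\<exists>N>m. \<forall>b\<in>alphabet_of N. alphabet_of m \<subseteq> set (morphism_comp tower_word m N [b])"
    using N(1) by blast
qed

end

section \<open>Continuity of itineraries, the conjugacy and recognizability\<close>

context tower_coding
begin

text \<open>The return time is a function of the letter, which is locally constant because its
  fibres are open.\<close>

lemma induced_continuous: "continuous_on (D m) (induced m)"
  unfolding continuous_on_sequentially
proof (intro allI ballI impI)
  fix z l assume l: "l \<in> D m" and z: "(\<forall>n. z n \<in> D m) \<and> z \<longlonglongrightarrow> l"
  obtain U where U: "open U" "{x\<in>D m. K m x = K m l} = X \<inter> U"
    using fibre_open[of m "K m l"] unfolding openin_open by blast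
  have "l \<in> U" using U(2) l by blast
  then have "\<forall>\<^sub>F n in sequentially. z n \<in> U" using z U(1) topological_tendstoD by blast
  then have ev: "\<forall>\<^sub>F n in sequentially. (T ^^ H m (K m l)) (z n) = (induced m \<circ> z) n"
  proof (rule eventually_mono)
    fix n assume "z n \<in> U"
    then have "z n \<in> {x\<in>D m. K m x = K m l}" unfolding U(2) using z D_subset by blast
    then show "(T ^^ H m (K m l)) (z n) = (induced m \<circ> z) n" by (simp add: induced_def)
  qed
  have "continuous_on X (T ^^ H m (K m l))"
    using topological_dynamical_systemD(4)[OF tds] bijT
    by (intro continuous_on_funpow_self) (auto simp: bij_betw_def)
  then have "(\<lambda>n. (T ^^ H m (K m l)) (z n)) \<longlonglongrightarrow> (T ^^ H m (K m l)) l"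
  proof (rule continuous_on_tendsto_compose)
    show "z \<longlonglongrightarrow> l" using z by blast
    show "l \<in> X" using l D_subset by blast
    have "z n \<in> X" for n using z D_subset by blast
    then show "\<forall>\<^sub>F n in sequentially. z n \<in> X" by simp
  qed
  from Lim_transform_eventually[OF this ev]
  show "(induced m \<circ> z) \<longlonglongrightarrow> induced m l" unfolding induced_def[of m l] .
qed

lemma D_compact: "compact (D m)"
  using D_closed topological_dynamical_systemD(2)[OF tds] closedin_compact by blast

lemma induced_system: "topological_dynamical_system (D m) (induced m)"
  by (rule topological_dynamical_systemI[OF D_nonempty D_compact bij_induced induced_continuous])

lemma itinerary_eventually:
  assumes "\<And>n. z n \<in> D m" "l \<in> D m" "z \<longlonglongrightarrow> l"
  shows "\<forall>\<^sub>F n in sequentially. itinerary m (z n) i = itinerary m l i"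
proof -
  let ?f = "iterate_int (D m) (induced m) i"
  have fD: "?f x \<in> D m" if "x \<in> D m" for x by (rule iterate_int_mem[OF bij_induced that])
  have lim: "(\<lambda>n. ?f (z n)) \<longlonglongrightarrow> ?f l"
    by (rule continuous_on_tendsto_compose[OF continuous_on_iterate_int[OF induced_system] assms(3,2)])
      (use assms(1) in auto)
  obtain U where U: "open U" "{x\<in>D m. K m x = K m (?f l)} = X \<inter> U"
    using fibre_open[of m "K m (?f l)"] unfolding openin_open by blast
  have "?f l \<in> U" using U(2) fD[OF assms(2)] by blast
  then have "\<forall>\<^sub>F n in sequentially. ?f (z n) \<in> U" using lim U(1) topological_tendstoD by blast
  then show ?thesis
  proof (rule eventually_mono)
    fix n assume "?f (z n) \<in> U"
    then have "?f (z n) \<in> {x\<in>D m. K m x = K m (?f l)}" unfolding U(2) using fD[OF assms(1)] D_subset by blast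
    then show "itinerary m (z n) i = itinerary m l i" by (simp add: itinerary_def)
  qed
qed

text \<open>Every word of the language is a segment of the itinerary of a point of
  \<open>D m\<close>, and recentring by returns moves it to a given window. A limit of such points
  in the compact set \<open>D m\<close> has itinerary \<open>y\<close>, since each letter of an
  itinerary is locally constant.\<close>

lemma subshift_level_itinerary:
  assumes y: "y \<in> subshift_level alphabet_of tower_word m"
  shows "\<exists>x\<in>D m. y = itinerary m x"
proof -
  have "\<exists>z\<in>D m. \<forall>i. \<bar>i\<bar> \<le> int n \<longrightarrow> itinerary m z i = y i" for n
  proof -
    have "segment y (- int n) (int n + 1) \<in> language_level alphabet_of tower_word m"
      using y by (simp add: subshift_level_segment)
    then obtain N a where N: "N > m" "a \<in> alphabet_of N"
      "sublist (segment y (- int n) (int n + 1)) (morphism_comp tower_word m N [a])"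
      unfolding language_level_def by blast
    obtain x where x: "x \<in> D N" "a = K N x" using N(2) unfolding alphabet_of_def by blast
    have xm: "x \<in> D m" using x(1) D_antimono[of m N] N(1) by auto
    obtain l where l: "morphism_comp tower_word m N [a] = segment (itinerary m x) 0 (int l)"
      using morphism_comp_letter[of m N x] x N(1) by auto
    obtain u v where uv: "segment (itinerary m x) 0 (int l) = u @ segment y (- int n) (int n + 1) @ v"
      using N(3) l unfolding sublist_def by auto
    define p where "p = int (length u)"
    have "segment y (- int n) (int n + 1) @ v = segment (itinerary m x) p (int l)"
      using segment_split_eq(2)[OF uv] by (simp add: p_def)
    from segment_split_eq(1)[OF this[symmetric]]
    have seg: "segment y (- int n) (int n + 1) = segment (itinerary m x) p (p + (2 * int n + 1))" by simp
    define z where "z = iterate_int (D m) (induced m) (p + int n) x"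
    have "itinerary m z i = y i" if i: "\<bar>i\<bar> \<le> int n" for i
    proof -
      have k: "nat (i + int n) < nat (2 * int n + 1)" "int (nat (i + int n)) = i + int n" using i by linarith+
      have "segment y (- int n) (int n + 1) ! nat (i + int n) = segment (itinerary m x) p (p + (2 * int n + 1)) ! nat (i + int n)"
        using seg by simp
      then have "y (- int n + (i + int n)) = itinerary m x (p + (i + int n))"
        using k by (simp add: algebra_simps del: int_nat_eq)
      then show ?thesis
        unfolding z_def itinerary_translate[OF xm] by (simp add: translate_def algebra_simps)
    qed
    moreover have "z \<in> D m" unfolding z_def by (rule iterate_int_mem[OF bij_induced xm])
    ultimately show ?thesis by blast
  qed
  then obtain z where z: "\<And>n. z n \<in> D m" "\<And>n i. \<bar>i\<bar> \<le> int n \<Longrightarrow> itinerary m (z n) i = y i" by metis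
  obtain l r where l: "l \<in> D m" "strict_mono r" "(z \<circ> r) \<longlonglongrightarrow> l"
    using D_compact[of m] z(1) unfolding compact_def by blast
  have "itinerary m l i = y i" for i
  proof -
    have "\<forall>\<^sub>F n in sequentially. itinerary m ((z \<circ> r) n) i = itinerary m l i"
      by (rule itinerary_eventually[OF _ l(1,3)]) (simp add: z(1))
    then obtain n0 where n0: "\<And>n. n \<ge> n0 \<Longrightarrow> itinerary m (z (r n)) i = itinerary m l i"
      unfolding eventually_sequentially comp_def by blast
    define n where "n = max n0 (nat \<bar>i\<bar>)"
    have "n \<le> r n" by (rule seq_suble[OF l(2)])
    moreover have "\<bar>i\<bar> \<le> int n" unfolding n_def by linarith
    ultimately have "itinerary m (z (r n)) i = y i" by (intro z(2)) linarith
    then show ?thesis using n0[of n] by (simp add: n_def)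
  qed
  then show ?thesis using l(1) by (intro bexI[of _ l]) (simp_all add: fun_eq_iff)
qed

lemma itinerary_0: "itinerary 0 x i = K 0 (iterate_int X T i x)"
  by (simp add: itinerary_def D_0 induced_0)

text \<open>The segment is common to all points of an open set \<open>U\<close>, which every orbit
  enters in fewer than \<open>L\<close> steps. A tower taller than \<open>L + n\<close> therefore
  contains the segment in its word, which at level 0 has one letter for each step.\<close>

lemma itinerary_in_subshift:
  assumes x: "x \<in> X"
  shows "itinerary 0 x \<in> subshift_level alphabet_of tower_word 0"
  unfolding subshift_level_segment
proof (intro conjI allI impI)
  show "itinerary 0 x i \<in> alphabet_of 0" for i using itinerary_letter[of x 0] x D_0 by simp
  fix i j :: int assume ij: "i \<le> j"
  define n where "n = nat (j - i)"
  define z where "z = iterate_int X T i x"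
  have zX: "z \<in> X" unfolding z_def by (rule iterate_int_mem[OF bijT x])
  \<comment> \<open>The factor \<open>X\<close> gives the right set when \<open>n = 0\<close> and
    the intersection runs over no index.\<close>
  define U where "U = X \<inter> (\<Inter>t\<in>{..<n}. {u\<in>X. itinerary 0 u (int t) = itinerary 0 z (int t)})"
  have "openin (top_of_set X) U"
  proof (cases "n = 0")
    case False
    have "openin (top_of_set X) {u\<in>X. itinerary 0 u (int t) = itinerary 0 z (int t)}" for t
    proof -
      have "continuous_on X (T ^^ t)"
        using topological_dynamical_systemD(4)[OF tds] bijT
        by (intro continuous_on_funpow_self) (auto simp: bij_betw_def)
      then have "openin (top_of_set X) (X \<inter> (T ^^ t) -` {x\<in>D 0. K 0 x = itinerary 0 z (int t)})"
        using continuous_openin_preimage[OF _ _ fibre_open[of 0]] funpow_mem[OF bijT] by blast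
      moreover have "X \<inter> (T ^^ t) -` {x\<in>D 0. K 0 x = itinerary 0 z (int t)} =
          {u\<in>X. itinerary 0 u (int t) = itinerary 0 z (int t)}"
        using funpow_mem[OF bijT] by (auto simp: itinerary_0 iterate_int_of_nat[OF bijT] D_0)
      ultimately show ?thesis by simp
    qed
    then have "openin (top_of_set X) (\<Inter>t\<in>{..<n}. {u\<in>X. itinerary 0 u (int t) = itinerary 0 z (int t)})"
      using False by (intro openin_INT2) auto
    then show ?thesis unfolding U_def by (intro openin_Int) auto
  qed (simp add: U_def)
  moreover have "z \<in> U" using zX by (simp add: U_def)
  ultimately have "\<exists>L. \<forall>y\<in>X. \<exists>t<L. (T ^^ t) y \<in> U" by (intro forward_recurrence[OF min]) auto
  then obtain L where L: "\<forall>y\<in>X. \<exists>t<L. (T ^^ t) y \<in> U" by (elim exE)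
  obtain N where N: "N > 0" "\<And>y. y \<in> D N \<Longrightarrow> H N (K N y) > L + n" using tall[of 0 "L + n"] by blast
  obtain y where y: "y \<in> D N" using D_nonempty[of N] by blast
  have yX: "y \<in> X" using y D_subset by blast
  obtain t where t: "t < L" "(T ^^ t) y \<in> U" using L yX by blast
  obtain l where l: "morphism_comp tower_word 0 N [K N y] = segment (itinerary 0 y) 0 (int l)"
    "(induced 0 ^^ l) y = induced N y" using morphism_comp_letter[of 0 N y] y by auto
  have "(T ^^ l) y = (T ^^ H N (K N y)) y" using l(2) by (simp add: induced_0 induced_def)
  then have "l = H N (K N y)" by (rule aperiodic[OF yX])
  then have lb: "L + n < l" using N(2)[OF y] by simp
  have "segment (itinerary 0 x) i j = segment (itinerary 0 y) (int t) (int t + int n)"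
  proof (rule nth_equalityI)
    show "length (segment (itinerary 0 x) i j) = length (segment (itinerary 0 y) (int t) (int t + int n))"
      by (simp add: n_def)
    fix s assume "s < length (segment (itinerary 0 x) i j)"
    then have s: "s < n" by (simp add: n_def)
    have "itinerary 0 ((T ^^ t) y) (int s) = itinerary 0 z (int s)" using t(2) s by (simp add: U_def)
    moreover have "itinerary 0 z (int s) = itinerary 0 x (i + int s)"
      unfolding z_def itinerary_0 iterate_int_add[OF bijT x] by (simp add: add.commute)
    moreover have "itinerary 0 ((T ^^ t) y) (int s) = itinerary 0 y (int t + int s)"
      using iterate_int_add[OF bijT yX, of "int s" "int t"] unfolding itinerary_0
      by (simp add: iterate_int_of_nat[OF bijT] add.commute)
    ultimately show "segment (itinerary 0 x) i j ! s = segment (itinerary 0 y) (int t) (int t + int n) ! s"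
      using s by (simp add: n_def)
  qed
  moreover have "sublist (segment (itinerary 0 y) (int t) (int t + int n)) (segment (itinerary 0 y) 0 (int l))"
    by (rule sublist_segment) (use t(1) lb in auto)
  ultimately have "sublist (segment (itinerary 0 x) i j) (morphism_comp tower_word 0 N [K N y])"
    using l(1) by simp
  then show "segment (itinerary 0 x) i j \<in> language_level alphabet_of tower_word 0"
    unfolding language_level_def using N(1) y by (auto simp: alphabet_of_def)
qed

lemma conjugacy: "topological_conjugacy X T (sadic_subshift alphabet_of tower_word) shift (itinerary 0)"
  unfolding topological_conjugacy_def factor_map_def
proof (intro conjI ballI)
  show img: "itinerary 0 ` X = sadic_subshift alphabet_of tower_word"
    using subshift_level_itinerary[of _ 0] itinerary_in_subshift unfolding sadic_subshift_def D_0 by blast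
  show "bij_betw (itinerary 0) X (sadic_subshift alphabet_of tower_word)"
    unfolding bij_betw_def using img itinerary_inj[of _ 0] by (auto simp: D_0 inj_on_def)
  show "itinerary 0 (T x) = shift (itinerary 0 x)" if "x \<in> X" for x
    by (rule ext) (simp add: itinerary_0 shift_def iterate_int_shift[OF bijT that])
  show "continuous_on X (itinerary 0)"
  proof (rule continuous_on_coordinatewise_then_product)
    fix i
    show "continuous_on X (\<lambda>x. itinerary 0 x i)"
      unfolding continuous_on_sequentially
    proof (intro allI ballI impI)
      fix z l assume "l \<in> X" "(\<forall>n. z n \<in> X) \<and> z \<longlonglongrightarrow> l"
      then have "\<forall>\<^sub>F n in sequentially. itinerary 0 (z n) i = itinerary 0 l i"
        by (intro itinerary_eventually) (auto simp: D_0)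
      then show "((\<lambda>x. itinerary 0 x i) \<circ> z) \<longlonglongrightarrow> itinerary 0 l i"
        by (intro tendsto_eventually) (simp add: comp_def)
    qed
  qed
qed

text \<open>The sequence \<open>s\<close> determines its point because itineraries are injective.
  Two representations with \<open>k < k'\<close> would make \<open>z\<close> a return of
  \<open>z'\<close> to \<open>D (Suc m)\<close> strictly inside a tower word.\<close>

lemma recognizable: "recognizable_sequence alphabet_of tower_word"
  unfolding recognizable_sequence_def recognizable_in_def
proof (intro allI impI)
  fix m and s :: "int \<Rightarrow> nat"
  let ?P = "\<lambda>(k::nat, y). y \<in> subshift_level alphabet_of tower_word (Suc m) \<and> k < length (tower_word m (y 0)) \<and>
    s = (shift ^^ k) (biinfinite_ext (tower_word m) y)"
  have pt: "\<exists>z\<in>D (Suc m). y = itinerary (Suc m) z \<and> k < length (tower_word m (K (Suc m) z)) \<and>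
      s = itinerary m ((induced m ^^ k) z)" if "?P (k, y)" for k y
  proof -
    have P: "y \<in> subshift_level alphabet_of tower_word (Suc m)" "k < length (tower_word m (y 0))"
      "s = (shift ^^ k) (biinfinite_ext (tower_word m) y)" using that by auto
    obtain z where z: "z \<in> D (Suc m)" "y = itinerary (Suc m) z" using subshift_level_itinerary[OF P(1)] by blast
    have zm: "z \<in> D m" using z(1) D_Suc by blast
    have "s = translate (int k) (itinerary m z)" using P(3) z by (simp add: funpow_shift biinfinite_ext_itinerary)
    then have "s = itinerary m ((induced m ^^ k) z)"
      using itinerary_translate[OF zm, of "int k"] by (simp add: iterate_int_of_nat[OF bij_induced])
    moreover have "y 0 = K (Suc m) z" using z(2) by (simp add: itinerary_def iterate_int_0[OF bij_induced])
    ultimately show ?thesis using z P(2) by auto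
  qed
  have eq: "(k, y) = (k', y')" if P: "?P (k, y)" "?P (k', y')" and le: "k \<le> k'" for k y k' y'
  proof -
    obtain z where z: "z \<in> D (Suc m)" "y = itinerary (Suc m) z" "s = itinerary m ((induced m ^^ k) z)"
      using pt[OF P(1)] by blast
    obtain z' where z': "z' \<in> D (Suc m)" "y' = itinerary (Suc m) z'" "k' < length (tower_word m (K (Suc m) z'))"
      "s = itinerary m ((induced m ^^ k') z')" using pt[OF P(2)] by blast
    have m: "z \<in> D m" "z' \<in> D m" using z(1) z'(1) D_Suc by auto
    have "(induced m ^^ k) z = (induced m ^^ k') z'"
      by (rule itinerary_inj[of _ m]) (use m funpow_induced_mem z(3) z'(4) in auto)
    also have "\<dots> = (induced m ^^ k) ((induced m ^^ (k' - k)) z')"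
      using le funpow_add[of k "k' - k" "induced m"] by (simp add: comp_def)
    finally have zz: "z = (induced m ^^ (k' - k)) z'"
      using inj_on_funpow[OF bij_induced, of k m] m funpow_induced_mem[OF m(2)] by (meson inj_onD)
    have "\<not> 0 < k' - k"
    proof
      assume "0 < k' - k"
      moreover have "k' - k < length (tower_word m (K (Suc m) z'))" using z'(3) by simp
      ultimately show False using tower_word_induced(4)[OF z'(1)] zz z(1) by metis
    qed
    then show ?thesis using zz le z(2) z'(2) by simp
  qed
  show "Uniq ?P"
  proof (rule Uniq_I)
    fix p q assume P: "?P p" "?P q"
    obtain k y where p: "p = (k, y)" by (cases p)
    obtain k' y' where q: "q = (k', y')" by (cases q)
    show "p = q"
    proof (cases "k \<le> k'")
      case True
      show ?thesis unfolding p q by (rule eq[OF _ _ True]) (use P in \<open>simp_all only: p q\<close>)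
    next
      case False
      then have le: "k' \<le> k" by simp
      show ?thesis unfolding p q by (rule sym, rule eq[OF _ _ le]) (use P in \<open>simp_all only: p q\<close>)
    qed
  qed
qed

end

subsection \<open>Kakutani-Rohlin partitions give labellings\<close>

text \<open>The levels of the towers are disjoint and cover \<open>X\<close>, so each point has one
  label. That the successor of a base point is at the top of a tower comes from the condition that
  the sets \<open>T^{-h(k)}B(k)\<close> fill the base.\<close>

lemma ckr_partition_labelling:
  fixes X :: "'a::topological_space set"
  assumes ckr: "ckr_partition X T d h B" and bij: "bij_betw T X X" and cont: "continuous_on X T"
  shows "\<exists>a. tower_labelling X T d h a \<and>
    (\<forall>x\<in>X. \<forall>k<d. \<forall>j<h k. a x = (k, j) \<longleftrightarrow> x \<in> tower_level X T (B k) j)"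
proof -
  have C: "\<forall>k<d. B k \<noteq> {} \<and> openin (top_of_set X) (B k) \<and> closedin (top_of_set X) (B k) \<and> h k \<ge> 1"
    and un: "\<Union> (ckr_atoms X T d h B) = X"
    and disj: "disjoint_family_on (\<lambda>(k, j). tower_level X T (B k) j) (SIGMA k:{..<d}. {..<h k})"
    and base: "(\<Union>k<d. tower_level X T (B k) (h k)) = ckr_base d B"
    using ckr unfolding ckr_partition_def by - (elim conjE, assumption)+
  have B: "B k \<noteq> {} \<and> openin (top_of_set X) (B k) \<and> h k \<ge> 1" if "k < d" for k using C that by simp
  have BX: "B k \<subseteq> X" if "k < d" for k using B[OF that] openin_imp_subset by blast
  have TX: "T x \<in> X" if "x \<in> X" for x using bij that by (auto simp: bij_betw_def)
  have ex: "\<exists>k j. k < d \<and> j < h k \<and> x \<in> tower_level X T (B k) j" if "x \<in> X" for x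
    using un that unfolding ckr_atoms_def by blast
  have uniq: "(k, j) = (k', j')"
    if "x \<in> tower_level X T (B k) j" "x \<in> tower_level X T (B k') j'" "k < d" "j < h k" "k' < d" "j' < h k'"
    for x k j k' j'
  proof (rule ccontr)
    assume "(k, j) \<noteq> (k', j')"
    then have "tower_level X T (B k) j \<inter> tower_level X T (B k') j' = {}"
      using disjoint_family_onD[OF disj, of "(k, j)" "(k', j')"] that(3-6) by simp
    then show False using that(1,2) by blast
  qed
  obtain k0 j0 where kj: "\<And>x. x \<in> X \<Longrightarrow> k0 x < d \<and> j0 x < h (k0 x) \<and> x \<in> tower_level X T (B (k0 x)) (j0 x)"
    using ex by metis
  define a where "a x = (k0 x, j0 x)" for x
  have a: "a x = (k, j) \<longleftrightarrow> x \<in> tower_level X T (B k) j" if "x \<in> X" "k < d" "j < h k" for x k j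
    using kj[OF that(1)] uniq[of x k j "k0 x" "j0 x"] that(2,3) unfolding a_def by auto
  have "tower_labelling X T d h a"
    unfolding tower_labelling_def
  proof (intro conjI ballI allI impI)
    show "fst (a x) < d" "snd (a x) < h (fst (a x))" if "x \<in> X" for x using kj[OF that] by (simp_all add: a_def)
  next
    fix k assume k: "k < d"
    then obtain x where x: "x \<in> B k" using B by blast
    have "x \<in> X" "x \<in> tower_level X T (B k) 0" using x BX[OF k] by (auto simp: tower_level_def)
    then show "\<exists>x\<in>X. a x = (k, 0)" using a[of x k 0] k B[OF k] by force
  next
    fix x k j assume x: "x \<in> X" and e: "a x = (k, Suc j)"
    have kd: "k < d" "Suc j < h k" using kj[OF x] e by (auto simp: a_def)
    then have "x \<in> tower_level X T (B k) (Suc j)" using a[OF x] e by blast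
    then have "T x \<in> tower_level X T (B k) j" using TX[OF x] by (simp add: tower_level_def funpow_swap1)
    then show "a (T x) = (k, j)" using a[OF TX[OF x], of k j] kd by simp
  next
    fix x assume x: "x \<in> X" and "snd (a x) = 0"
    then have "x \<in> tower_level X T (B (k0 x)) 0" using kj[OF x] by (simp add: a_def)
    then have "x \<in> ckr_base d B" using kj[OF x] by (auto simp: tower_level_def ckr_base_def)
    then obtain k where k: "k < d" "x \<in> tower_level X T (B k) (h k)" using base by blast
    have hk: "h k = Suc (h k - 1)" using B[OF k(1)] by simp
    have "(T ^^ Suc (h k - 1)) x \<in> B k" using k(2) hk by (simp add: tower_level_def)
    then have "T x \<in> tower_level X T (B k) (h k - 1)" using TX[OF x] by (simp add: tower_level_def funpow_swap1)
    then have "a (T x) = (k, h k - 1)" using a[OF TX[OF x], of k "h k - 1"] k(1) hk by simp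
    then show "snd (a (T x)) = h (fst (a (T x))) - 1" by simp
  next
    fix v :: "nat \<times> nat"
    obtain k j where v: "v = (k, j)" by (cases v)
    show "openin (top_of_set X) {x \<in> X. a x = v}"
    proof (cases "k < d \<and> j < h k")
      case True
      have "continuous_on X (T ^^ j)"
        using cont bij by (intro continuous_on_funpow_self) (auto simp: bij_betw_def)
      then have "openin (top_of_set X) (X \<inter> (T ^^ j) -` B k)"
        using continuous_openin_preimage[of X "T ^^ j" X "B k"] B True funpow_mem[OF bij] by blast
      moreover have "X \<inter> (T ^^ j) -` B k = {x \<in> X. a x = v}"
        using a True by (auto simp: v tower_level_def)
      ultimately show ?thesis by simp
    next
      case False
      have "a x \<noteq> v" if "x \<in> X" for x using kj[OF that] False by (auto simp: a_def v)
      then have empty: "{x \<in> X. a x = v} = {}" by blast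
      show ?thesis unfolding empty by (rule openin_empty)
    qed
  qed
  then show ?thesis using a by blast
qed

lemma nested_ckr_labelled_sequence:
  fixes X :: "'a::topological_space set"
  assumes nest: "nested_ckr X T d h B" and bij: "bij_betw T X X" and cont: "continuous_on X T"
  shows "\<exists>a. labelled_sequence X T d h a"
proof -
  have ckr: "\<And>n. ckr_partition X T (d n) (h n) (B n)"
    and base: "\<And>n. ckr_base (d (Suc n)) (B (Suc n)) \<subseteq> ckr_base (d n) (B n)"
    and ref: "\<And>n. \<forall>P\<in>ckr_atoms X T (d (Suc n)) (h (Suc n)) (B (Suc n)).
        \<exists>Q\<in>ckr_atoms X T (d n) (h n) (B n). P \<subseteq> Q"
    and pt: "\<exists>x. (\<Inter>n. ckr_base (d n) (B n)) = {x}"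
    and span: "topology_generated_by (\<Union>n. ckr_atoms X T (d n) (h n) (B n)) = top_of_set X"
    using nest unfolding nested_ckr_def by simp_all
  have "\<forall>n. \<exists>a. tower_labelling X T (d n) (h n) a \<and>
    (\<forall>x\<in>X. \<forall>k<d n. \<forall>j<h n k. a x = (k, j) \<longleftrightarrow> x \<in> tower_level X T (B n k) j)"
    using ckr_partition_labelling[OF ckr bij cont] by blast
  from choice[OF this] obtain a where "\<forall>n. tower_labelling X T (d n) (h n) (a n) \<and>
    (\<forall>x\<in>X. \<forall>k<d n. \<forall>j<h n k. a n x = (k, j) \<longleftrightarrow> x \<in> tower_level X T (B n k) j)" by (elim exE)
  then have lab: "\<And>n. tower_labelling X T (d n) (h n) (a n)"
    and a: "\<And>n x k j. x \<in> X \<Longrightarrow> k < d n \<Longrightarrow> j < h n k \<Longrightarrow> a n x = (k, j) \<longleftrightarrow> x \<in> tower_level X T (B n k) j"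
    by blast+
  have rng: "fst (a n x) < d n" "snd (a n x) < h n (fst (a n x))" if "x \<in> X" for n x
    using label_range[OF bij lab that, of n "fst (a n x)" "snd (a n x)"] by simp_all
  have atom: "x \<in> tower_level X T (B n (fst (a n x))) (snd (a n x))" if "x \<in> X" for n x
    using a[OF that rng[OF that]] by simp
  have atomI: "tower_level X T (B n (fst (a n x))) (snd (a n x)) \<in> ckr_atoms X T (d n) (h n) (B n)" if "x \<in> X" for n x
    unfolding ckr_atoms_def using rng[OF that, of n] by blast
  have same: "a n x = a n y" if QA: "Q \<in> ckr_atoms X T (d n) (h n) (B n)" and xQ: "x \<in> Q" and yQ: "y \<in> Q" for n x y Q
  proof -
    obtain k j where Q: "Q = tower_level X T (B n k) j" "k < d n" "j < h n k" using QA unfolding ckr_atoms_def by blast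
    have "x \<in> X" "y \<in> X" using xQ yQ Q(1) by (auto simp: tower_level_def)
    then have "a n x = (k, j)" "a n y = (k, j)" using a[OF _ Q(2,3)] Q(1) xQ yQ by simp_all
    then show ?thesis by simp
  qed
  have finer: "a n x = a n y" if x: "x \<in> X" and y: "y \<in> X" and xy: "a (Suc n) x = a (Suc n) y" for n x y
  proof -
    obtain Q where Q: "Q \<in> ckr_atoms X T (d n) (h n) (B n)"
      "tower_level X T (B (Suc n) (fst (a (Suc n) x))) (snd (a (Suc n) x)) \<subseteq> Q"
      using ref[of n] atomI[OF x, of "Suc n"] by blast
    have "x \<in> Q" using Q(2) atom[OF x, of "Suc n"] by blast
    moreover have "y \<in> Q" using Q(2) atom[OF y, of "Suc n"] unfolding xy by blast
    ultimately show ?thesis by (rule same[OF Q(1)])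
  qed
  have finer_le: "a m x = a m y" if "m \<le> n" "x \<in> X" "y \<in> X" "a n x = a n y" for m n x y
    using that(1,4)
  proof (induction n rule: dec_induct)
    case (step n)
    then show ?case using finer[OF that(2,3)] by blast
  qed
  have base_iff: "x \<in> ckr_base (d n) (B n) \<longleftrightarrow> snd (a n x) = 0" if "x \<in> X" for n x
  proof
    assume "x \<in> ckr_base (d n) (B n)"
    then obtain k where k: "k < d n" "x \<in> B n k" by (auto simp: ckr_base_def)
    then have "h n k > 0" using ckr[of n] unfolding ckr_partition_def by force
    moreover have "x \<in> tower_level X T (B n k) 0" using k(2) that by (simp add: tower_level_def)
    ultimately have "a n x = (k, 0)" using a[OF that k(1), of 0] by simp
    then show "snd (a n x) = 0" by simp
  next
    assume "snd (a n x) = 0"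
    then have "x \<in> B n (fst (a n x))" using atom[OF that, of n] by (simp add: tower_level_def)
    then show "x \<in> ckr_base (d n) (B n)" using rng(1)[OF that] by (auto simp: ckr_base_def)
  qed
  have base_X: "ckr_base (d n) (B n) \<subseteq> X" for n
    using ckr[of n] unfolding ckr_partition_def ckr_base_def by (auto dest!: openin_imp_subset)
  have "labelled_sequence X T d h a"
    unfolding labelled_sequence_def
  proof (intro conjI allI ballI impI)
    show "tower_labelling X T (d n) (h n) (a n)" for n by (rule lab)
    show "snd (a n x) = 0" if "x \<in> X" "snd (a (Suc n) x) = 0" for n x
      using base_iff[OF that(1), of n] base_iff[OF that(1), of "Suc n"] base[of n] that(2) by blast
    show "a n x = a n y" if "x \<in> X" "y \<in> X" "a (Suc n) x = a (Suc n) y" for n x y by (rule finer[OF that])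
    have "{x \<in> X. \<forall>n. snd (a n x) = 0} = (\<Inter>n. ckr_base (d n) (B n))"
      using base_iff base_X by blast
    then show "\<exists>x. {x \<in> X. \<forall>n. snd (a n x) = 0} = {x}" using pt by simp
    fix U x assume x: "x \<in> U" and "openin (top_of_set X) U"
    then have "openin (topology_generated_by (\<Union>n. ckr_atoms X T (d n) (h n) (B n))) U" using span by simp
    then have "generate_topology_on (\<Union>n. ckr_atoms X T (d n) (h n) (B n)) U"
      by (simp add: openin_topology_generated_by_iff)
    \<comment> \<open>The claim is made for points of \<open>X\<close> so that it passes through the
      generation of open sets. Intersections use the larger of two levels, since labels of a higher
      level determine those below.\<close>
    then have "\<forall>x\<in>U \<inter> X. \<exists>n. \<forall>y\<in>X. a n y = a n x \<longrightarrow> y \<in> U"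
    proof induction
      case Empty then show ?case by simp
    next
      case (Int V W)
      show ?case
      proof
        fix x assume x: "x \<in> V \<inter> W \<inter> X"
        obtain n where n: "\<forall>y\<in>X. a n y = a n x \<longrightarrow> y \<in> V" using Int.IH(1) x by blast
        obtain m where m: "\<forall>y\<in>X. a m y = a m x \<longrightarrow> y \<in> W" using Int.IH(2) x by blast
        have "y \<in> V \<inter> W" if y: "y \<in> X" "a (max n m) y = a (max n m) x" for y
          using n m y(1) finer_le[of n "max n m" y x] finer_le[of m "max n m" y x] x y(2) by auto
        then show "\<exists>n. \<forall>y\<in>X. a n y = a n x \<longrightarrow> y \<in> V \<inter> W" by blast
      qed
    next
      case (UN \<K>)
      show ?case
      proof
        fix x assume "x \<in> \<Union> \<K> \<inter> X"
        then obtain V where V: "V \<in> \<K>" "x \<in> V \<inter> X" by blast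
        then obtain n where "\<forall>y\<in>X. a n y = a n x \<longrightarrow> y \<in> V" using UN.IH[OF V(1)] by blast
        then show "\<exists>n. \<forall>y\<in>X. a n y = a n x \<longrightarrow> y \<in> \<Union> \<K>" using V(1) by blast
      qed
    next
      case (Basis P)
      then obtain n where "P \<in> ckr_atoms X T (d n) (h n) (B n)" by blast
      then obtain k j where P: "P = tower_level X T (B n k) j" "k < d n" "j < h n k" unfolding ckr_atoms_def by blast
      have "y \<in> P" if "x \<in> P \<inter> X" "y \<in> X" "a n y = a n x" for x y
        using a[of x k n j] a[of y k n j] P that by auto
      then show ?case by blast
    qed
    moreover have "x \<in> X" using x \<open>openin (top_of_set X) U\<close> openin_imp_subset by blast
    ultimately show "\<exists>n. \<forall>y\<in>X. a n y = a n x \<longrightarrow> y \<in> U" using x by blast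
  qed
  then show ?thesis by blast
qed

subsection \<open>The conjugacy theorem\<close>

text \<open>A climbing point moves to a level below the top of its tower, so the tops are exactly
  the images of base points. This turns the inclusion of bases into the inclusion of the sets of
  tops used in the coding.\<close>

lemma label_top_iff:
  assumes bij: "bij_betw T X X" and lab: "tower_labelling X T d h a" and x: "x \<in> X"
  shows "snd (a (T x)) = h (fst (a (T x))) - 1 \<longleftrightarrow> snd (a x) = 0"
proof
  assume top: "snd (a (T x)) = h (fst (a (T x))) - 1"
  obtain k i where kj: "a x = (k, i)" by (cases "a x")
  show "snd (a x) = 0"
  proof (cases i)
    case (Suc j)
    then have "a (T x) = (k, j)" using label_step[OF bij lab x] kj by blast
    then have "j = h k - 1" using top by simp
    moreover have "Suc j < h k" using label_range[OF bij lab x kj] Suc by simp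
    ultimately show ?thesis by simp
  qed (simp add: kj)
next
  assume "snd (a x) = 0"
  then have "a x = (fst (a x), 0)" by (simp add: prod_eq_iff)
  then show "snd (a (T x)) = h (fst (a (T x))) - 1" by (rule label_step_base[OF bij lab x])
qed

text \<open>Pairs with equal labels at ever higher levels and distance above \<open>\<delta>\<close>
  would accumulate at a point \<open>l\<close>. Some fibre around \<open>l\<close> lies in a ball of
  radius \<open>\<delta> / 2\<close>, and both points of a late pair belong to it because labels of
  a high level determine the lower ones.\<close>

lemma labels_small_diameter:
  fixes X :: "'a::metric_space set"
  assumes seq: "labelled_sequence X T d h a" and comp: "compact X" and \<delta>: "\<delta> > 0"
  shows "\<exists>n. \<forall>x\<in>X. \<forall>y\<in>X. a n x = a n y \<longrightarrow> dist x y \<le> \<delta>"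
proof (rule ccontr)
  assume neg: "\<not> ?thesis"
  have "\<exists>x y. x \<in> X \<and> y \<in> X \<and> a n x = a n y \<and> dist x y > \<delta>" for n
    using neg by (meson not_le)
  then obtain x y where xy: "\<And>n. x n \<in> X" "\<And>n. y n \<in> X" "\<And>n. a n (x n) = a n (y n)" "\<And>n. dist (x n) (y n) > \<delta>"
    by metis
  obtain l r where l: "l \<in> X" "strict_mono r" "(x \<circ> r) \<longlonglongrightarrow> l"
    using comp xy(1) unfolding compact_def by blast
  have "l \<in> X \<inter> ball l (\<delta> / 2)" using l(1) \<delta> by simp
  moreover have "openin (top_of_set X) (X \<inter> ball l (\<delta> / 2))" by (rule openin_open_Int) simp
  ultimately have "\<exists>n. \<forall>z\<in>X. a n z = a n l \<longrightarrow> z \<in> X \<inter> ball l (\<delta> / 2)" by (rule labelled_sequenceD(5)[OF seq])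
  then obtain n where n: "\<And>z. z \<in> X \<Longrightarrow> a n z = a n l \<Longrightarrow> z \<in> ball l (\<delta> / 2)" by blast
  have "openin (top_of_set X) {z\<in>X. a n z = a n l}"
    using labelled_sequenceD(1)[OF seq, of n] unfolding tower_labelling_def by blast
  then obtain U where U: "open U" "{z\<in>X. a n z = a n l} = X \<inter> U" unfolding openin_open by blast
  have "l \<in> U" using U(2) l(1) by blast
  then have "\<forall>\<^sub>F m in sequentially. (x \<circ> r) m \<in> U" using l(3) U(1) topological_tendstoD by blast
  then obtain m0 where m0: "\<And>m. m \<ge> m0 \<Longrightarrow> x (r m) \<in> U" unfolding eventually_sequentially comp_def by blast
  define m where "m = max m0 n"
  have "x (r m) \<in> {z\<in>X. a n z = a n l}" unfolding U(2) using m0[of m] xy(1) by (simp add: m_def)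
  then have ax: "a n (x (r m)) = a n l" by simp
  have "a k (x (r m)) = a k (y (r m))" if "k \<le> r m" for k
    using that
  proof (induction "r m - k" arbitrary: k)
    case 0
    then have "k = r m" by simp
    then show ?case using xy(3) by simp
  next
    case (Suc e)
    then have "a (Suc k) (x (r m)) = a (Suc k) (y (r m))" by simp
    then show ?case by (rule labelled_sequenceD(3)[OF seq xy(1,2)])
  qed
  moreover have "n \<le> r m" using seq_suble[OF l(2), of m] by (simp add: m_def)
  ultimately have ay: "a n (y (r m)) = a n l" using ax by simp
  have "dist l (x (r m)) < \<delta> / 2" "dist l (y (r m)) < \<delta> / 2" using n[OF xy(1) ax] n[OF xy(2) ay] by auto
  then have "dist (x (r m)) (y (r m)) < \<delta>" by (rule dist_triangle_half_r)
  then show False using xy(4)[of "r m"] by simp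
qed

text \<open>Level 0 of the coding reads the atoms of level \<open>n0\<close> step by step, so its
  letters are encoded labels and its heights are 1. Level \<open>Suc p\<close> reads the towers of
  level \<open>n0 + p\<close>; thus the first morphism lists the atoms of each tower of level
  \<open>n0\<close>. From level 1 on, \<open>D m\<close> consists of tower tops, because a climb
  ends in the base.\<close>

lemma labelled_sequence_tower_coding:
  fixes X :: "'a::metric_space set"
  assumes min: "minimal_system X T" and inf: "infinite X" and seq: "labelled_sequence X T d h a"
    and sep: "\<And>x y. x \<in> X \<Longrightarrow> y \<in> X \<Longrightarrow> x \<noteq> y \<Longrightarrow> \<exists>i. a n0 (iterate_int X T i x) \<noteq> a n0 (iterate_int X T i y)"
  defines "D \<equiv> \<lambda>m. case m of 0 \<Rightarrow> X | Suc p \<Rightarrow> {x\<in>X. snd (a (n0 + p) x) = h (n0 + p) (fst (a (n0 + p) x)) - 1}"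
    and "K \<equiv> \<lambda>m x. case m of 0 \<Rightarrow> prod_encode (a n0 x) | Suc p \<Rightarrow> fst (a (n0 + p) x)"
    and "H \<equiv> \<lambda>m k. case m of 0 \<Rightarrow> 1 | Suc p \<Rightarrow> h (n0 + p) k"
  shows "tower_coding X T D K H"
proof -
  note bij = topological_dynamical_systemD(3)[OF minimal_systemD(1)[OF min]]
  note lab = labelled_sequenceD(1)[OF seq]
  have D_0: "D 0 = X" and D_Suc: "D (Suc p) = {x\<in>X. snd (a (n0 + p) x) = h (n0 + p) (fst (a (n0 + p) x)) - 1}" for p
    by (simp_all add: D_def)
  have K_0: "K 0 x = prod_encode (a n0 x)" and K_Suc: "K (Suc p) x = fst (a (n0 + p) x)" for p x by (simp_all add: K_def)
  have H_0: "H 0 k = 1" and H_Suc: "H (Suc p) k = h (n0 + p) k" for p k by (simp_all add: H_def)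
  have DX: "x \<in> X" if "x \<in> D m" for x m using that by (cases m) (simp_all add: D_0 D_Suc)
  have top: "a (n0 + p) x = (K (Suc p) x, H (Suc p) (K (Suc p) x) - 1)" if "x \<in> D (Suc p)" for x p
    using that by (simp add: D_Suc K_Suc H_Suc prod_eq_iff)
  have topI: "x \<in> D (Suc p)" "K (Suc p) x = k" if "x \<in> X" "a (n0 + p) x = (k, h (n0 + p) k - 1)" for x p k
    using that by (simp_all add: D_Suc K_Suc)
  have pos: "1 \<le> H m (K m x)" if "x \<in> D m" for x m
  proof (cases m)
    case (Suc p)
    then show ?thesis using label_range[OF bij lab DX[OF that] top[of x p]] that by (simp add: H_Suc)
  qed (simp add: H_0)
  have climb: "a (n0 + p) ((T ^^ j) x) = (K (Suc p) x, H (Suc p) (K (Suc p) x) - 1 - j)"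
    if "x \<in> D (Suc p)" "j < H (Suc p) (K (Suc p) x)" for x p j
    by (rule label_funpow[OF bij lab DX[OF that(1)] top[OF that(1)]]) (use that(2) in simp)
  have TX: "(T ^^ j) x \<in> X" if "x \<in> D m" for x m j by (rule funpow_mem[OF bij DX[OF that]])
  have refl: "a (n0 + p) ((T ^^ j) x) = a (n0 + p) ((T ^^ j) y)"
    if "x \<in> D (Suc p)" "y \<in> D (Suc p)" "K (Suc p) x = K (Suc p) y" "j < H (Suc p) (K (Suc p) x)" for x y p j
    using climb[OF that(1,4)] climb[OF that(2), of j] that(3,4) by simp
  have ref: "(T ^^ j) y \<in> D m \<and> K m ((T ^^ j) x) = K m ((T ^^ j) y)"
    if x: "x \<in> D (Suc m)" and y: "y \<in> D (Suc m)" and k: "K (Suc m) x = K (Suc m) y"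
      and j: "j < H (Suc m) (K (Suc m) x)" and mem: "(T ^^ j) x \<in> D m" for x y m j
  proof (cases m)
    case 0
    then show ?thesis using refl[OF x y k j] TX[OF y] by (simp add: D_0 K_0)
  next
    case (Suc p)
    have "a (n0 + m) ((T ^^ j) x) = a (n0 + m) ((T ^^ j) y)" by (rule refl[OF x y k j])
    then have "a (n0 + p) ((T ^^ j) x) = a (n0 + p) ((T ^^ j) y)"
      using labelled_sequenceD(3)[OF seq TX[OF x] TX[OF y], of "n0 + p"] Suc by simp
    then show ?thesis using mem TX[OF y] by (simp add: Suc D_Suc K_Suc)
  qed
  show ?thesis
  proof
    show "minimal_system X T" "infinite X" by (rule min, rule inf)
    show "D 0 = X" "H 0 k = 1" for k by (rule D_0, rule H_0)
    show "openin (top_of_set X) {x \<in> D m. K m x = k}" for m k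
    proof (cases m)
      case 0
      have "{x \<in> D m. K m x = k} = {x\<in>X. a n0 x = prod_decode k}"
        unfolding 0 D_0 K_0 by (auto simp flip: prod_encode_eq)
      then show ?thesis using label_fibre_open[OF bij lab] by simp
    next
      case (Suc p)
      have "{x \<in> D m. K m x = k} = {x\<in>X. a (n0 + p) x = (k, h (n0 + p) k - 1)}"
        unfolding Suc D_Suc K_Suc by (auto simp: prod_eq_iff)
      then show ?thesis using label_fibre_open[OF bij lab] by simp
    qed
    show "closedin (top_of_set X) (D m)" for m
    proof (cases m)
      case (Suc p)
      show ?thesis using label_fibre_closed[OF bij lab, of "n0 + p" "{v. snd v = h (n0 + p) (fst v) - 1}"]
        by (simp add: Suc D_Suc)
    qed (simp add: D_0)
    show "finite (K m ` D m)" for m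
    proof (cases m)
      case 0
      have "K m ` D m \<subseteq> prod_encode ` (SIGMA k:{..<d n0}. {..<h n0 k})"
      proof
        fix v assume "v \<in> K m ` D m"
        then obtain x where x: "x \<in> X" "v = prod_encode (a n0 x)" by (auto simp: 0 D_0 K_0)
        obtain k j where kj: "a n0 x = (k, j)" by (cases "a n0 x")
        then have "a n0 x \<in> (SIGMA k:{..<d n0}. {..<h n0 k})" using label_range[OF bij lab x(1) kj] by simp
        then show "v \<in> prod_encode ` (SIGMA k:{..<d n0}. {..<h n0 k})" unfolding x(2) by (rule imageI)
      qed
      then show ?thesis by (rule finite_subset) simp
    next
      case (Suc p)
      have "K m ` D m \<subseteq> {..<d (n0 + p)}"
        using label_range[OF bij lab DX top] by (auto simp: Suc)
      then show ?thesis by (rule finite_subset) simp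
    qed
    show "D (Suc m) \<subseteq> D m" for m
    proof (cases m)
      case 0 then show ?thesis using DX by (auto simp: D_0)
    next
      case (Suc p)
      show ?thesis
      proof
        fix x assume x: "x \<in> D (Suc m)"
        obtain z where z: "z \<in> X" "x = T z" using DX[OF x] bij_betw_imp_surj_on[OF bij] by blast
        have "snd (a (n0 + m) z) = 0"
          using x label_top_iff[OF bij lab z(1), of "n0 + m"] z(2) by (simp add: D_Suc)
        then have "snd (a (n0 + p) z) = 0" using labelled_sequenceD(2)[OF seq z(1), of "n0 + p"] Suc by simp
        then show "x \<in> D m"
          using label_top_iff[OF bij lab z(1), of "n0 + p"] z(2) DX[OF x] by (simp add: Suc D_Suc)
      qed
    qed
    show "1 \<le> H m (K m x)" if "x \<in> D m" for x m by (rule pos[OF that])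
    show "(T ^^ H m (K m x)) x \<in> D m" if x: "x \<in> D m" for x m
    proof (cases m)
      case 0 then show ?thesis using TX[OF x] by (simp add: D_0)
    next
      case (Suc p)
      define l where "l = H m (K m x)"
      have l: "l \<ge> 1" using pos[OF x] by (simp add: l_def)
      define z where "z = (T ^^ (l - 1)) x"
      have "snd (a (n0 + p) z) = 0" using climb[of x p "l - 1"] x l by (simp add: Suc l_def z_def)
      moreover have "z \<in> X" unfolding z_def by (rule TX[OF x])
      ultimately have "snd (a (n0 + p) (T z)) = h (n0 + p) (fst (a (n0 + p) (T z))) - 1"
        using label_top_iff[OF bij lab] by blast
      moreover have "T z = (T ^^ l) x" using funpow.simps(2)[of "l - 1" T] l by (simp add: z_def)
      ultimately have "(T ^^ l) x \<in> D m" using TX[OF x, of l] by (simp add: Suc D_Suc)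
      then show ?thesis unfolding l_def .
    qed
    show "(T ^^ j) x \<notin> D m" if x: "x \<in> D m" and j: "0 < j" "j < H m (K m x)" for x m j
    proof (cases m)
      case 0 then show ?thesis using j by (simp add: H_0)
    next
      case (Suc p)
      have "a (n0 + p) ((T ^^ j) x) = (K m x, H m (K m x) - 1 - j)" using climb[of x p j] x j by (simp add: Suc)
      then show ?thesis using j by (auto simp: Suc D_Suc H_Suc)
    qed
    show "\<exists>x\<in>D m. \<exists>j<H m (K m x). (T ^^ j) x = y" if y: "y \<in> X" for y m
    proof (cases m)
      case 0
      show ?thesis by (rule bexI[of _ y], rule exI[of _ 0]) (use y in \<open>simp_all add: 0 D_0 H_0\<close>)
    next
      case (Suc p)
      obtain k i where ki: "a (n0 + p) y = (k, i)" by (cases "a (n0 + p) y")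
      have i: "i < h (n0 + p) k" using label_range[OF bij lab y ki] by simp
      define j where "j = h (n0 + p) k - 1 - i"
      obtain x where x: "x \<in> X" "(T ^^ j) x = y" using funpow_surj[OF bij y] by blast
      have "a (n0 + p) x = (k, i + j)"
        by (rule label_backward[OF bij lab x(1)]) (use x(2) ki i in \<open>simp_all add: j_def\<close>)
      then have "a (n0 + p) x = (k, h (n0 + p) k - 1)" using i by (simp add: j_def)
      note t = topI[OF x(1) this]
      have "j < H m (K m x)" using t(2) i by (simp add: Suc H_Suc j_def)
      then show ?thesis using t(1) x(2) Suc by blast
    qed
    show "(T ^^ j) y \<in> D m"
      if "x \<in> D (Suc m)" "y \<in> D (Suc m)" "K (Suc m) x = K (Suc m) y" "j < H (Suc m) (K (Suc m) x)" "(T ^^ j) x \<in> D m"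
      for x y m j using ref[OF that] by blast
    show "K m ((T ^^ j) x) = K m ((T ^^ j) y)"
      if "x \<in> D (Suc m)" "y \<in> D (Suc m)" "K (Suc m) x = K (Suc m) y" "j < H (Suc m) (K (Suc m) x)" "(T ^^ j) x \<in> D m"
      for x y m j using ref[OF that] by blast
    show "\<exists>i. K 0 (iterate_int X T i x) \<noteq> K 0 (iterate_int X T i y)" if "x \<in> X" "y \<in> X" "x \<noteq> y" for x y
      using sep[OF that] by (simp add: K_0)
    show "\<exists>N>M. \<forall>x\<in>D N. L < H N (K N x)" for M L
    proof -
      obtain N where N: "N \<ge> n0 + M" "\<And>k. k < d N \<Longrightarrow> h N k > L"
        using labelled_sequence_heights_unbounded[OF min inf seq] by blast
      have "L < H (Suc (N - n0)) (K (Suc (N - n0)) x)" if x: "x \<in> D (Suc (N - n0))" for x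
        using label_range[OF bij lab DX[OF x] top[OF x]] N by (simp add: H_Suc)
      then show ?thesis using N(1) by (intro exI[of _ "Suc (N - n0)"]) auto
    qed
  qed
qed

theorem expansive_sadic_conjugacy:
  fixes X :: "'a::metric_space set"
  assumes cant: "minimal_cantor_system X T" and exp: "expansive X T" and rank: "finite_topological_rank X T"
  shows "\<exists>A \<tau> \<pi>. directive_sequence A \<tau> \<and> primitive_sequence A \<tau> \<and> recognizable_sequence A \<tau> \<and>
    alphabet_rank A < \<infinity> \<and> topological_conjugacy X T (sadic_subshift A \<tau>) shift \<pi> \<and>
    alphabet_rank A \<le> enat (topological_rank X T)"
proof -
  define r where "r = topological_rank X T"
  have min: "minimal_system X T" using cant by (simp add: minimal_cantor_system_def)
  note S = topological_dynamical_systemD[OF minimal_systemD(1)[OF min]]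
  obtain x where "x \<in> X" "x islimpt X" using cant by (auto simp: minimal_cantor_system_def cantor_set_def)
  then have inf: "infinite X" using islimpt_finite by blast
  have "has_ckr_rank_at_most X T r"
    unfolding r_def topological_rank_def using rank unfolding finite_topological_rank_def by (rule LeastI_ex)
  then obtain d h B where nest: "nested_ckr X T d h B" and dr: "\<And>n. d n \<le> r"
    unfolding has_ckr_rank_at_most_def by blast
  obtain a where seq: "labelled_sequence X T d h a"
    using nested_ckr_labelled_sequence[OF nest S(3,4)] by blast
  obtain \<delta> where \<delta>: "\<delta> > 0" "\<forall>x\<in>X. \<forall>y\<in>X. x \<noteq> y \<longrightarrow> (\<exists>n. dist (iterate_int X T n x) (iterate_int X T n y) > \<delta>)"
    using exp unfolding expansive_def by blast
  obtain n0 where n0: "\<And>x y. x \<in> X \<Longrightarrow> y \<in> X \<Longrightarrow> a n0 x = a n0 y \<Longrightarrow> dist x y \<le> \<delta>"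
    using labels_small_diameter[OF seq S(2) \<delta>(1)] by blast
  have sep: "\<exists>i. a n0 (iterate_int X T i x) \<noteq> a n0 (iterate_int X T i y)" if x: "x \<in> X" and y: "y \<in> X" and neq: "x \<noteq> y" for x y
  proof -
    obtain i where "dist (iterate_int X T i x) (iterate_int X T i y) > \<delta>" using \<delta>(2) x y neq by blast
    then show ?thesis
      using n0[OF iterate_int_mem[OF S(3) x] iterate_int_mem[OF S(3) y], of i i] by (meson leD)
  qed
  define D where "D = (\<lambda>m. case m of 0 \<Rightarrow> X | Suc p \<Rightarrow> {x\<in>X. snd (a (n0 + p) x) = h (n0 + p) (fst (a (n0 + p) x)) - 1})"
  define K where "K = (\<lambda>m x. case m of 0 \<Rightarrow> prod_encode (a n0 x) | Suc p \<Rightarrow> fst (a (n0 + p) x))"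
  define H where "H = (\<lambda>m k. case m of 0 \<Rightarrow> 1 | Suc p \<Rightarrow> h (n0 + p) k)"
  interpret tower_coding X T D K H
    unfolding D_def K_def H_def by (rule labelled_sequence_tower_coding[OF min inf seq sep])
  \<comment> \<open>The bound holds from level 1 on. Level 0 has the atoms as letters, of which
    there may be more, but a single level does not affect the lower limit.\<close>
  have card: "card (alphabet_of (Suc p)) \<le> r" for p
  proof -
    have "alphabet_of (Suc p) \<subseteq> {..<d (n0 + p)}"
    proof
      fix k assume "k \<in> alphabet_of (Suc p)"
      then obtain x where x: "x \<in> X" "k = fst (a (n0 + p) x)"
        unfolding alphabet_of_def by (auto simp: D_def K_def)
      then show "k \<in> {..<d (n0 + p)}"
        using label_range[OF S(3) labelled_sequenceD(1)[OF seq] x(1), of "n0 + p" k "snd (a (n0 + p) x)"] by simp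
    qed
    then have "card (alphabet_of (Suc p)) \<le> card {..<d (n0 + p)}" by (intro card_mono) auto
    then show ?thesis using dr[of "n0 + p"] by simp
  qed
  have "\<forall>\<^sub>F n in sequentially. enat (card (alphabet_of n)) \<le> enat r"
    unfolding eventually_sequentially
  proof (intro exI[of _ 1] allI impI)
    fix n :: nat assume "1 \<le> n"
    then obtain p where "n = Suc p" by (cases n) auto
    then show "enat (card (alphabet_of n)) \<le> enat r" using card by simp
  qed
  then have "alphabet_rank alphabet_of \<le> liminf (\<lambda>n. enat r)"
    unfolding alphabet_rank_def by (rule Liminf_mono)
  then have ar: "alphabet_rank alphabet_of \<le> enat r" by (simp add: Liminf_const)
  then have "alphabet_rank alphabet_of < \<infinity>" by (rule le_less_trans) simp
  then show ?thesis using ar directive primitive recognizable conjugacy unfolding r_def by blast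
qed

theorem theorem4p1:
  shows
  "(\<forall>(X :: 'a::metric_space set) T.
      minimal_cantor_system X T \<and> expansive X T \<and> finite_topological_rank X T \<longrightarrow>
      (\<exists>A \<tau> \<pi>. directive_sequence A \<tau> \<and> primitive_sequence A \<tau> \<and> recognizable_sequence A \<tau> \<and>
         alphabet_rank A < \<infinity> \<and>
         topological_conjugacy X T (sadic_subshift A \<tau>) shift \<pi> \<and>
         alphabet_rank A \<le> enat (topological_rank X T)))
   \<and>
   (\<forall>A \<tau>. directive_sequence A \<tau> \<and> primitive_sequence A \<tau> \<and> alphabet_rank A < \<infinity> \<and>
      sadic_subshift A \<tau> \<noteq> {} \<longrightarrow>
      minimal_system (sadic_subshift A \<tau>) shift \<and>
      (\<exists>(Y :: (nat \<Rightarrow> nat) set) R \<pi>.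
         minimal_cantor_system Y R \<and> finite_topological_rank Y R \<and>
         enat (topological_rank Y R) \<le> (subshift_alphabet_rank (sadic_subshift A \<tau>))\<^sup>2 \<and>
         factor_map Y R (sadic_subshift A \<tau>) shift \<pi> \<and>
         (recognizable_sequence A \<tau> \<longrightarrow>
            topological_conjugacy Y R (sadic_subshift A \<tau>) shift \<pi> \<and>
            minimal_cantor_system (sadic_subshift A \<tau>) shift \<and>
            finite_topological_rank (sadic_subshift A \<tau>) shift)))"
proof (intro conjI allI impI)
  fix X :: "'a::metric_space set" and T
  assume "minimal_cantor_system X T \<and> expansive X T \<and> finite_topological_rank X T"
  then show "\<exists>A \<tau> \<pi>. directive_sequence A \<tau> \<and> primitive_sequence A \<tau> \<and> recognizable_sequence A \<tau> \<and>
         alphabet_rank A < \<infinity> \<and>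
         topological_conjugacy X T (sadic_subshift A \<tau>) shift \<pi> \<and>
         alphabet_rank A \<le> enat (topological_rank X T)"
    by (intro expansive_sadic_conjugacy) blast+
next
  fix A \<tau>
  assume *: "directive_sequence A \<tau> \<and> primitive_sequence A \<tau> \<and> alphabet_rank A < \<infinity> \<and> sadic_subshift A \<tau> \<noteq> {}"
  then show "minimal_system (sadic_subshift A \<tau>) shift" by (intro primitive_minimal) blast+
  show "\<exists>(Y :: (nat \<Rightarrow> nat) set) R \<pi>.
         minimal_cantor_system Y R \<and> finite_topological_rank Y R \<and>
         enat (topological_rank Y R) \<le> (subshift_alphabet_rank (sadic_subshift A \<tau>))\<^sup>2 \<and>
         factor_map Y R (sadic_subshift A \<tau>) shift \<pi> \<and>
         (recognizable_sequence A \<tau> \<longrightarrow>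
            topological_conjugacy Y R (sadic_subshift A \<tau>) shift \<pi> \<and>
            minimal_cantor_system (sadic_subshift A \<tau>) shift \<and>
            finite_topological_rank (sadic_subshift A \<tau>) shift)"
    using * by (intro sadic_subshift_factor) blast+
qed

end
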